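(* Let $d\geq 2$. Every pre-Lagrangian toric fiber in the contact toric manifold $\mathbb{T}^d\times\mathbb{S}^{d-1}$ (the cosphere bundle of $\mathbb{T}^d$) with its standard contact structure, i.e. every submanifold $\mathbb{T}^d\times\{p\}$ with $p\in\mathbb{S}^{d-1}$, is non-displaceable.
   Context: Here $\mathbb{T}^d\times\mathbb{S}^{d-1}=\{(e^{2\pi i\theta_1},\ldots,e^{2\pi i\theta_d},x_1,\ldots,x_d)\in\mathbb{T}^d\times\mathbb{R}^d : \sum_{i=1}^d x_i^2=1\}$ carries the contact structure $\ker\left(\sum_{i=1}^d x_i\,d\theta_i\right)$, and $\mathbb{T}^d$ acts by multiplication on the $\mathbb{T}^d$ factor. The pre-Lagrangian toric fibers are the orbits $\mathbb{T}^d\times\{p\}$, $p\in\mathbb{S}^{d-1}$. A contact isotopy of a contact manifold $(V,\xi)$ is a smooth family $\{\varphi_t\}_{t\in[0,1]}$ of diffeomorphisms of $V$ preserving $\xi$. A subset $L\subset V$ is called non-displaceable if $\varphi_1(L)\cap L\neq\emptyset$ for every contact isotopy $\{\varphi_t\}_{t\in[0,1]}$ of $(V,\xi)$ with $\varphi_0=\mathrm{id}$. *)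

theory Defs
  imports "HOL-Analysis.Analysis"
begin

(* Only meaningful for open U: derivatives are taken in the ambient space. In finite
   dimension, continuity of iterated directional derivatives gives the usual C^k. *)
primrec Ck_on :: "nat \<Rightarrow> ('a::euclidean_space) set \<Rightarrow> ('a \<Rightarrow> 'b::euclidean_space) \<Rightarrow> bool" where
  "Ck_on 0 U f \<longleftrightarrow> continuous_on U f"
| "Ck_on (Suc k) U f \<longleftrightarrow>
     (\<forall>x\<in>U. f differentiable (at x)) \<and>
     (\<forall>v. Ck_on k U (\<lambda>x. frechet_derivative f (at x) v))"

(* Smoothness on an arbitrary subset A of a Euclidean space: local extension to a
   smooth map on an open set. For embedded submanifolds (possibly with boundary or
   corners, such as [0,1] x M) this is smoothness in the manifold sense. *)
definition smooth_on :: "('a::euclidean_space) set \<Rightarrow> ('a \<Rightarrow> 'b::euclidean_space) \<Rightarrow> bool" where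
  "smooth_on A f \<longleftrightarrow>
     (\<forall>x\<in>A. \<exists>U g. open U \<and> x \<in> U \<and> (\<forall>k. Ck_on k U g) \<and> (\<forall>y\<in>A \<inter> U. g y = f y))"

definition diffeomorphism_of :: "('a::euclidean_space) set \<Rightarrow> ('a \<Rightarrow> 'a) \<Rightarrow> bool" where
  "diffeomorphism_of M f \<longleftrightarrow>
     bij_betw f M M \<and> smooth_on M f \<and> smooth_on M (inv_into M f)"

definition tangent_space :: "('a::euclidean_space) set \<Rightarrow> 'a \<Rightarrow> 'a set" where
  "tangent_space M q =
     {v. \<exists>\<gamma> e. e > 0 \<and> smooth_on {-e<..<e} \<gamma> \<and> \<gamma> ` {-e<..<e} \<subseteq> M \<and>
           \<gamma> 0 = q \<and> (\<gamma> has_vector_derivative v) (at (0::real))}"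

(* A distribution on M assigns to q in M a subspace \<xi> q of tangent_space M q. On a
   submanifold, D below is determined on tangent_space M q (where it is the
   differential of f) though not on the ambient space, so the condition does not
   depend on the choice of D. *)
definition preserves_distribution ::
    "('a::euclidean_space) set \<Rightarrow> ('a \<Rightarrow> 'a set) \<Rightarrow> ('a \<Rightarrow> 'a) \<Rightarrow> bool" where
  "preserves_distribution M \<xi> f \<longleftrightarrow>
     (\<forall>q\<in>M. \<exists>D. (f has_derivative D) (at q within M) \<and> D ` \<xi> q = \<xi> (f q))"

definition contact_isotopy ::
    "('a::euclidean_space) set \<Rightarrow> ('a \<Rightarrow> 'a set) \<Rightarrow> (real \<Rightarrow> 'a \<Rightarrow> 'a) \<Rightarrow> bool" where
  "contact_isotopy M \<xi> \<phi> \<longleftrightarrow>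
     smooth_on ({0..1} \<times> M) (\<lambda>(t, q). \<phi> t q) \<and>
     (\<forall>t\<in>{0..1}. diffeomorphism_of M (\<phi> t) \<and> preserves_distribution M \<xi> (\<phi> t))"

definition non_displaceable ::
    "('a::euclidean_space) set \<Rightarrow> ('a \<Rightarrow> 'a set) \<Rightarrow> 'a set \<Rightarrow> bool" where
  "non_displaceable M \<xi> L \<longleftrightarrow>
     (\<forall>\<phi>. contact_isotopy M \<xi> \<phi> \<and> (\<forall>q\<in>M. \<phi> 0 q = q) \<longrightarrow> \<phi> 1 ` L \<inter> L \<noteq> {})"

definition torus :: "(complex ^ 'n) set" where
  "torus = {\<chi> i. cis (2 * pi * \<theta> $ i) | \<theta> :: real ^ 'n. True}"

definition torus_sphere :: "((complex ^ 'n) \<times> (real ^ 'n)) set" where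
  "torus_sphere = torus \<times> sphere 0 1"

(* The form sum_i x_i d\<theta>_i at (z, x), evaluated on (w, u). Since
   z_i = exp (2 pi i \<theta>_i), we have dz_i / z_i = 2 pi i d\<theta>_i. *)
definition contact_form ::
    "(complex ^ 'n) \<times> (real ^ 'n) \<Rightarrow> (complex ^ 'n) \<times> (real ^ 'n) \<Rightarrow> real" where
  "contact_form = (\<lambda>(z, x) (w, u). \<Sum>i\<in>UNIV. x $ i * (Im (w $ i / z $ i) / (2 * pi)))"

definition standard_contact_structure ::
    "(complex ^ 'n) \<times> (real ^ 'n) \<Rightarrow> ((complex ^ 'n) \<times> (real ^ 'n)) set" where
  "standard_contact_structure q = {v \<in> tangent_space torus_sphere q. contact_form q v = 0}"

end

theory Submission
  imports Defs
begin

text \<open>A contact isotopy is a composition of \<open>C\<^sup>1\<close>-small contact maps. Each of these lifts to a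
  homogeneous symplectic map \<open>(q, p) \<mapsto> (Q, P)\<close> of \<open>\<real>\<^sup>d \<times> (\<real>\<^sup>d - 0)\<close>, periodic in \<open>q\<close>, with
  \<open>P \<bullet> dQ = p \<bullet> dq\<close>, and hence has a generating function \<open>s(Q, p)\<close>. Trajectories of the composition
  that start and end with momentum \<open>p\<close> are the critical points of a discrete action functional
  (broken geodesics in the sense of Chaperon). After a cutoff of the generating functions this
  functional is a nondegenerate quadratic form plus a perturbation that is bounded together with
  its gradient, except for one torus direction, so it has a critical point by a saddle point
  argument: iterated gradient descent, with Brouwer's theorem in the negative directions of the
  form as the linking input.\<close>

subsection \<open>Brouwer's theorem in \<open>\<real>\<^sup>n\<close> for variable \<open>n\<close>\<close>

text \<open>The lift turns the fiber over \<open>p\<close> into the Lagrangian torus of all (q, p)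
  with this exact momentum, a translate of the zero section in the cotangent bundle of the torus.
  Prescribing \<open>p\<close> itself at both ends, and not only its ray, makes the question a
  Lagrangian intersection problem, and a solution projects to a point of the fiber whose image lies
  in the fiber. The obstacle is homogeneity: the generating functions of the lifts are singular at p
  = 0 and grow linearly in p, so before the cutoff they are not bounded perturbations of anything.
  The number of variables is governed by the number of small maps, hence by the isotopy, so the
  variables are functions on \<open>nat\<close> with the product topology. Since a single critical
  point is wanted, no homology of the torus enters. The torus direction is degenerate for the
  quadratic form, but integer translations preserve the gradient and bring it into a compact box,
  where almost critical points accumulate at a critical one.\<close>

lemma compact_fun_box:
  fixes S :: "'i \<Rightarrow> 'b::topological_space set"
  assumes "\<And>i. compact (S i)"
  shows "compact {x. \<forall>i. x i \<in> S i}"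
proof -
  have "compactin (product_topology (\<lambda>i. euclidean) UNIV) (PiE UNIV S)"
    using assms by (simp add: compactin_PiE)
  moreover have "PiE UNIV S = {x. \<forall>i. x i \<in> S i}"
    by (auto simp: PiE_def)
  ultimately show ?thesis
    by (simp add: euclidean_product_topology)
qed

lemma tendsto_fun_iff:
  fixes X :: "'a \<Rightarrow> 'i \<Rightarrow> 'b::topological_space"
  shows "(X \<longlongrightarrow> l) F \<longleftrightarrow> (\<forall>i. ((\<lambda>a. X a i) \<longlongrightarrow> l i) F)"
  using limitin_componentwise[of "\<lambda>i. euclidean" UNIV X l F]
  by (simp add: euclidean_product_topology)

text \<open>The number of variables will depend on the isotopy, so the dimension cannot be a type.\<close>

lemma brouwer_nat_real:
  fixes H :: "(nat \<Rightarrow> real) \<Rightarrow> nat \<Rightarrow> real"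
  assumes cont: "\<And>i. i < n \<Longrightarrow> continuous_on UNIV (\<lambda>x. H x i)"
    and bound: "\<And>x i. i < n \<Longrightarrow> \<bar>H x i\<bar> < R"
  obtains x where "\<And>i. i < n \<Longrightarrow> H x i = x i" and "\<And>i. i \<ge> n \<Longrightarrow> x i = 0"
proof (cases "n = 0")
  case True
  then show ?thesis using that[of "\<lambda>_. 0"] by auto
next
  case False
  then have "R > 0" using bound[of 0] by fastforce
  \<comment> \<open>The point of the cube [-R, R]^n with grid coordinates \<open>x\<close>, for p
    cells along each edge. The later coordinates are 0, so that limits exist in a compact
    product.\<close>
  define z where "z p x = (\<lambda>i. if i < n then - R + 2 * R * (real (x i) / real p) else 0)"
    for p :: nat and x :: "nat \<Rightarrow> nat"
  define lab where "lab p x i = (if H (z p x) i < z p x i then 1 else 0::nat)" for p x i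
  define nb where "nb q r \<longleftrightarrow> (\<forall>j<n. q j \<le> r j \<and> r j \<le> q j + 1)" for q r :: "nat \<Rightarrow> nat"
  have ex: "\<exists>q. (\<forall>i<n. q i < p) \<and> (\<forall>i<n. \<exists>r s. nb q r \<and> nb q s \<and>
      H (z p r) i < z p r i \<and> H (z p s) i \<ge> z p s i)" if "p > 0" for p
  proof -
    \<comment> \<open>The strict bound by R places H strictly above the lower faces and strictly
      below the upper ones, which is the boundary condition of Kuhn's lemma.\<close>
    have lab0: "lab p x i = 0" if "i < n" "x i = 0" for x i
      using bound[OF \<open>i < n\<close>, of "z p x"] that by (auto simp: lab_def z_def)
    have lab1: "lab p x i = 1" if "i < n" "x i = p" for x i
      using bound[OF \<open>i < n\<close>, of "z p x"] that \<open>p > 0\<close> by (auto simp: lab_def z_def)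
    obtain q where q: "\<forall>i<n. q i < p"
      "\<forall>i<n. \<exists>r s. (\<forall>j<n. q j \<le> r j \<and> r j \<le> q j + 1) \<and> (\<forall>j<n. q j \<le> s j \<and> s j \<le> q j + 1)
         \<and> lab p r i \<noteq> lab p s i"
      by (rule kuhn_lemma[OF \<open>p > 0\<close>, of n "lab p"]) (use lab0 lab1 in \<open>auto simp: lab_def\<close>)
    have "\<exists>r s. nb q r \<and> nb q s \<and> H (z p r) i < z p r i \<and> H (z p s) i \<ge> z p s i" if i: "i < n" for i
    proof -
      obtain r s where rs: "nb q r" "nb q s" "lab p r i \<noteq> lab p s i"
        using q(2) i by (auto simp: nb_def)
      show ?thesis
      proof (cases "H (z p r) i < z p r i")
        case True
        then have "\<not> H (z p s) i < z p s i" using rs(3) by (auto simp: lab_def)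
        then show ?thesis using True rs by (intro exI[of _ r] exI[of _ s]) auto
      next
        case False
        then have "H (z p s) i < z p s i" using rs(3) by (auto simp: lab_def split: if_splits)
        then show ?thesis using False rs by (intro exI[of _ s] exI[of _ r]) auto
      qed
    qed
    then show ?thesis using q(1) by auto
  qed
  have "\<forall>k. \<exists>q. (\<forall>i<n. q i < Suc k) \<and> (\<forall>i<n. \<exists>r s. nb q r \<and> nb q s \<and>
      H (z (Suc k) r) i < z (Suc k) r i \<and> H (z (Suc k) s) i \<ge> z (Suc k) s i)"
    using ex by blast
  then obtain q where q: "\<And>k i. i < n \<Longrightarrow> q k i < Suc k"
    and rs: "\<And>k i. i < n \<Longrightarrow> \<exists>r s. nb (q k) r \<and> nb (q k) s \<and>
      H (z (Suc k) r) i < z (Suc k) r i \<and> H (z (Suc k) s) i \<ge> z (Suc k) s i"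
    by metis
  let ?K = "{x. \<forall>i. x i \<in> (if i < n then {-R..R} else {0::real})}"
  have K: "seq_compact ?K" by (intro compact_imp_seq_compact compact_fun_box) auto
  have "\<forall>k. z (Suc k) (q k) \<in> ?K"
  proof
    fix k
    have "z (Suc k) (q k) i \<in> {-R..R}" if "i < n" for i
    proof -
      define t where "t = real (q k i) / real (Suc k)"
      have "0 \<le> t" "t \<le> 1"
        using q[OF that, of k] by (auto simp: t_def divide_le_eq_1)
      then have "0 \<le> 2 * R * t" "2 * R * t \<le> 2 * R"
        using \<open>R > 0\<close> by (auto intro!: mult_left_le)
      moreover have "z (Suc k) (q k) i = - R + 2 * R * t" using that by (simp add: z_def t_def)
      ultimately show ?thesis by auto
    qed
    then show "z (Suc k) (q k) \<in> ?K" by (auto simp: z_def)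
  qed
  with K obtain l \<tau> where l: "l \<in> ?K" "strict_mono \<tau>" "((\<lambda>k. z (Suc k) (q k)) \<circ> \<tau>) \<longlonglongrightarrow> l"
    by (rule seq_compactE)
  \<comment> \<open>The cells have side 2 R / \<open>Suc (\<tau> k)\<close>, so every choice of
    vertices in them has the same limit.\<close>
  have near: "(\<lambda>k. z (Suc (\<tau> k)) (r k)) \<longlonglongrightarrow> l" if "\<And>k. nb (q (\<tau> k)) (r k)" for r
  proof (unfold tendsto_fun_iff, rule allI)
    fix i
    have lim: "(\<lambda>k. z (Suc (\<tau> k)) (q (\<tau> k)) i) \<longlonglongrightarrow> l i"
      using l(3) unfolding tendsto_fun_iff by (simp add: o_def)
    have "(\<lambda>k. 2 * R * inverse (real (Suc k))) \<longlonglongrightarrow> 2 * R * 0"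
      by (intro tendsto_intros LIMSEQ_inverse_real_of_nat)
    then have lim0: "(\<lambda>k. 2 * R * inverse (real (Suc k))) \<longlonglongrightarrow> 0"
      by simp
    have "(\<lambda>k. z (Suc (\<tau> k)) (r k) i - z (Suc (\<tau> k)) (q (\<tau> k)) i) \<longlonglongrightarrow> 0"
    proof (rule Lim_null_comparison[OF _ lim0])
      show "\<forall>\<^sub>F k in sequentially. norm (z (Suc (\<tau> k)) (r k) i - z (Suc (\<tau> k)) (q (\<tau> k)) i) \<le> 2 * R * inverse (real (Suc k))"
      proof (rule always_eventually, rule allI)
        fix k
        show "norm (z (Suc (\<tau> k)) (r k) i - z (Suc (\<tau> k)) (q (\<tau> k)) i) \<le> 2 * R * inverse (real (Suc k))"
        proof (cases "i < n")
          case True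
          let ?t = "real (Suc (\<tau> k))"
          have 1: "real (r k i) - real (q (\<tau> k) i) \<in> {0..1}"
            using that[of k] True by (auto simp: nb_def)
          have eq: "z (Suc (\<tau> k)) (r k) i - z (Suc (\<tau> k)) (q (\<tau> k)) i =
             2 * R * ((real (r k i) - real (q (\<tau> k) i)) / ?t)"
            using True by (simp add: z_def algebra_simps diff_divide_distrib)
          have "norm (z (Suc (\<tau> k)) (r k) i - z (Suc (\<tau> k)) (q (\<tau> k)) i) =
             2 * R * ((real (r k i) - real (q (\<tau> k) i)) / ?t)"
            unfolding eq using 1 \<open>R > 0\<close> by simp
          also have "\<dots> \<le> 2 * R * (1 / ?t)"
            using 1 \<open>R > 0\<close> by (intro mult_left_mono divide_right_mono) auto
          also have "\<dots> \<le> 2 * R * inverse (real (Suc k))"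
            using seq_suble[OF l(2), of k] \<open>R > 0\<close>
            by (intro mult_left_mono) (auto simp: field_simps)
          finally show ?thesis .
        qed (use \<open>R > 0\<close> in \<open>simp add: z_def\<close>)
      qed
    qed
    from tendsto_add[OF this lim] show "(\<lambda>k. z (Suc (\<tau> k)) (r k) i) \<longlonglongrightarrow> l i" by simp
  qed
  \<comment> \<open>Each cell has one vertex where H decreases coordinate i and one where it does
    not; both inequalities pass to the limit.\<close>
  have "H l i = l i" if i: "i < n" for i
  proof -
    have lim: "(\<lambda>k. H (x k) i) \<longlonglongrightarrow> H l i" "(\<lambda>k. x k i) \<longlonglongrightarrow> l i" if "x \<longlonglongrightarrow> l" for x
      using continuous_on_tendsto_compose[OF cont[OF i] that] that
      unfolding tendsto_fun_iff by auto
    obtain r s where r: "\<And>k. nb (q (\<tau> k)) (r k)" "\<And>k. H (z (Suc (\<tau> k)) (r k)) i < z (Suc (\<tau> k)) (r k) i"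
      and s: "\<And>k. nb (q (\<tau> k)) (s k)" "\<And>k. H (z (Suc (\<tau> k)) (s k)) i \<ge> z (Suc (\<tau> k)) (s k) i"
    proof -
      have "\<forall>k. \<exists>r s. nb (q (\<tau> k)) r \<and> nb (q (\<tau> k)) s \<and>
        H (z (Suc (\<tau> k)) r) i < z (Suc (\<tau> k)) r i \<and> H (z (Suc (\<tau> k)) s) i \<ge> z (Suc (\<tau> k)) s i"
        using rs[OF i] by blast
      then show thesis using that unfolding choice_iff by blast
    qed
    have "H l i \<le> l i"
      using r by (intro LIMSEQ_le[OF lim[OF near]]) (auto intro: less_imp_le)
    moreover have "l i \<le> H l i"
      using s by (intro LIMSEQ_le[OF lim(2)[OF near] lim(1)[OF near]]) (auto intro: less_imp_le)
    ultimately show ?thesis by simp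
  qed
  moreover have "l i = 0" if "i \<ge> n" for i
  proof -
    have "l i \<in> (if i < n then {-R..R} else {0})" using l(1) by simp
    then show ?thesis using that by simp
  qed
  ultimately show ?thesis using that by blast
qed

text \<open>Boundedness on the whole space takes the place of an invariant ball: any larger cube
  will do. The vectors are flattened, coordinate c of vector j becoming number j * DIM('v) +
  c.\<close>

lemma brouwer_nat:
  fixes H :: "(nat \<Rightarrow> 'v::euclidean_space) \<Rightarrow> nat \<Rightarrow> 'v"
  assumes cont: "\<And>i. i < n \<Longrightarrow> continuous_on UNIV (\<lambda>x. H x i)"
    and bound: "\<And>x i. i < n \<Longrightarrow> norm (H x i) \<le> R"
  obtains x where "\<And>i. i < n \<Longrightarrow> H x i = x i" and "\<And>i. i \<ge> n \<Longrightarrow> x i = 0"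
proof -
  let ?d = "DIM('v)"
  obtain e where e: "bij_betw e {..<?d} (Basis :: 'v set)"
    using ex_bij_betw_nat_finite[of "Basis :: 'v set"] by (auto simp: atLeast0LessThan)
  define vec where "vec x = (\<lambda>j. \<Sum>c<?d. x (j * ?d + c) *\<^sub>R e c)" for x :: "nat \<Rightarrow> real"
  define H' where "H' x i = H (vec x) (i div ?d) \<bullet> e (i mod ?d)" for x i
  have Basis: "e (i mod ?d) \<in> Basis" for i
    using e by (auto simp: bij_betw_def)
  have div: "i div ?d < n" if "i < n * ?d" for i
    using that by (simp add: less_mult_imp_div_less)
  have vec: "continuous_on UNIV vec"
    unfolding vec_def by (intro continuous_intros) auto
  obtain x where x: "\<And>i. i < n * ?d \<Longrightarrow> H' x i = x i" "\<And>i. i \<ge> n * ?d \<Longrightarrow> x i = 0"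
  proof (rule brouwer_nat_real[of "n * ?d" H' "R + 1"])
    fix i assume i: "i < n * ?d"
    show "continuous_on UNIV (\<lambda>x. H' x i)"
      unfolding H'_def
      by (intro continuous_intros continuous_on_compose2[OF cont[OF div[OF i]] vec]) auto
    show "\<bar>H' x i\<bar> < R + 1" for x
      using order_trans[OF Basis_le_norm[OF Basis] bound[OF div[OF i]], of "vec x" i]
      unfolding H'_def by linarith
  qed (use that in blast)
  have "H (vec x) j = vec x j" if "j < n" for j
  proof -
    have lt: "j * ?d + c < n * ?d" if "c < ?d" for c
    proof -
      have "j * ?d + c < Suc j * ?d" using that by simp
      also have "\<dots> \<le> n * ?d" using \<open>j < n\<close> by (intro mult_right_mono) auto
      finally show ?thesis .
    qed
    have "vec x j = (\<Sum>c<?d. H' x (j * ?d + c) *\<^sub>R e c)"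
      unfolding vec_def using x(1)[OF lt] by simp
    also have "\<dots> = (\<Sum>c<?d. (H (vec x) j \<bullet> e c) *\<^sub>R e c)"
      by (simp add: H'_def)
    also have "\<dots> = (\<Sum>b\<in>Basis. (H (vec x) j \<bullet> b) *\<^sub>R b)"
      by (rule sum.reindex_bij_betw[OF e, of "\<lambda>b. (H (vec x) j \<bullet> b) *\<^sub>R b"])
    finally show ?thesis by (simp add: euclidean_representation)
  qed
  moreover have "vec x j = 0" if "j \<ge> n" for j
  proof -
    have "n * ?d \<le> j * ?d + c" for c
      using mult_le_mono1[OF that, of ?d] by (rule trans_le_add1)
    then show ?thesis unfolding vec_def using x(2) by simp
  qed
  ultimately show ?thesis using that by blast
qed

subsection \<open>A saddle point theorem\<close>

text \<open>Iterating a gradient descent step expands the coordinates with \<open>\<sigma> i < 0\<close>, so by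
  Brouwer's theorem some start in these coordinates returns to zero there after \<open>k\<close> steps. The
  functional is then bounded above at the start and below at the end, uniformly in \<open>k\<close>.\<close>

lemma saddle_almost_critical:
  fixes W :: "(nat \<Rightarrow> 'v::euclidean_space) \<Rightarrow> real" and w :: "(nat \<Rightarrow> 'v) \<Rightarrow> nat \<Rightarrow> 'v"
    and \<sigma> :: "nat \<Rightarrow> real"
  assumes W: "\<And>y. \<bar>W y\<bar> \<le> C"
    and w: "\<And>y i. i < n \<Longrightarrow> norm (w y i) \<le> B"
    and cont: "\<And>i. i < n \<Longrightarrow> continuous_on UNIV (\<lambda>y. w y i)"
    and taylor: "\<And>\<epsilon>. \<epsilon> > 0 \<Longrightarrow> \<exists>K. \<forall>y y'. W y' - W y \<le> (\<Sum>i<n. w y i \<bullet> (y' i - y i))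
      + \<epsilon> * (\<Sum>i<n. norm (y' i - y i)) + K * (\<Sum>i<n. norm (y' i - y i))\<^sup>2"
    and "\<delta> > 0"
  obtains y where "(\<Sum>i<n. norm (\<sigma> i *\<^sub>R y i + w y i)) < \<delta>"
proof (rule ccontr)
  assume "\<not> thesis"
  define G where "G y i = \<sigma> i *\<^sub>R y i + w y i" for y i
  define S where "S y = (\<Sum>i<n. norm (G y i))" for y
  define F where "F y = (\<Sum>i<n. \<sigma> i * (y i \<bullet> y i)) / 2 + W y" for y
  have S: "S y \<ge> \<delta>" for y
    using \<open>\<not> thesis\<close> that unfolding S_def G_def by (meson not_le)
  have "n > 0" using S[of undefined] \<open>\<delta> > 0\<close> by (cases "n = 0") (auto simp: S_def)
  \<comment> \<open>A step gains h S^2 / n to first order, against an error e h S. As S \<ge>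
    \<delta>, this e limits the error to a quarter of the gain.\<close>
  define e where "e = \<delta> / (4 * n)"
  have "e > 0" unfolding e_def using \<open>\<delta> > 0\<close> \<open>n > 0\<close> by simp
  from taylor[OF this] obtain K where K: "\<And>y y'. W y' - W y \<le> (\<Sum>i<n. w y i \<bullet> (y' i - y i))
      + e * (\<Sum>i<n. norm (y' i - y i)) + K * (\<Sum>i<n. norm (y' i - y i))\<^sup>2"
    by blast
  define L where "L = \<bar>K\<bar> + (\<Sum>i<n. \<bar>\<sigma> i\<bar>) + 1"
  have "L > 0" unfolding L_def by (intro add_nonneg_pos add_nonneg_nonneg sum_nonneg) auto
  \<comment> \<open>\<open>L\<close> bounds the second order coefficients, and h^2 L = h / (4 n)
    costs another quarter, so half of the gain remains.\<close>
  define h where "h = 1 / (4 * n * L)"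
  have "h > 0" using \<open>n > 0\<close> \<open>L > 0\<close> by (simp add: h_def)
  define T where "T y = (\<lambda>i. if i < n then y i - h *\<^sub>R G y i else y i)" for y
  have descent: "F (T y) \<le> F y - h * \<delta>\<^sup>2 / (2 * n)" for y
  proof -
    let ?R = "\<Sum>i<n. G y i \<bullet> G y i"
    have D: "(\<Sum>i<n. norm (T y i - y i)) = h * S y"
      using \<open>h > 0\<close> by (simp add: T_def S_def sum_distrib_left)
    have w': "(\<Sum>i<n. w y i \<bullet> (T y i - y i)) = - h * (\<Sum>i<n. w y i \<bullet> G y i)"
      by (simp add: T_def sum_distrib_left)
    have quad: "(\<Sum>i<n. \<sigma> i * (T y i \<bullet> T y i)) - (\<Sum>i<n. \<sigma> i * (y i \<bullet> y i)) =
        - 2 * h * (\<Sum>i<n. \<sigma> i * (y i \<bullet> G y i)) + h\<^sup>2 * (\<Sum>i<n. \<sigma> i * (G y i \<bullet> G y i))"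
      unfolding sum_distrib_left sum_subtractf[symmetric] sum.distrib[symmetric]
      by (intro sum.cong) (auto simp: T_def inner_diff_left inner_diff_right inner_commute
          algebra_simps power2_eq_square)
    have R: "(\<Sum>i<n. \<sigma> i * (y i \<bullet> G y i)) + (\<Sum>i<n. w y i \<bullet> G y i) = ?R"
      unfolding sum.distrib[symmetric]
      by (intro sum.cong refl) (simp add: G_def inner_add_left)
    have le: "norm (G y i) \<le> S y" if "i < n" for i
      unfolding S_def using that by (intro member_le_sum) auto
    have "(\<Sum>i<n. \<sigma> i * (G y i \<bullet> G y i)) \<le> (\<Sum>i<n. \<bar>\<sigma> i\<bar> * (S y)\<^sup>2)"
      using le by (intro sum_mono mult_mono) (auto simp: dot_square_norm power_mono)
    then have quad': "(\<Sum>i<n. \<sigma> i * (G y i \<bullet> G y i)) \<le> (\<Sum>i<n. \<bar>\<sigma> i\<bar>) * (S y)\<^sup>2"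
      by (simp add: sum_distrib_right)
    \<comment> \<open>Cauchy-Schwarz, at the cost of a factor n: the gradient is bounded below in
      the l1 norm, while descent is measured in the l2 norm.\<close>
    have cs: "(S y)\<^sup>2 \<le> n * ?R"
      using sum_squared_le_sum_of_squares[of "\<lambda>i. norm (G y i)" "{..<n}"]
      by (simp add: S_def dot_square_norm mult.commute)
    have "F (T y) - F y \<le> - (h * ?R) + h\<^sup>2 / 2 * (\<Sum>i<n. \<sigma> i * (G y i \<bullet> G y i))
        + e * (h * S y) + K * (h * S y)\<^sup>2"
      using K[of "T y" y] quad unfolding F_def D w' R[symmetric] by (simp add: algebra_simps)
    also have "\<dots> \<le> - (h * ((S y)\<^sup>2 / n)) + h\<^sup>2 / 2 * ((\<Sum>i<n. \<bar>\<sigma> i\<bar>) * (S y)\<^sup>2)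
        + S y / (4 * n) * (h * S y) + \<bar>K\<bar> * (h * S y)\<^sup>2"
      using cs quad' S[of y] \<open>h > 0\<close> \<open>\<delta> > 0\<close> \<open>n > 0\<close>
      by (intro add_mono le_imp_neg_le mult_left_mono mult_right_mono divide_right_mono)
        (auto simp: e_def field_simps)
    also have "\<dots> = - (3 / 4) * h / n * (S y)\<^sup>2 + h\<^sup>2 * (S y)\<^sup>2 * ((\<Sum>i<n. \<bar>\<sigma> i\<bar>) / 2 + \<bar>K\<bar>)"
      using \<open>n > 0\<close> by (simp add: field_simps power2_eq_square)
    also have "\<dots> \<le> - (3 / 4) * h / n * (S y)\<^sup>2 + h\<^sup>2 * (S y)\<^sup>2 * L"
      unfolding L_def by (intro add_left_mono mult_left_mono) (auto intro!: sum_nonneg)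
    also have "\<dots> = - (3 / 4) * h / n * (S y)\<^sup>2 + h / (4 * n) * (S y)\<^sup>2"
      using \<open>n > 0\<close> \<open>L > 0\<close> by (simp add: h_def power2_eq_square)
    also have "\<dots> = - (h * (S y)\<^sup>2 / (2 * n))"
      using \<open>n > 0\<close> by (simp add: field_simps)
    also have "\<dots> \<le> - (h * \<delta>\<^sup>2 / (2 * n))"
      using S[of y] \<open>h > 0\<close> \<open>\<delta> > 0\<close>
      by (simp add: divide_right_mono mult_left_mono power_mono)
    finally show ?thesis by simp
  qed
  have iter: "F ((T ^^ k) y) \<le> F y - k * (h * \<delta>\<^sup>2 / (2 * n))" for k y
  proof (induction k)
    case (Suc k)
    then show ?case using descent[of "(T ^^ k) y"]
      by (simp add: algebra_simps add_divide_distrib)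
  qed simp
  have contT: "continuous_on UNIV T"
  proof (rule continuous_on_coordinatewise_then_product)
    fix i
    show "continuous_on UNIV (\<lambda>y. T y i)"
      using cont[of i] by (cases "i < n") (auto simp: T_def G_def intro!: continuous_intros)
  qed
  have contTk: "continuous_on UNIV (T ^^ k)" for k
    by (induction k) (auto simp: id_def o_def intro: continuous_on_compose2[OF contT])
  have bounded: "k * (h * \<delta>\<^sup>2 / (2 * n)) \<le> 2 * C" for k :: nat
  proof -
    define l where "l i = 1 - h * \<sigma> i" for i
    \<comment> \<open>Unrolling \<open>T\<close> in an expanding coordinate gives l^k (y i - H k y
      i) after k steps, so a fixed point of \<open>H k\<close> is a start that returns to 0 there.
      In the other coordinates \<open>H\<close> is 0, which makes the fixed point vanish there at
      the start.\<close>
    define H where "H k y i = (if \<sigma> i < 0 then h *\<^sub>R (\<Sum>j<k. inverse (l i) ^ Suc j *\<^sub>R w ((T ^^ j) y) i) else 0)"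
      for k y i
    have l: "l i > 1" if "\<sigma> i < 0" for i
      using that \<open>h > 0\<close> by (simp add: l_def mult_pos_neg)
    have TkH: "(T ^^ k) y i = l i ^ k *\<^sub>R (y i - H k y i)" if "i < n" "\<sigma> i < 0" for k y i
    proof (induction k)
      case (Suc k)
      have "(T ^^ Suc k) y i = l i *\<^sub>R (T ^^ k) y i - h *\<^sub>R w ((T ^^ k) y) i"
        using that by (simp add: T_def G_def l_def algebra_simps)
      also have "\<dots> = l i ^ Suc k *\<^sub>R (y i - H k y i - h *\<^sub>R inverse (l i) ^ Suc k *\<^sub>R w ((T ^^ k) y) i)"
        using l[OF that(2)] by (simp add: Suc algebra_simps power_inverse)
      also have "y i - H k y i - h *\<^sub>R inverse (l i) ^ Suc k *\<^sub>R w ((T ^^ k) y) i = y i - H (Suc k) y i"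
        using that by (simp add: H_def algebra_simps)
      finally show ?case .
    qed (use that in \<open>simp add: H_def\<close>)
    obtain y where y: "\<And>i. i < n \<Longrightarrow> H k y i = y i"
    proof (rule brouwer_nat[of n "H k" "h * (k * B)"])
      fix i assume i: "i < n"
      show "continuous_on UNIV (\<lambda>y. H k y i)"
        unfolding H_def using continuous_on_compose2[OF cont[OF i] contTk]
        by (cases "\<sigma> i < 0") (auto intro!: continuous_intros)
      show "norm (H k y i) \<le> h * (k * B)" for y
      proof (cases "\<sigma> i < 0")
        case True
        have "norm (inverse (l i) ^ Suc j *\<^sub>R w ((T ^^ j) y) i) \<le> 1 * B" for j
          unfolding norm_scaleR using l[OF True] w[OF i]
          by (intro mult_mono) (auto simp: power_le_one inverse_le_1_iff abs_mult power_abs simp del: power_Suc)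
        then have "norm (\<Sum>j<k. inverse (l i) ^ Suc j *\<^sub>R w ((T ^^ j) y) i) \<le> k * B"
          by (intro order_trans[OF norm_sum] order_trans[OF sum_bounded_above[where K = B]]) auto
        then show ?thesis using \<open>h > 0\<close> True by (simp add: H_def)
      next
        case False
        have "0 \<le> B" using w[OF i] norm_ge_zero order_trans by blast
        then show ?thesis using False \<open>h > 0\<close> by (simp add: H_def)
      qed
    qed (use that in blast)
    \<comment> \<open>At the start only coordinates with \<sigma> i < 0 can be nonzero, and at the
      end exactly these vanish. The quadratic part is thus \<le> 0 first and \<ge> 0 last, and the
      bound on W limits the total descent to 2 C.\<close>
    have "F y \<le> W y"
    proof -
      have "\<sigma> i * (y i \<bullet> y i) \<le> 0" if "i < n" for i
      proof (cases "\<sigma> i < 0")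
        case False
        then have "y i = 0" using y[OF that] by (simp add: H_def)
        then show ?thesis by simp
      qed (simp add: mult_nonpos_nonneg)
      then have "(\<Sum>i<n. \<sigma> i * (y i \<bullet> y i)) \<le> 0" by (intro sum_nonpos) auto
      then show ?thesis by (simp add: F_def)
    qed
    moreover have "W ((T ^^ k) y) \<le> F ((T ^^ k) y)"
    proof -
      have "\<sigma> i * ((T ^^ k) y i \<bullet> (T ^^ k) y i) \<ge> 0" if "i < n" for i
        using TkH[OF that] y[OF that] by (cases "\<sigma> i < 0") auto
      then have "(\<Sum>i<n. \<sigma> i * ((T ^^ k) y i \<bullet> (T ^^ k) y i)) \<ge> 0" by (intro sum_nonneg) auto
      then show ?thesis by (simp add: F_def)
    qed
    ultimately show ?thesis using iter[of k y] W[of y] W[of "(T ^^ k) y"] by linarith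
  qed
  have "h * \<delta>\<^sup>2 / (2 * n) > 0" using \<open>h > 0\<close> \<open>\<delta> > 0\<close> \<open>n > 0\<close> by simp
  then obtain k :: nat where "2 * C < k * (h * \<delta>\<^sup>2 / (2 * n))"
    using reals_Archimedean3 by blast
  then show False using bounded[of k] by linarith
qed

subsection \<open>Generating functions and their cutoff\<close>

lemma DERIV_max_0_square:
  "((\<lambda>t::real. (max 0 t)\<^sup>2) has_real_derivative 2 * max 0 t) (at t)"
proof -
  consider "t > 0" | "t < 0" | "t = 0" by linarith
  then show ?thesis
  proof cases
    case 1
    have "((\<lambda>t::real. t\<^sup>2) has_real_derivative 2 * t) (at t)"
      by (auto intro!: derivative_eq_intros)
    then have "((\<lambda>t::real. (max 0 t)\<^sup>2) has_real_derivative 2 * t) (at t)"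
      by (rule has_field_derivative_transform_within_open[where S = "{0<..}"]) (use 1 in auto)
    then show ?thesis using 1 by simp
  next
    case 2
    have "((\<lambda>t::real. 0) has_real_derivative 0) (at t)" by simp
    then have "((\<lambda>t::real. (max 0 t)\<^sup>2) has_real_derivative 0) (at t)"
      by (rule has_field_derivative_transform_within_open[where S = "{..<0}"]) (use 2 in auto)
    then show ?thesis using 2 by simp
  next
    case 3
    have "(\<lambda>h::real. (max 0 h)\<^sup>2 / h) \<midarrow>0\<rightarrow> 0"
    proof (rule Lim_null_comparison)
      show "\<forall>\<^sub>F h in at 0. norm ((max 0 h)\<^sup>2 / h) \<le> \<bar>h\<bar>"
        by (rule always_eventually) (auto simp: max_def power2_eq_square)
      show "((\<lambda>h::real. \<bar>h\<bar>) \<longlongrightarrow> 0) (at 0)"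
        by (rule tendsto_rabs_zero) (rule tendsto_ident_at)
    qed
    then show ?thesis using 3 by (simp add: DERIV_def)
  qed
qed

text \<open>Class C1 is enough, so squared positive parts serve as bump functions: \<open>e\<close>
  is 1 on the annulus and \<le> 0 outside a larger one, and \<open>g\<close> truncates it at 0
  without losing differentiability. The cutoff must vanish near 0 as well as far out, because
  generating functions are differentiable only off p = 0.\<close>

lemma radial_cutoff:
  fixes r\<^sub>1 r\<^sub>2 :: real
  assumes "0 < r\<^sub>1" "0 < r\<^sub>2"
  obtains \<kappa> :: "'v::euclidean_space \<Rightarrow> real" and \<kappa>' r R where
    "\<And>p. (\<kappa> has_derivative (\<lambda>h. \<kappa>' p \<bullet> h)) (at p)" "continuous_on UNIV \<kappa>'"
    "\<And>p. 0 \<le> \<kappa> p" "\<And>p. \<kappa> p \<le> 1"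
    "\<And>p. r\<^sub>1 \<le> norm p \<Longrightarrow> norm p \<le> r\<^sub>2 \<Longrightarrow> \<kappa> p = 1 \<and> \<kappa>' p = 0"
    "0 < r" "\<And>p. norm p < r \<Longrightarrow> \<kappa> p = 0 \<and> \<kappa>' p = 0"
    "\<And>p. norm p > R \<Longrightarrow> \<kappa> p = 0 \<and> \<kappa>' p = 0"
proof -
  define g where "g t = (max 0 t)\<^sup>2" for t :: real
  \<comment> \<open>In terms of t = |p|^2, the inner penalty in \<open>e\<close> sets in below 2 a
    and reaches 1 at a; the outer one sets in above b and reaches 1 at 2 b.\<close>
  define a where "a = r\<^sub>1\<^sup>2 / 2"
  define b where "b = r\<^sub>2\<^sup>2"
  have "a > 0" "b > 0" using assms by (auto simp: a_def b_def)
  define e where "e t = 1 - g ((t - b) / b) - g ((2 * a - t) / a)" for t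
  define e' where "e' t = - (2 * max 0 ((t - b) / b) / b) + 2 * max 0 ((2 * a - t) / a) / a" for t
  define \<kappa> where "\<kappa> p = g (e (p \<bullet> p))" for p :: 'v
  define \<kappa>' where "\<kappa>' p = (4 * max 0 (e (p \<bullet> p)) * e' (p \<bullet> p)) *\<^sub>R p" for p :: 'v
  have g: "(g has_real_derivative 2 * max 0 t) (at t within S)" for t S
    using DERIV_max_0_square[of t] unfolding g_def by (rule has_field_derivative_at_within)
  have e: "(e has_real_derivative e' t) (at t within S)" for t S
    unfolding e_def e'_def using \<open>a > 0\<close> \<open>b > 0\<close>
    by (auto intro!: derivative_eq_intros DERIV_chain2[OF g])
  have ge: "((\<lambda>t. g (e t)) has_real_derivative 2 * max 0 (e t) * e' t) (at t within S)" for t S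
    by (rule DERIV_chain2[OF g e])
  have der: "(\<kappa> has_derivative (\<lambda>h. \<kappa>' p \<bullet> h)) (at p)" for p
  proof -
    have "((\<lambda>p::'v. p \<bullet> p) has_derivative (\<lambda>h. 2 * (p \<bullet> h))) (at p)"
      by (auto intro!: derivative_eq_intros simp: inner_commute)
    from has_derivative_compose[OF this ge[of "p \<bullet> p" UNIV, unfolded has_field_derivative_def]]
    have "(\<kappa> has_derivative (\<lambda>h. 2 * max 0 (e (p \<bullet> p)) * e' (p \<bullet> p) * (2 * (p \<bullet> h)))) (at p)"
      by (simp add: \<kappa>_def[abs_def] mult.commute)
    then show ?thesis by (simp add: \<kappa>'_def mult.assoc mult.left_commute)
  qed
  have g0: "g t \<ge> 0" for t by (simp add: g_def)
  have g1: "g t \<le> 1" if "t \<le> 1" for t using that by (simp add: g_def power_le_one)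
  have e1: "e t \<le> 1" for t using g0[of "(t - b) / b"] g0[of "(2 * a - t) / a"] by (simp add: e_def)
  have ge1: "g t \<ge> 1" if "t \<ge> 1" for t using that by (simp add: g_def)
  have zero: "\<kappa> p = 0 \<and> \<kappa>' p = 0" if "p \<bullet> p \<le> a \<or> p \<bullet> p \<ge> 2 * b" for p
  proof -
    have "e (p \<bullet> p) \<le> 0"
      using that
    proof
      assume "p \<bullet> p \<le> a"
      then have "(2 * a - p \<bullet> p) / a \<ge> 1" using \<open>a > 0\<close> by (simp add: field_simps)
      from ge1[OF this] g0[of "(p \<bullet> p - b) / b"] show ?thesis by (simp add: e_def)
    next
      assume "p \<bullet> p \<ge> 2 * b"
      then have "(p \<bullet> p - b) / b \<ge> 1" using \<open>b > 0\<close> by (simp add: field_simps)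
      from ge1[OF this] g0[of "(2 * a - p \<bullet> p) / a"] show ?thesis by (simp add: e_def)
    qed
    then show ?thesis by (simp add: \<kappa>_def \<kappa>'_def g_def)
  qed
  show ?thesis
  proof (rule that[OF der])
    have e_cont: "continuous_on UNIV e" by (rule DERIV_continuous_on[OF e])
    have "continuous_on UNIV e'" unfolding e'_def
      using \<open>a > 0\<close> \<open>b > 0\<close> by (intro continuous_intros) auto
    then have "continuous_on UNIV (\<lambda>p::'v. e' (p \<bullet> p))"
      by (rule continuous_on_compose2) (auto intro!: continuous_intros)
    moreover have "continuous_on UNIV (\<lambda>p::'v. e (p \<bullet> p))"
      by (rule continuous_on_compose2[OF e_cont]) (auto intro!: continuous_intros)
    ultimately show "continuous_on UNIV \<kappa>'" unfolding \<kappa>'_def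
      by (intro continuous_intros)
    show "0 \<le> \<kappa> p" "\<kappa> p \<le> 1" for p using g0 g1[OF e1] by (auto simp: \<kappa>_def)
    show "\<kappa> p = 1 \<and> \<kappa>' p = 0" if "r\<^sub>1 \<le> norm p" "norm p \<le> r\<^sub>2" for p
    proof -
      have "r\<^sub>1\<^sup>2 \<le> p \<bullet> p" "p \<bullet> p \<le> r\<^sub>2\<^sup>2"
        using that assms by (auto simp: dot_square_norm power_mono)
      then have "(p \<bullet> p - b) / b \<le> 0" "(2 * a - p \<bullet> p) / a \<le> 0"
        using \<open>a > 0\<close> \<open>b > 0\<close> by (auto simp: a_def b_def field_simps)
      then show ?thesis by (simp add: \<kappa>_def \<kappa>'_def e_def e'_def g_def max_absorb1)
    qed
    show "0 < r\<^sub>1 / 2" using assms by simp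
    show "\<kappa> p = 0 \<and> \<kappa>' p = 0" if "norm p < r\<^sub>1 / 2" for p
    proof -
      have "p \<bullet> p \<le> (r\<^sub>1 / 2)\<^sup>2" using that assms by (auto simp: dot_square_norm intro!: power_mono)
      also have "\<dots> \<le> a" using assms by (simp add: a_def power_divide)
      finally show ?thesis using zero by blast
    qed
    show "\<kappa> p = 0 \<and> \<kappa>' p = 0" if "norm p > 2 * r\<^sub>2" for p
    proof -
      have "2 * b \<le> (2 * r\<^sub>2)\<^sup>2" using assms by (simp add: b_def power_mult_distrib)
      also have "\<dots> \<le> p \<bullet> p"
        using that assms power_mono[of "2 * r\<^sub>2" "norm p" 2] by (simp add: dot_square_norm)
      finally show ?thesis using zero by blast
    qed
  qed
qed

text \<open>The last conjunct is what uniform continuity of the gradient gives: \<open>\<epsilon>\<close> handles short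
  increments, and the quadratic term absorbs the long ones.\<close>

definition uniform_gradient :: "('v::euclidean_space \<Rightarrow> real) \<Rightarrow> ('v \<Rightarrow> 'v) \<Rightarrow> bool" where
  "uniform_gradient f g \<longleftrightarrow> continuous_on UNIV g \<and> bounded (range f) \<and> bounded (range g) \<and>
    (\<forall>\<epsilon>>0. \<exists>K. \<forall>z z'. f z' - f z \<le> g z \<bullet> (z' - z) + \<epsilon> * norm (z' - z) + K * (norm (z' - z))\<^sup>2)"

lemma uniform_gradientI:
  assumes der: "\<And>z. (f has_derivative (\<lambda>h. g z \<bullet> h)) (at z)"
    and bf: "bounded (range f)" and bg: "bounded (range g)"
    and uc: "uniformly_continuous_on UNIV g"
  shows "uniform_gradient f g"
  unfolding uniform_gradient_def
proof (intro conjI allI impI bf bg)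
  show "continuous_on UNIV g" by (rule uniformly_continuous_imp_continuous[OF uc])
  fix \<epsilon> :: real assume "\<epsilon> > 0"
  obtain B where B: "\<And>z. \<bar>f z\<bar> \<le> B" using bf by (auto simp: bounded_iff)
  obtain B' where B': "\<And>z. norm (g z) \<le> B'" using bg by (auto simp: bounded_iff)
  have "B \<ge> 0" "B' \<ge> 0" using B[of undefined] norm_ge_zero[of "g undefined"] B'[of undefined] by linarith+
  obtain \<rho> where "\<rho> > 0" and \<rho>: "\<And>z z'. dist z' z < \<rho> \<Longrightarrow> dist (g z') (g z) < \<epsilon>"
    using uc \<open>\<epsilon> > 0\<close> unfolding uniformly_continuous_on_def by auto
  \<comment> \<open>For increments v of length at least \<rho>, 2 B \<le> 2 B (|v| / \<rho>)^2 and
    B' |v| \<le> B' |v|^2 / \<rho>, so constant and linear terms both become quadratic.\<close>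
  define K where "K = 2 * B / \<rho>\<^sup>2 + B' / \<rho>"
  have "K \<ge> 0" using \<open>B \<ge> 0\<close> \<open>B' \<ge> 0\<close> \<open>\<rho> > 0\<close> by (simp add: K_def)
  have "f z' - f z \<le> g z \<bullet> (z' - z) + \<epsilon> * norm (z' - z) + K * (norm (z' - z))\<^sup>2" for z z'
  proof (cases "norm (z' - z) < \<rho>")
    case True
    have "norm (f z' - f z - g z \<bullet> (z' - z)) \<le> norm (z' - z) * \<epsilon>"
    proof (rule differentiable_bound_linearization[where S = "ball z \<rho>" and f' = "\<lambda>x h. g x \<bullet> h"])
      show "z + t *\<^sub>R (z' - z) \<in> ball z \<rho>" if "t \<in> {0..1}" for t
        using that True mult_right_mono[of t 1 "norm (z' - z)"] by (auto simp: dist_norm)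
      show "(f has_derivative (\<bullet>) (g x)) (at x within ball z \<rho>)" for x
        using der by (simp add: has_derivative_at_withinI)
      show "onorm ((\<lambda>h. g x \<bullet> h) - (\<lambda>h. g z \<bullet> h)) \<le> \<epsilon>" if "x \<in> ball z \<rho>" for x
      proof (rule onorm_bound)
        have *: "norm (g x - g z) \<le> \<epsilon>"
          using \<rho>[of x z] that by (auto simp: dist_norm norm_minus_commute intro: less_imp_le)
        show "norm (((\<lambda>h. g x \<bullet> h) - (\<lambda>h. g z \<bullet> h)) h) \<le> \<epsilon> * norm h" for h
          using Cauchy_Schwarz_ineq2[of "g x - g z" h] mult_right_mono[OF *, of "norm h"]
          by (auto simp: inner_diff_left)
      qed (use \<open>\<epsilon> > 0\<close> in simp)
      show "z \<in> ball z \<rho>" using \<open>\<rho> > 0\<close> by simp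
    qed
    then have "f z' - f z \<le> g z \<bullet> (z' - z) + \<epsilon> * norm (z' - z)"
      by (auto simp: abs_le_iff mult.commute)
    then show ?thesis using \<open>K \<ge> 0\<close> by (smt (verit) mult_nonneg_nonneg zero_le_power2)
  next
    case False
    let ?v = "norm (z' - z)"
    have v: "?v / \<rho> \<ge> 1" using False \<open>\<rho> > 0\<close> by simp
    have "2 * B \<le> 2 * B * (?v / \<rho>)\<^sup>2"
      using v \<open>B \<ge> 0\<close> by (simp add: mult_le_cancel_left1)
    moreover have "B' * ?v * 1 \<le> B' * ?v * (?v / \<rho>)"
      using v \<open>B' \<ge> 0\<close> by (intro mult_left_mono) auto
    ultimately have *: "2 * B + B' * ?v \<le> K * ?v\<^sup>2"
      by (simp add: K_def power2_eq_square algebra_simps)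
    have "f z' - f z \<le> 2 * B" using B[of z] B[of z'] by linarith
    moreover have "- (g z \<bullet> (z' - z)) \<le> B' * ?v"
      using Cauchy_Schwarz_ineq2[of "g z" "z' - z"] mult_right_mono[OF B'[of z] norm_ge_zero, of "z' - z"]
      by linarith
    moreover have "0 \<le> \<epsilon> * ?v" using \<open>\<epsilon> > 0\<close> by simp
    ultimately show ?thesis using * by linarith
  qed
  then show "\<exists>K. \<forall>z z'. f z' - f z \<le> g z \<bullet> (z' - z) + \<epsilon> * norm (z' - z) + K * (norm (z' - z))\<^sup>2"
    by blast
qed

section \<open>Functions periodic under integer translations\<close>

definition int_vecs :: "(real ^ 'n) set" where
  "int_vecs = {k. \<forall>i. k $ i \<in> \<int>}"

lemma int_vec_shift:
  fixes Q :: "real ^ 'n"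
  obtains k where "k \<in> int_vecs" "Q + k \<in> cbox 0 1"
proof
  let ?k = "\<chi> i. - of_int \<lfloor>Q $ i\<rfloor>"
  show "?k \<in> int_vecs" by (simp add: int_vecs_def)
  show "Q + ?k \<in> cbox 0 1"
    by (auto simp: mem_box_cart intro: less_imp_le) linarith+
qed

text \<open>An integer translation brings \<open>Q\<close> into the unit box and the support
  condition bounds \<open>p\<close>, so a compact set decides everything. The radii of
  \<open>?K\<close> have 1 to spare because only one of two nearby points is normalised; the other
  follows by the same translation.\<close>

lemma uniformly_continuous_periodic:
  fixes g :: "(real ^ 'n) \<times> 'v::euclidean_space \<Rightarrow> 'w::euclidean_space"
  assumes cont: "continuous_on UNIV g"
    and per: "\<And>Q p k. k \<in> int_vecs \<Longrightarrow> g (Q + k, p) = g (Q, p)"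
    and supp: "\<And>Q p. norm p > R \<Longrightarrow> g (Q, p) = 0"
  shows "uniformly_continuous_on UNIV g" and "bounded (range g)"
proof -
  let ?K = "cball (0 :: real ^ 'n) (norm (1 :: real ^ 'n) + 1) \<times> cball (0 :: 'v) (R + 1)"
  have K: "compact ?K" by (intro compact_Times compact_cball)
  have cK: "continuous_on ?K g" using cont continuous_on_subset by blast
  have box: "norm Q \<le> norm (1 :: real ^ 'n)" if "Q \<in> cbox 0 1" for Q :: "real ^ 'n"
    using that by (intro norm_le_componentwise_cart) (auto simp: mem_box_cart)
  have "range g \<subseteq> insert 0 (g ` ?K)"
  proof safe
    fix Q p assume *: "g (Q, p) \<notin> g ` ?K"
    obtain k where k: "k \<in> int_vecs" "Q + k \<in> cbox 0 1" by (rule int_vec_shift)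
    show "g (Q, p) = 0"
    proof (rule ccontr)
      assume "g (Q, p) \<noteq> 0"
      then have "norm p \<le> R" using supp[of p Q] by (meson not_le)
      then have "(Q + k, p) \<in> ?K" using box[OF k(2)] by auto
      then show False using * per[OF k(1), of Q p] by (metis imageI)
    qed
  qed
  then show "bounded (range g)"
    using compact_imp_bounded[OF compact_continuous_image[OF cK K]] bounded_subset bounded_insert
    by metis
  show "uniformly_continuous_on UNIV g"
    unfolding uniformly_continuous_on_def
  proof (intro allI impI)
    fix \<epsilon> :: real assume "\<epsilon> > 0"
    then obtain \<rho> where "\<rho> > 0" and \<rho>: "\<And>z z'. z \<in> ?K \<Longrightarrow> z' \<in> ?K \<Longrightarrow> dist z' z < \<rho> \<Longrightarrow> dist (g z') (g z) < \<epsilon>"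
      using compact_uniformly_continuous[OF cK K] unfolding uniformly_continuous_on_def by metis
    have "dist (g (Q', p')) (g (Q, p)) < \<epsilon>" if d: "dist (Q', p') (Q, p) < min \<rho> 1" for Q p Q' p'
    proof -
      obtain k where k: "k \<in> int_vecs" "Q + k \<in> cbox 0 1" by (rule int_vec_shift)
      have dQ: "dist Q' Q < 1" using d dist_fst_le[of "(Q', p')" "(Q, p)"] by simp
      have dp: "dist p' p < 1" using d dist_snd_le[of "(Q', p')" "(Q, p)"] by simp
      have Q'k: "Q' + k = (Q + k) + (Q' - Q)" by simp
      have "norm (Q' + k) \<le> norm (1 :: real ^ 'n) + 1"
        unfolding Q'k using norm_triangle_ineq[of "Q + k" "Q' - Q"] box[OF k(2)] dQ
        by (simp add: dist_norm)
      show ?thesis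
      proof (cases "norm p \<le> R \<or> norm p' \<le> R")
        case True
        then have "norm p \<le> R + 1" "norm p' \<le> R + 1"
          using dp norm_triangle_ineq3[of p' p] by (auto simp: dist_norm)
        then have "(Q + k, p) \<in> ?K" "(Q' + k, p') \<in> ?K"
          using box[OF k(2)] \<open>norm (Q' + k) \<le> _\<close> by auto
        moreover have "dist (Q' + k, p') (Q + k, p) < \<rho>"
          using d by (simp add: dist_Pair_Pair)
        ultimately have "dist (g (Q' + k, p')) (g (Q + k, p)) < \<epsilon>" by (rule \<rho>)
        then show ?thesis by (simp add: per[OF k(1)])
      next
        case False
        then show ?thesis using supp \<open>\<epsilon> > 0\<close> by simp
      qed
    qed
    then show "\<exists>d>0. \<forall>x\<in>UNIV. \<forall>x'\<in>UNIV. dist x' x < d \<longrightarrow> dist (g x') (g x) < \<epsilon>"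
      using \<open>\<rho> > 0\<close> by (intro exI[of _ "min \<rho> 1"]) auto
  qed
qed

text \<open>\<open>s\<close> generates the map \<open>(Q + \<partial>s/\<partial>p, p) \<mapsto> (Q, p + \<partial>s/\<partial>Q)\<close>; here
  \<open>g = (\<partial>s/\<partial>Q, \<partial>s/\<partial>p)\<close>.\<close>

definition generating_function ::
    "((real ^ 'n) \<times> (real ^ 'n) \<Rightarrow> real) \<Rightarrow> ((real ^ 'n) \<times> (real ^ 'n) \<Rightarrow> (real ^ 'n) \<times> (real ^ 'n)) \<Rightarrow> bool" where
  "generating_function s g \<longleftrightarrow>
    (\<forall>z. snd z \<noteq> 0 \<longrightarrow> (s has_derivative (\<lambda>h. g z \<bullet> h)) (at z)) \<and>
    continuous_on {z. snd z \<noteq> 0} g \<and>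
    (\<forall>Q p k. k \<in> int_vecs \<longrightarrow> s (Q + k, p) = s (Q, p)) \<and>
    (\<forall>Q p. p \<noteq> 0 \<longrightarrow> norm (fst (g (Q, p))) \<le> norm p / 2)"

lemma inner_ext:
  fixes a b :: "'a::real_inner"
  assumes "(\<lambda>h. a \<bullet> h) = (\<lambda>h. b \<bullet> h)"
  shows "a = b"
  using fun_cong[OF assms] vector_eq_rdot[of a b] by blast

text \<open>The cutoff depends on \<open>p\<close> alone. It therefore multiplies the
  \<open>Q\<close>-derivative by a factor in [0, 1], and its own derivative enters only the
  \<open>p\<close>-component; periodicity in \<open>Q\<close> is untouched as well.\<close>

lemma generating_function_cutoff:
  fixes s :: "(real ^ 'n) \<times> (real ^ 'n) \<Rightarrow> real"
  assumes gen: "generating_function s g" and "0 < r\<^sub>1" "0 < r\<^sub>2"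
  obtains S G where "uniform_gradient S G"
    "\<And>Q p k. k \<in> int_vecs \<Longrightarrow> G (Q + k, p) = G (Q, p)"
    "\<And>Q p. norm (fst (G (Q, p))) \<le> norm p / 2"
    "\<And>Q p. r\<^sub>1 \<le> norm p \<Longrightarrow> norm p \<le> r\<^sub>2 \<Longrightarrow> G (Q, p) = g (Q, p)"
proof -
  obtain \<kappa> :: "real ^ 'n \<Rightarrow> real" and \<kappa>' r R where
    der\<kappa>: "\<And>p. (\<kappa> has_derivative (\<lambda>h. \<kappa>' p \<bullet> h)) (at p)" and cont\<kappa>: "continuous_on UNIV \<kappa>'"
    and \<kappa>: "\<And>p. 0 \<le> \<kappa> p" "\<And>p. \<kappa> p \<le> 1"
    and one: "\<And>p. r\<^sub>1 \<le> norm p \<Longrightarrow> norm p \<le> r\<^sub>2 \<Longrightarrow> \<kappa> p = 1 \<and> \<kappa>' p = 0"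
    and r: "0 < r" "\<And>p. norm p < r \<Longrightarrow> \<kappa> p = 0 \<and> \<kappa>' p = 0"
    and R: "\<And>p. norm p > R \<Longrightarrow> \<kappa> p = 0 \<and> \<kappa>' p = 0"
    using radial_cutoff[OF assms(2,3), where ?'v = "real ^ 'n"] by blast
  define S where "S z = \<kappa> (snd z) * s z" for z
  define G where "G z = \<kappa> (snd z) *\<^sub>R g z + (0, s z *\<^sub>R \<kappa>' (snd z))" for z
  \<comment> \<open>Two open sets covering the space: on the first the product rule applies, on the
    second everything vanishes.\<close>
  let ?U = "{z :: (real ^ 'n) \<times> (real ^ 'n). snd z \<noteq> 0}" and ?V = "{z :: (real ^ 'n) \<times> (real ^ 'n). norm (snd z) < r}"
  have open_U: "open ?U" by (intro open_Collect_neq continuous_intros)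
  have open_V: "open ?V" by (intro open_Collect_less continuous_intros)
  have UV: "?U \<union> ?V = UNIV" using r(1) by auto
  have der_s: "(s has_derivative (\<lambda>h. g z \<bullet> h)) (at z)" if "snd z \<noteq> 0" for z
    using gen that unfolding generating_function_def by blast
  have der: "(S has_derivative (\<lambda>h. G z \<bullet> h)) (at z)" for z
  proof (cases "snd z = 0")
    case True
    have "((\<lambda>z. 0) has_derivative (\<lambda>h. 0)) (at z)" by simp
    then have "(S has_derivative (\<lambda>h. 0)) (at z)"
      by (rule has_derivative_transform_within_open[OF _ open_V]) (use True r in \<open>auto simp: S_def\<close>)
    then show ?thesis using r True by (simp add: G_def flip: zero_prod_def)
  next
    case False
    have "((\<lambda>z. \<kappa> (snd z)) has_derivative (\<lambda>h. \<kappa>' (snd z) \<bullet> snd h)) (at z)"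
      by (rule has_derivative_compose[OF _ der\<kappa>, of snd]) (auto intro!: derivative_eq_intros)
    from has_derivative_mult[OF this der_s[OF False]] show ?thesis
      unfolding S_def by (simp add: G_def inner_add_left inner_prod_def algebra_simps)
  qed
  have "continuous_on ?U G"
  proof -
    have "continuous_on ?U s"
      by (rule has_derivative_continuous_on, rule has_derivative_at_withinI[OF der_s]) simp
    moreover have "continuous_on UNIV \<kappa>"
      by (rule has_derivative_continuous_on, rule has_derivative_at_withinI[OF der\<kappa>])
    then have "continuous_on ?U (\<lambda>z. \<kappa> (snd z))"
      by (rule continuous_on_compose2) (auto intro!: continuous_intros)
    moreover have "continuous_on ?U (\<lambda>z. \<kappa>' (snd z))"
      by (rule continuous_on_compose2[OF cont\<kappa>]) (auto intro!: continuous_intros)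
    moreover have "continuous_on ?U g" using gen unfolding generating_function_def by blast
    ultimately show ?thesis unfolding G_def by (intro continuous_intros)
  qed
  moreover have "continuous_on ?V G"
    by (rule continuous_on_eq[of _ "\<lambda>_. 0"]) (use r in \<open>auto simp: G_def zero_prod_def\<close>)
  ultimately have contG: "continuous_on UNIV G"
    unfolding UV[symmetric] using open_U open_V by (rule continuous_on_open_Un[rotated 2])
  have contS: "continuous_on UNIV S"
    by (rule has_derivative_continuous_on, rule has_derivative_at_withinI[OF der])
  have perS: "S (Q + k, p) = S (Q, p)" if "k \<in> int_vecs" for Q p k
    using gen that by (simp add: S_def generating_function_def)
  \<comment> \<open>A generating function is required to be periodic, its gradient is not;
    periodicity of the gradient follows from uniqueness of derivatives.\<close>
  have perG: "G (Q + k, p) = G (Q, p)" if k: "k \<in> int_vecs" for Q p k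
  proof (rule inner_ext, rule has_derivative_unique[OF _ der])
    have "((\<lambda>z. z + (k, 0)) has_derivative (\<lambda>h. h)) (at (Q, p))"
      by (auto intro!: derivative_eq_intros)
    from has_derivative_compose[OF this der]
    have "((\<lambda>z. S (z + (k, 0))) has_derivative (\<lambda>h. G (Q + k, p) \<bullet> h)) (at (Q, p))" by simp
    moreover have "(\<lambda>z. S (z + (k, 0))) = S" using perS[OF k] by (auto simp: fun_eq_iff)
    ultimately show "(S has_derivative (\<lambda>h. G (Q + k, p) \<bullet> h)) (at (Q, p))" by simp
  qed
  have supp: "S (Q, p) = 0 \<and> G (Q, p) = 0" if "norm p > R" for Q p
    using R[OF that] by (simp add: S_def G_def zero_prod_def)
  show ?thesis
  proof (rule that)
    show "uniform_gradient S G"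
      using uniformly_continuous_periodic[OF contS perS, of R] uniformly_continuous_periodic[OF contG perG, of R] supp
      by (intro uniform_gradientI der) auto
    show "G (Q + k, p) = G (Q, p)" if "k \<in> int_vecs" for Q p k by (rule perG[OF that])
    show "norm (fst (G (Q, p))) \<le> norm p / 2" for Q p
    proof (cases "p = 0")
      case False
      then have "norm (fst (g (Q, p))) \<le> norm p / 2" using gen by (simp add: generating_function_def)
      then have "\<kappa> p * norm (fst (g (Q, p))) \<le> 1 * (norm p / 2)" using \<kappa> by (intro mult_mono) auto
      then show ?thesis using \<kappa> by (simp add: G_def)
    qed (use r in \<open>simp add: G_def\<close>)
    show "G (Q, p) = g (Q, p)" if "r\<^sub>1 \<le> norm p" "norm p \<le> r\<^sub>2" for Q p
      using one[OF that] by (simp add: G_def prod_eq_iff)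
  qed
qed

subsection \<open>Critical points of the action\<close>

text \<open>The points \<open>z k y\<close> at which the generating functions are evaluated depend
  affinely on the variables, with scalar coefficients. By the chain rule the inner sum is the
  gradient in variable i of the sum of the \<open>S k\<close>, so the saddle point theorem applies.
  The coefficients are chosen only when the action is set up.\<close>

lemma almost_critical_sum:
  fixes S :: "nat \<Rightarrow> 'v::euclidean_space \<times> 'v \<Rightarrow> real" and G :: "nat \<Rightarrow> 'v \<times> 'v \<Rightarrow> 'v \<times> 'v"
    and a c :: "nat \<Rightarrow> nat \<Rightarrow> real" and \<sigma> :: "nat \<Rightarrow> real" and n N :: nat and \<zeta> :: "'v \<times> 'v"
  assumes SG: "\<And>k. k < N \<Longrightarrow> uniform_gradient (S k) (G k)" and "\<delta> > 0"
  defines "z \<equiv> \<lambda>k y. \<zeta> + (\<Sum>i<n. (a k i *\<^sub>R y i, c k i *\<^sub>R y i))"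
  obtains y where "(\<Sum>i<n. norm (\<sigma> i *\<^sub>R y i +
    (\<Sum>k<N. a k i *\<^sub>R fst (G k (z k y)) + c k i *\<^sub>R snd (G k (z k y))))) < \<delta>"
proof -
  define W where "W y = (\<Sum>k<N. S k (z k y))" for y
  define w where "w y i = (\<Sum>k<N. a k i *\<^sub>R fst (G k (z k y)) + c k i *\<^sub>R snd (G k (z k y)))" for y i
  have "\<exists>C. \<forall>k<N. \<forall>x. \<bar>S k x\<bar> \<le> C \<and> norm (G k x) \<le> C"
  proof -
    have "\<forall>k\<in>{..<N}. \<exists>C. \<forall>x. \<bar>S k x\<bar> \<le> C \<and> norm (G k x) \<le> C"
    proof
      fix k assume "k \<in> {..<N}"
      then have "bounded (range (S k))" "bounded (range (G k))"
        using SG by (auto simp: uniform_gradient_def)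
      then obtain C C' where "\<And>x. \<bar>S k x\<bar> \<le> C" "\<And>x. norm (G k x) \<le> C'"
        by (auto simp: bounded_iff)
      then show "\<exists>C. \<forall>x. \<bar>S k x\<bar> \<le> C \<and> norm (G k x) \<le> C"
        by (intro exI[of _ "max C C'"]) (auto simp: le_max_iff_disj)
    qed
    then obtain C where C: "\<And>k x. k < N \<Longrightarrow> \<bar>S k x\<bar> \<le> C k \<and> norm (G k x) \<le> C k"
      unfolding bchoice_iff by blast
    have "C k \<le> (\<Sum>k<N. \<bar>C k\<bar>)" if "k < N" for k
      using member_le_sum[of k "{..<N}" "\<lambda>k. \<bar>C k\<bar>"] that by auto
    then show ?thesis using C by (meson order_trans)
  qed
  then obtain C where C: "\<And>k x. k < N \<Longrightarrow> \<bar>S k x\<bar> \<le> C" "\<And>k x. k < N \<Longrightarrow> norm (G k x) \<le> C"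
    by blast
  have contz: "continuous_on UNIV (z k)" for k
    unfolding z_def by (intro continuous_intros) auto
  have contG: "continuous_on UNIV (\<lambda>y. G k (z k y))" if "k < N" for k
    using SG[OF that] unfolding uniform_gradient_def
    by (intro continuous_on_compose2[OF _ contz]) auto
  have linear: "z k y' - z k y = (\<Sum>i<n. (a k i *\<^sub>R (y' i - y i), c k i *\<^sub>R (y' i - y i)))" for k y y'
    by (simp add: z_def sum_subtractf[symmetric] scaleR_diff_right)
  \<comment> \<open>One Lipschitz constant for all \<open>z k\<close> with respect to the sum of the
    norms. The summand 1 permits division by it.\<close>
  define L where "L = 1 + (\<Sum>k<N. \<Sum>i<n. \<bar>a k i\<bar> + \<bar>c k i\<bar>)"
  have "L \<ge> 1" unfolding L_def by (simp add: sum_nonneg)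
  have lip: "norm (z k y' - z k y) \<le> L * (\<Sum>i<n. norm (y' i - y i))" if "k < N" for k y y'
  proof -
    have "norm (z k y' - z k y) \<le> (\<Sum>i<n. L * norm (y' i - y i))"
      unfolding linear
    proof (rule sum_norm_le)
      fix i assume "i \<in> {..<n}"
      have "\<bar>a k i\<bar> + \<bar>c k i\<bar> \<le> (\<Sum>i<n. \<bar>a k i\<bar> + \<bar>c k i\<bar>)"
        using \<open>i \<in> {..<n}\<close> by (intro member_le_sum) auto
      also have "\<dots> \<le> (\<Sum>k<N. \<Sum>i<n. \<bar>a k i\<bar> + \<bar>c k i\<bar>)"
        using that by (intro member_le_sum[of k "{..<N}" "\<lambda>k. \<Sum>i<n. \<bar>a k i\<bar> + \<bar>c k i\<bar>"]) (auto intro!: sum_nonneg)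
      finally have "\<bar>a k i\<bar> + \<bar>c k i\<bar> \<le> L" by (simp add: L_def)
      have "norm (a k i *\<^sub>R (y' i - y i), c k i *\<^sub>R (y' i - y i))
          \<le> norm (a k i *\<^sub>R (y' i - y i)) + norm (c k i *\<^sub>R (y' i - y i))"
        by (rule norm_Pair_le)
      also have "\<dots> = (\<bar>a k i\<bar> + \<bar>c k i\<bar>) * norm (y' i - y i)" by (simp add: distrib_right)
      also have "\<dots> \<le> L * norm (y' i - y i)"
        using \<open>\<bar>a k i\<bar> + \<bar>c k i\<bar> \<le> L\<close> by (rule mult_right_mono) simp
      finally show "norm (a k i *\<^sub>R (y' i - y i), c k i *\<^sub>R (y' i - y i)) \<le> L * norm (y' i - y i)" .
    qed
    then show ?thesis by (simp add: sum_distrib_left)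
  qed
  show thesis
  proof (rule saddle_almost_critical[of W "N * C" n w _ \<delta> \<sigma>])
    show "\<bar>W y\<bar> \<le> N * C" for y
      unfolding W_def using C(1) by (intro order_trans[OF sum_abs] order_trans[OF sum_bounded_above[where K = C]]) auto
    show "norm (w y i) \<le> L * (N * C)" if i: "i < n" for y i
    proof -
      have "norm (w y i) \<le> (\<Sum>k<N. L * C)"
        unfolding w_def
      proof (rule sum_norm_le)
        fix k assume "k \<in> {..<N}"
        have "\<bar>a k i\<bar> + \<bar>c k i\<bar> \<le> (\<Sum>i<n. \<bar>a k i\<bar> + \<bar>c k i\<bar>)"
          using i by (intro member_le_sum) auto
        also have "\<dots> \<le> (\<Sum>k<N. \<Sum>i<n. \<bar>a k i\<bar> + \<bar>c k i\<bar>)"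
          using \<open>k \<in> _\<close> by (intro member_le_sum[of k "{..<N}" "\<lambda>k. \<Sum>i<n. \<bar>a k i\<bar> + \<bar>c k i\<bar>"]) (auto intro!: sum_nonneg)
        finally have L: "\<bar>a k i\<bar> + \<bar>c k i\<bar> \<le> L" by (simp add: L_def)
        let ?g = "G k (z k y)"
        have g: "norm ?g \<le> C" using C(2) \<open>k \<in> _\<close> by auto
        have "norm (a k i *\<^sub>R fst ?g + c k i *\<^sub>R snd ?g) \<le> \<bar>a k i\<bar> * norm (fst ?g) + \<bar>c k i\<bar> * norm (snd ?g)"
          by (rule order_trans[OF norm_triangle_ineq]) simp
        also have "\<dots> \<le> \<bar>a k i\<bar> * C + \<bar>c k i\<bar> * C"
          using g norm_fst_le[of "fst ?g" "snd ?g"] norm_snd_le[of "snd ?g" "fst ?g"]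
          by (intro add_mono mult_left_mono) auto
        also have "\<dots> = (\<bar>a k i\<bar> + \<bar>c k i\<bar>) * C" by (simp add: distrib_right)
        also have "\<dots> \<le> L * C" using L order_trans[OF norm_ge_zero g] by (rule mult_right_mono)
        finally show "norm (a k i *\<^sub>R fst ?g + c k i *\<^sub>R snd ?g) \<le> L * C" .
      qed
      then show ?thesis by (simp add: mult.left_commute)
    qed
    show "continuous_on UNIV (\<lambda>y. w y i)" for i
      unfolding w_def using contG by (intro continuous_intros) auto
    show "\<exists>K. \<forall>y y'. W y' - W y \<le> (\<Sum>i<n. w y i \<bullet> (y' i - y i))
      + \<epsilon> * (\<Sum>i<n. norm (y' i - y i)) + K * (\<Sum>i<n. norm (y' i - y i))\<^sup>2" if "\<epsilon> > 0" for \<epsilon>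
    proof -
      \<comment> \<open>Each of the N summands contributes e L times the increment.
        \<open>Suc N\<close> instead of N keeps the quotient meaningful for N = 0.\<close>
      define e where "e = \<epsilon> / (Suc N * L)"
      have "e > 0" using that \<open>L \<ge> 1\<close> by (simp add: e_def)
      have "\<forall>k\<in>{..<N}. \<exists>K. \<forall>x x'. S k x' - S k x \<le> G k x \<bullet> (x' - x) + e * norm (x' - x) + K * (norm (x' - x))\<^sup>2"
        using SG \<open>e > 0\<close> by (auto simp: uniform_gradient_def)
      then obtain K where K: "\<And>k x x'. k < N \<Longrightarrow>
          S k x' - S k x \<le> G k x \<bullet> (x' - x) + e * norm (x' - x) + K k * (norm (x' - x))\<^sup>2"
        unfolding bchoice_iff by blast
      show ?thesis
      proof (intro exI allI)
        fix y y' :: "nat \<Rightarrow> 'v"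
        let ?D = "\<Sum>i<n. norm (y' i - y i)"
        have D: "?D \<ge> 0" by (simp add: sum_nonneg)
        have "S k (z k y') - S k (z k y) \<le> G k (z k y) \<bullet> (z k y' - z k y) + (e * (L * ?D) + \<bar>K k\<bar> * (L * ?D)\<^sup>2)"
          if "k < N" for k
        proof -
          have "S k (z k y') - S k (z k y) \<le> G k (z k y) \<bullet> (z k y' - z k y)
             + e * norm (z k y' - z k y) + K k * (norm (z k y' - z k y))\<^sup>2"
            by (rule K[OF that])
          moreover have "e * norm (z k y' - z k y) \<le> e * (L * ?D)"
            using lip[OF that] \<open>e > 0\<close> by simp
          moreover have "K k * (norm (z k y' - z k y))\<^sup>2 \<le> \<bar>K k\<bar> * (L * ?D)\<^sup>2"
            using lip[OF that] by (intro mult_mono power_mono) auto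
          ultimately show ?thesis by linarith
        qed
        then have "W y' - W y \<le> (\<Sum>k<N. G k (z k y) \<bullet> (z k y' - z k y) + (e * (L * ?D) + \<bar>K k\<bar> * (L * ?D)\<^sup>2))"
          unfolding W_def sum_subtractf[symmetric] by (intro sum_mono) auto
        also have "\<dots> = (\<Sum>k<N. G k (z k y) \<bullet> (z k y' - z k y)) + N * (e * (L * ?D)) + (\<Sum>k<N. \<bar>K k\<bar>) * (L * ?D)\<^sup>2"
          by (simp add: sum.distrib sum_distrib_right)
        also have "(\<Sum>k<N. G k (z k y) \<bullet> (z k y' - z k y)) = (\<Sum>i<n. w y i \<bullet> (y' i - y i))"
          unfolding linear w_def inner_sum_right inner_sum_left
          by (subst sum.swap) (auto simp: inner_prod_def inner_add_left intro!: sum.cong)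
        also have "N * (e * (L * ?D)) \<le> \<epsilon> * ?D"
        proof -
          have "N * (e * (L * ?D)) \<le> Suc N * (e * (L * ?D))"
            using \<open>e > 0\<close> \<open>L \<ge> 1\<close> D by (intro mult_right_mono) auto
          also have "\<dots> = \<epsilon> * ?D" using \<open>L \<ge> 1\<close> by (simp add: e_def del: of_nat_Suc)
          finally show ?thesis .
        qed
        finally show "W y' - W y \<le> (\<Sum>i<n. w y i \<bullet> (y' i - y i)) + \<epsilon> * ?D + ((\<Sum>k<N. \<bar>K k\<bar>) * L\<^sup>2) * ?D\<^sup>2"
          by (simp add: power_mult_distrib mult.assoc)
      qed
    qed
  qed (use \<open>\<delta> > 0\<close> that in \<open>auto simp: w_def\<close>)
qed

lemma sum_lessThan_double_Suc:
  fixes h :: "nat \<Rightarrow> 'a::comm_monoid_add"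
  shows "(\<Sum>i<Suc (2 * m). h i) = (\<Sum>j<m. h j) + (\<Sum>j<m. h (m + j)) + h (2 * m)"
proof -
  have "(\<Sum>i<m + l. h i) = (\<Sum>j<m. h j) + (\<Sum>j<l. h (m + j))" for l
    by (induction l) (auto simp: add.assoc)
  from this[of m] show ?thesis by (simp add: mult_2)
qed

text \<open>The variables are \<open>\<alpha>\<^sub>j = y j\<close>, \<open>\<beta>\<^sub>j = y (m + j)\<close> and \<open>x = y (2 * m)\<close>. With
  \<open>Q\<^sub>0 = x\<close>, \<open>Q\<^sub>j\<^sub>+\<^sub>1 - Q\<^sub>j = \<alpha>\<^sub>j - \<beta>\<^sub>j\<close> and \<open>P\<^sub>j\<^sub>+\<^sub>1 - p = \<alpha>\<^sub>j + \<beta>\<^sub>j\<close>, the action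
  \<open>\<Sum>\<^sub>j (P\<^sub>j\<^sub>+\<^sub>1 - p) \<bullet> (Q\<^sub>j\<^sub>+\<^sub>1 - Q\<^sub>j) + \<Sum>\<^sub>k S\<^sub>k(Q\<^sub>k, P\<^sub>k)\<close> has quadratic part \<open>|\<alpha>|\<^sup>2 - |\<beta>|\<^sup>2\<close>.\<close>

lemma action_critical_point:
  fixes G :: "nat \<Rightarrow> (real ^ 'n) \<times> (real ^ 'n) \<Rightarrow> (real ^ 'n) \<times> (real ^ 'n)"
  assumes SG: "\<And>k. k \<le> m \<Longrightarrow> uniform_gradient (S k) (G k)"
    and per: "\<And>k Q p v. k \<le> m \<Longrightarrow> v \<in> int_vecs \<Longrightarrow> G k (Q + v, p) = G k (Q, p)"
  obtains Q P where "P 0 = p"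
    "\<And>k. k < m \<Longrightarrow> P (Suc k) = P k + fst (G k (Q k, P k))"
    "\<And>k. k < m \<Longrightarrow> Q k = Q (Suc k) + snd (G (Suc k) (Q (Suc k), P (Suc k)))"
    "p = P m + fst (G m (Q m, P m))"
proof -
  define n where "n = Suc (2 * m)"
  \<comment> \<open>Row k expresses (Q_k, P_k) in the variables: Q_k is x plus the sum of \<alpha>_j
    - \<beta>_j over j < k, and P_k is p + \<alpha>_j + \<beta>_j for k = j + 1. Row 0 gives P_0 =
    p, as 0 is no successor.\<close>
  define a c :: "nat \<Rightarrow> nat \<Rightarrow> real" where
    "a k i = (if i < m then of_bool (i < k) else if i < 2 * m then - of_bool (i - m < k) else 1)"
    and "c k i = (if i < m then of_bool (k = Suc i) else if i < 2 * m then of_bool (k = Suc (i - m)) else 0)"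
    for k i
  \<comment> \<open>The saddle point theorem takes half of \<sigma> as coefficients, the action has
    |\<alpha>|^2 - |\<beta>|^2; hence the factor 2. The value 0 belongs to the degenerate direction
    x.\<close>
  define \<sigma> :: "nat \<Rightarrow> real" where "\<sigma> i = (if i < m then 2 else if i < 2 * m then - 2 else 0)" for i
  define z where "z k y = (0, p) + (\<Sum>i<n. (a k i *\<^sub>R y i, c k i *\<^sub>R y i))" for k and y :: "nat \<Rightarrow> real ^ 'n"
  define w where "w y i = (\<Sum>k<Suc m. a k i *\<^sub>R fst (G k (z k y)) + c k i *\<^sub>R snd (G k (z k y)))" for y i
  define f where "f y = (\<Sum>i<n. norm (\<sigma> i *\<^sub>R y i + w y i))" for y
  have small: "\<exists>y. f y < \<delta>" if "\<delta> > 0" for \<delta>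
  proof -
    have "uniform_gradient (S k) (G k)" if "k < Suc m" for k using SG that by simp
    from almost_critical_sum[where N = "Suc m" and S = S and G = G and \<zeta> = "(0, p)" and n = n
        and a = a and c = c and \<sigma> = \<sigma>, OF this that]
    show ?thesis unfolding f_def w_def z_def by blast
  qed
  have cont: "continuous_on UNIV f"
  proof -
    have contz: "continuous_on UNIV (z k)" for k
      unfolding z_def by (intro continuous_intros) auto
    have "continuous_on UNIV (\<lambda>y. G k (z k y))" if "k < Suc m" for k
      using SG[of k] that unfolding uniform_gradient_def
      by (intro continuous_on_compose2[OF _ contz]) auto
    then show ?thesis unfolding f_def w_def by (intro continuous_intros) auto
  qed
  have "\<exists>C. \<forall>i y. norm (w y i) \<le> C"
  proof -
    have "\<forall>k\<in>{..<Suc m}. \<exists>C. \<forall>x. norm (G k x) \<le> C"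
      using SG by (auto simp: uniform_gradient_def bounded_iff less_Suc_eq_le)
    then obtain C where C: "\<And>k x. k < Suc m \<Longrightarrow> norm (G k x) \<le> C k"
      unfolding bchoice_iff by blast
    have "norm (w y i) \<le> (\<Sum>k<Suc m. 1 * C k + 1 * C k)" for i y
      unfolding w_def
    proof (rule sum_norm_le)
      fix k assume "k \<in> {..<Suc m}"
      let ?g = "G k (z k y)"
      have "norm (fst ?g) \<le> C k" "norm (snd ?g) \<le> C k"
        using norm_fst_le[of "fst ?g" "snd ?g"] norm_snd_le[of "snd ?g" "fst ?g"] C[of k "z k y"] \<open>k \<in> _\<close>
        by auto
      then have "norm (a k i *\<^sub>R fst ?g) \<le> 1 * C k" "norm (c k i *\<^sub>R snd ?g) \<le> 1 * C k"
        unfolding norm_scaleR by (intro mult_mono; simp add: a_def c_def)+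
      then show "norm (a k i *\<^sub>R fst ?g + c k i *\<^sub>R snd ?g) \<le> 1 * C k + 1 * C k"
        by (rule norm_triangle_mono)
    qed
    then show ?thesis by blast
  qed
  then obtain C where C: "\<And>y i. norm (w y i) \<le> C" by blast
  \<comment> \<open>Almost critical points can be moved into \<open>K\<close>: the bound on
    \<open>w\<close> controls the variables with nonzero \<sigma>, an integer translation brings x
    into the unit box, and the variables beyond n are set to 0.\<close>
  define K where "K = {y :: nat \<Rightarrow> real ^ 'n. \<forall>i. y i \<in> (if i < 2 * m then cball 0 (C + 1) else if i = 2 * m then cbox 0 1 else {0})}"
  have "compact K" unfolding K_def by (rule compact_fun_box) auto
  have smallK: "\<exists>y\<in>K. f y < \<delta>" if \<delta>: "\<delta> > 0" "\<delta> \<le> 1" for \<delta>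
  proof -
    obtain y where y: "f y < \<delta>" using small[OF \<delta>(1)] by blast
    obtain v where v: "v \<in> int_vecs" "y (2 * m) + v \<in> cbox 0 1" by (rule int_vec_shift)
    define y' where "y' i = (if i < 2 * m then y i else if i = 2 * m then y i + v else 0)" for i
    \<comment> \<open>Translating x translates every Q_k and changes no P_k, so \<open>w\<close>
      stays the same by periodicity, and the quadratic part does not see x.\<close>
    have "z k y' = z k y + (v, 0)" for k
      unfolding z_def n_def sum_lessThan_double_Suc
      by (simp add: y'_def a_def c_def)
    then have "w y' i = w y i" for i
      unfolding w_def using per[OF _ v(1), of _ "fst (z _ y)" "snd (z _ y)"]
      by (intro sum.cong) (auto simp: plus_prod_def)
    then have "f y' = f y"
      unfolding f_def by (intro sum.cong) (auto simp: y'_def n_def \<sigma>_def)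
    moreover have "y' \<in> K"
    proof -
      have "norm (y i) \<le> C + 1" if "i < 2 * m" for i
      proof -
        have "norm (\<sigma> i *\<^sub>R y i + w y i) \<le> f y"
          unfolding f_def using that by (intro member_le_sum) (auto simp: n_def)
        then have "norm (\<sigma> i *\<^sub>R y i) \<le> 1 + C"
          using norm_triangle_ineq4[of "\<sigma> i *\<^sub>R y i + w y i" "w y i"] C[of y i] y \<open>\<delta> \<le> 1\<close> by simp
        moreover have "norm (\<sigma> i *\<^sub>R y i) = 2 * norm (y i)" using that by (simp add: \<sigma>_def)
        ultimately show ?thesis using norm_ge_zero[of "y i"] by linarith
      qed
      then have "y' i \<in> (if i < 2 * m then cball 0 (C + 1) else if i = 2 * m then cbox 0 1 else {0})" for i
        using v(2) unfolding y'_def by (cases "i = 2 * m") simp_all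
      then show ?thesis unfolding K_def by blast
    qed
    ultimately show ?thesis using y by metis
  qed
  \<comment> \<open>Compactness turns almost critical points into a critical one: \<open>f\<close>
    attains its infimum on \<open>K\<close>, and that infimum is 0.\<close>
  obtain y where y: "\<And>y'. y' \<in> K \<Longrightarrow> f y \<le> f y'"
  proof -
    have "K \<noteq> {}" using smallK[of 1] by auto
    then have "\<exists>x\<in>K. \<forall>y\<in>K. f x \<le> f y"
      by (rule continuous_attains_inf[OF \<open>compact K\<close> _ continuous_on_subset[OF cont subset_UNIV]])
    then show thesis using that by blast
  qed
  have "f y \<le> 0"
  proof (rule ccontr)
    assume "\<not> f y \<le> 0"
    then obtain y' where "y' \<in> K" "f y' < min (f y) 1" using smallK[of "min (f y) 1"] by auto
    then show False using y[of y'] by auto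
  qed
  then have "f y = 0" using sum_nonneg[of "{..<n}" "\<lambda>i. norm (\<sigma> i *\<^sub>R y i + w y i)"] by (simp add: f_def)
  then have crit: "\<sigma> i *\<^sub>R y i + w y i = 0" if "i < n" for i
    using that unfolding f_def by (subst (asm) sum_nonneg_eq_0_iff) auto
  define Q where "Q k = fst (z k y)" for k
  define P where "P k = snd (z k y)" for k
  define b where "b k = fst (G k (Q k, P k))" for k
  define d where "d k = snd (G k (Q k, P k))" for k
  have z: "z k y = (Q k, P k)" for k by (simp add: Q_def P_def)
  have Q: "Q k = y (2 * m) + (\<Sum>j<m. of_bool (j < k) *\<^sub>R (y j - y (m + j)))" for k
    unfolding Q_def z_def n_def sum_lessThan_double_Suc
    by (simp add: fst_sum a_def sum_subtractf[symmetric] sum_negf scaleR_diff_right)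
  have P: "P k = p + (\<Sum>j<m. of_bool (k = Suc j) *\<^sub>R (y j + y (m + j)))" for k
    unfolding P_def z_def n_def sum_lessThan_double_Suc
    by (simp add: snd_sum c_def sum.distrib[symmetric] scaleR_add_right)
  have QSuc: "Q (Suc k) - Q k = y k - y (m + k)" if "k < m" for k
  proof -
    have "Q (Suc k) - Q k = (\<Sum>j<m. of_bool (j = k) *\<^sub>R (y j - y (m + j)))"
      unfolding Q by (simp add: sum_subtractf[symmetric]) (intro sum.cong, auto)
    also have "\<dots> = (\<Sum>j<m. if j = k then y j - y (m + j) else 0)" by (intro sum.cong) auto
    finally show ?thesis using that by simp
  qed
  have PSuc: "P (Suc k) = p + (y k + y (m + k))" if "k < m" for k
  proof -
    have "P (Suc k) = p + (\<Sum>j<m. if j = k then y j + y (m + j) else 0)"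
      unfolding P by (intro arg_cong2[where f = "(+)"] sum.cong) auto
    then show ?thesis using that by simp
  qed
  have P0: "P 0 = p" unfolding P by simp
  \<comment> \<open>Criticality in the direction x. It becomes the closing condition that the
    momentum after the last map is again \<open>p\<close>.\<close>
  have total: "(\<Sum>k<Suc m. b k) = 0"
    using crit[of "2 * m"] by (simp add: n_def \<sigma>_def w_def a_def c_def z b_def)
  have pick: "(\<Sum>k<Suc m. of_bool (k = Suc j) *\<^sub>R d k) = d (Suc j)" if "j < m" for j
  proof -
    have "(\<Sum>k<Suc m. of_bool (k = Suc j) *\<^sub>R d k) = (\<Sum>k<Suc m. if k = Suc j then d k else 0)"
      by (intro sum.cong) auto
    then show ?thesis using that by (simp del: sum.lessThan_Suc)
  qed
  define B where "B j = (\<Sum>k<Suc m. of_bool (j < k) *\<^sub>R b k)" for j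
  have \<alpha>: "2 *\<^sub>R y j + (B j + d (Suc j)) = 0" if "j < m" for j
    using crit[of j] that pick[OF that]
    by (simp add: n_def \<sigma>_def w_def a_def c_def z B_def sum.distrib flip: b_def d_def del: sum.lessThan_Suc)
  have \<beta>: "- 2 *\<^sub>R y (m + j) + (- B j + d (Suc j)) = 0" if "j < m" for j
    using crit[of "m + j"] that pick[OF that]
    by (simp add: n_def \<sigma>_def w_def a_def c_def z B_def sum.distrib sum_negf sum_subtractf flip: b_def d_def del: sum.lessThan_Suc)
  \<comment> \<open>Half the sum of the equations for \<alpha>_j and \<beta>_j is the recursion for
    Q; half their difference, together with \<open>total\<close>, is the one for P.\<close>
  have diff: "y j - y (m + j) = - d (Suc j)" if "j < m" for j
  proof -
    have "2 *\<^sub>R (y j - y (m + j) + d (Suc j)) =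
        (2 *\<^sub>R y j + (B j + d (Suc j))) + (- 2 *\<^sub>R y (m + j) + (- B j + d (Suc j)))"
      by (simp add: algebra_simps scaleR_2)
    also have "\<dots> = 0" unfolding \<alpha>[OF that] \<beta>[OF that] by simp
    finally show ?thesis by (simp add: eq_neg_iff_add_eq_0)
  qed
  have add: "y j + y (m + j) = - B j" if "j < m" for j
  proof -
    have "2 *\<^sub>R (y j + y (m + j) + B j) =
        (2 *\<^sub>R y j + (B j + d (Suc j))) - (- 2 *\<^sub>R y (m + j) + (- B j + d (Suc j)))"
      by (simp add: algebra_simps scaleR_2)
    also have "\<dots> = 0" unfolding \<alpha>[OF that] \<beta>[OF that] by simp
    finally show ?thesis by (simp add: eq_neg_iff_add_eq_0)
  qed
  have B: "- B j = (\<Sum>k<Suc j. b k)" if "j < m" for j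
  proof -
    have split: "{..<Suc m} = {..<Suc j} \<union> {Suc j..<Suc m}" using that by auto
    have "(\<Sum>k<Suc m. b k) = (\<Sum>k<Suc j. b k) + (\<Sum>k=Suc j..<Suc m. b k)"
      unfolding split by (rule sum.union_disjoint) auto
    moreover have "B j = (\<Sum>k=Suc j..<Suc m. b k)"
      unfolding B_def by (rule sum.mono_neutral_cong_right) auto
    ultimately show ?thesis using total by (metis minus_unique add.commute)
  qed
  have Psum: "P k = p + (\<Sum>j<k. b j)" if "k \<le> m" for k
  proof (cases k)
    case (Suc j)
    then have "j < m" using that by simp
    from PSuc[OF this] add[OF this] B[OF this] show ?thesis using Suc by simp
  qed (simp add: P0)
  show thesis
  proof (rule that[of P Q])
    show "P (Suc k) = P k + fst (G k (Q k, P k))" if "k < m" for k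
      using Psum[of k] Psum[of "Suc k"] that by (simp add: b_def add.assoc)
    show "Q k = Q (Suc k) + snd (G (Suc k) (Q (Suc k), P (Suc k)))" if "k < m" for k
    proof -
      have "Q (Suc k) - Q k = - d (Suc k)" using QSuc[OF that] diff[OF that] by (rule trans)
      then show ?thesis by (simp add: d_def algebra_simps)
    qed
    show "p = P m + fst (G m (Q m, P m))"
      using Psum[of m] total by (simp add: b_def add.assoc)
  qed (rule P0)
qed

text \<open>The bound \<open>|\<partial>s/\<partial>Q| \<le> |p| / 2\<close> survives the cutoff, so a critical trajectory starting at
  \<open>p \<noteq> 0\<close> stays in an annulus that is known in advance, where nothing has been cut off.\<close>

lemma generating_functions_trajectory:
  fixes p :: "real ^ 'n"
  assumes gen: "\<And>k. k \<le> m \<Longrightarrow> generating_function (s k) (g k)" and "p \<noteq> 0"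
  obtains Q P where "P 0 = p" "\<And>k. k \<le> m \<Longrightarrow> P k \<noteq> 0"
    "\<And>k. k < m \<Longrightarrow> P (Suc k) = P k + fst (g k (Q k, P k))"
    "\<And>k. k < m \<Longrightarrow> Q k = Q (Suc k) + snd (g (Suc k) (Q (Suc k), P (Suc k)))"
    "p = P m + fst (g m (Q m, P m))"
proof -
  define r\<^sub>1 where "r\<^sub>1 = norm p / 2 ^ m"
  define r\<^sub>2 where "r\<^sub>2 = 2 ^ m * norm p"
  have "0 < r\<^sub>1" "0 < r\<^sub>2" using \<open>p \<noteq> 0\<close> by (auto simp: r\<^sub>1_def r\<^sub>2_def)
  have "\<forall>k\<in>{..m}. \<exists>G. (\<exists>S. uniform_gradient S G) \<and> (\<forall>Q p v. v \<in> int_vecs \<longrightarrow> G (Q + v, p) = G (Q, p)) \<and>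
      (\<forall>Q p. norm (fst (G (Q, p))) \<le> norm p / 2) \<and>
      (\<forall>Q p. r\<^sub>1 \<le> norm p \<longrightarrow> norm p \<le> r\<^sub>2 \<longrightarrow> G (Q, p) = g k (Q, p))"
  proof
    fix k assume "k \<in> {..m}"
    then have "generating_function (s k) (g k)" using gen by simp
    from generating_function_cutoff[OF this \<open>0 < r\<^sub>1\<close> \<open>0 < r\<^sub>2\<close>]
    obtain S G where "uniform_gradient S G" "\<And>Q p v. v \<in> int_vecs \<Longrightarrow> G (Q + v, p) = G (Q, p)"
      "\<And>Q p. norm (fst (G (Q, p))) \<le> norm p / 2"
      "\<And>Q p. r\<^sub>1 \<le> norm p \<Longrightarrow> norm p \<le> r\<^sub>2 \<Longrightarrow> G (Q, p) = g k (Q, p)"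
      by metis
    then show "\<exists>G. (\<exists>S. uniform_gradient S G) \<and> (\<forall>Q p v. v \<in> int_vecs \<longrightarrow> G (Q + v, p) = G (Q, p)) \<and>
      (\<forall>Q p. norm (fst (G (Q, p))) \<le> norm p / 2) \<and>
      (\<forall>Q p. r\<^sub>1 \<le> norm p \<longrightarrow> norm p \<le> r\<^sub>2 \<longrightarrow> G (Q, p) = g k (Q, p))"
      by blast
  qed
  then obtain G where "\<forall>k\<in>{..m}. (\<exists>S. uniform_gradient S (G k)) \<and> (\<forall>Q p v. v \<in> int_vecs \<longrightarrow> G k (Q + v, p) = G k (Q, p)) \<and>
      (\<forall>Q p. norm (fst (G k (Q, p))) \<le> norm p / 2) \<and>
      (\<forall>Q p. r\<^sub>1 \<le> norm p \<longrightarrow> norm p \<le> r\<^sub>2 \<longrightarrow> G k (Q, p) = g k (Q, p))"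
    unfolding bchoice_iff by blast
  then have G: "\<And>k. k \<le> m \<Longrightarrow> \<exists>S. uniform_gradient S (G k)"
      "\<And>k Q p v. k \<le> m \<Longrightarrow> v \<in> int_vecs \<Longrightarrow> G k (Q + v, p) = G k (Q, p)"
      "\<And>k Q p. k \<le> m \<Longrightarrow> norm (fst (G k (Q, p))) \<le> norm p / 2"
      "\<And>k Q p. k \<le> m \<Longrightarrow> r\<^sub>1 \<le> norm p \<Longrightarrow> norm p \<le> r\<^sub>2 \<Longrightarrow> G k (Q, p) = g k (Q, p)"
    by simp_all
  from G(1) obtain S where S: "\<And>k. k \<le> m \<Longrightarrow> uniform_gradient (S k) (G k)" by metis
  obtain Q P where P0: "P 0 = p" and PSuc: "\<And>k. k < m \<Longrightarrow> P (Suc k) = P k + fst (G k (Q k, P k))"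
    and QSuc: "\<And>k. k < m \<Longrightarrow> Q k = Q (Suc k) + snd (G (Suc k) (Q (Suc k), P (Suc k)))"
    and Pm: "p = P m + fst (G m (Q m, P m))"
    using action_critical_point[of m S G p, OF S G(2)] by blast
  \<comment> \<open>A step changes the momentum by at most half of its norm, so the norm changes by
    a factor between 1/2 and 2. This is the origin of the powers of 2 in the radii of the
    annulus.\<close>
  have bounds: "norm p / 2 ^ k \<le> norm (P k) \<and> norm (P k) \<le> 2 ^ k * norm p" if "k \<le> m" for k
    using that
  proof (induction k)
    case (Suc k)
    let ?b = "fst (G k (Q k, P k))"
    have b: "norm ?b \<le> norm (P k) / 2" using G(3)[of k "Q k" "P k"] Suc.prems by simp
    have P: "P (Suc k) = P k + ?b" using PSuc[of k] Suc.prems by simp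
    have "norm (P k) / 2 \<le> norm (P (Suc k))"
      using b norm_diff_ineq[of "P k" ?b] unfolding P by linarith
    moreover have "norm (P (Suc k)) \<le> 2 * norm (P k)"
      using b norm_triangle_ineq[of "P k" ?b] norm_ge_zero[of "P k"] unfolding P by linarith
    moreover define l u where "l = norm p / 2 ^ k" and "u = 2 ^ k * norm p"
    moreover have "l \<le> norm (P k)" "norm (P k) \<le> u" using Suc by (auto simp: l_def u_def)
    moreover have l: "norm p / 2 ^ Suc k = l / 2" and u: "2 ^ Suc k * norm p = 2 * u"
      by (simp_all add: l_def u_def)
    ultimately show ?case unfolding l u by linarith
  qed (simp add: P0)
  have annulus: "r\<^sub>1 \<le> norm (P k) \<and> norm (P k) \<le> r\<^sub>2" if "k \<le> m" for k
  proof -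
    have "(2::real) ^ k \<le> 2 ^ m" using that by (intro power_increasing) auto
    then have "2 ^ k * norm p \<le> r\<^sub>2" "r\<^sub>1 \<le> norm p / 2 ^ k"
      by (auto simp: r\<^sub>1_def r\<^sub>2_def intro!: mult_right_mono divide_left_mono)
    then show ?thesis using bounds[OF that] by linarith
  qed
  have eq: "G k (Q', P k) = g k (Q', P k)" if "k \<le> m" for k Q'
    using annulus[OF that] G(4)[OF that] by blast
  show thesis
  proof (rule that[of P Q])
    show "P k \<noteq> 0" if "k \<le> m" for k using annulus[OF that] \<open>0 < r\<^sub>1\<close> by auto
    show "P (Suc k) = P k + fst (g k (Q k, P k))" if "k < m" for k
      using PSuc[OF that] eq[of k] that by simp
    show "Q k = Q (Suc k) + snd (g (Suc k) (Q (Suc k), P (Suc k)))" if "k < m" for k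
      using QSuc[OF that] eq[of "Suc k"] that by simp
    show "p = P m + fst (g m (Q m, P m))" using Pm eq[of m] by simp
  qed (rule P0)
qed

subsection \<open>Generating functions of contact maps\<close>

text \<open>One direction is treated at a time, because the displacement \<open>u\<close> of a
  lifted map will be Lipschitz in q for fixed p only; this bounds its derivative on vectors (v, 0),
  not its operator norm.\<close>

lemma directional_derivative_le_lipschitz:
  fixes f :: "'a::real_normed_vector \<Rightarrow> 'b::real_normed_vector"
  assumes der: "(f has_derivative f') (at x)"
    and lip: "\<And>t. norm (f (x + t *\<^sub>R v) - f x) \<le> L * norm (t *\<^sub>R v)"
  shows "norm (f' v) \<le> L * norm v"
proof (cases "v = 0")
  case True
  then show ?thesis using linear_0[OF has_derivative_linear[OF der]] by simp
next
  case False
  have bound: "norm (f' v) \<le> (L + e) * norm v" if "e > 0" for e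
  proof -
    obtain d where "d > 0" and
      d: "\<And>y. norm (y - x) < d \<Longrightarrow> norm (f y - f x - f' (y - x)) \<le> e * norm (y - x)"
      using der \<open>e > 0\<close> unfolding has_derivative_at_alt by blast
    define t where "t = d / (2 * norm v)"
    have "t > 0" using \<open>d > 0\<close> False by (simp add: t_def)
    have "norm (t *\<^sub>R v) < d" using \<open>d > 0\<close> False by (simp add: t_def)
    then have "norm (f (x + t *\<^sub>R v) - f x - f' (t *\<^sub>R v)) \<le> e * norm (t *\<^sub>R v)"
      using d[of "x + t *\<^sub>R v"] by simp
    then have "norm (f' (t *\<^sub>R v)) \<le> (L + e) * norm (t *\<^sub>R v)"
      using lip[of t] norm_triangle_sub[of "f' (t *\<^sub>R v)" "f (x + t *\<^sub>R v) - f x"]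
      by (simp add: norm_minus_commute distrib_right)
    then have "t * norm (f' v) \<le> t * ((L + e) * norm v)"
      using linear_scale[OF has_derivative_linear[OF der]] \<open>t > 0\<close> by (simp add: mult.left_commute)
    then show ?thesis using \<open>t > 0\<close> by simp
  qed
  have "norm (f' v) \<le> L * norm v + e" if "e > 0" for e
    using bound[of "e / norm v"] that False by (simp add: distrib_right)
  then show ?thesis by (rule field_le_epsilon)
qed

text \<open>A map \<open>(q, p) \<mapsto> (q + u (q, p), X (q, p))\<close> that pulls the contact form back to a multiple of
  itself lifts to a homogeneous map \<open>(q, p) \<mapsto> (Q, P)\<close> with \<open>P = \<lambda> X\<close> and
  \<open>P \<bullet> dQ = p \<bullet> dq\<close>. Its generating function is \<open>s(Q, p) = p \<bullet> (q - Q)\<close>.\<close>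

lemma generating_function_of_lift:
  fixes u X :: "(real ^ 'n) \<times> (real ^ 'n) \<Rightarrow> real ^ 'n"
    and Du :: "(real ^ 'n) \<times> (real ^ 'n) \<Rightarrow> ((real ^ 'n) \<times> (real ^ 'n)) \<Rightarrow>\<^sub>L (real ^ 'n)"
  defines "E \<equiv> {z. snd z \<noteq> 0}"
  assumes der: "\<And>z. z \<in> E \<Longrightarrow> (u has_derivative blinfun_apply (Du z)) (at z)"
    and contDu: "continuous_on E Du" and contX: "continuous_on E X"
    and X1: "\<And>z. z \<in> E \<Longrightarrow> norm (X z) = 1"
    and Xp: "\<And>q p. p \<noteq> 0 \<Longrightarrow> norm (X (q, p) - sgn p) \<le> 1 / 10"
    and lip: "\<And>q q' p. p \<noteq> 0 \<Longrightarrow> norm (u (q, p) - u (q', p)) \<le> 1 / 10 * norm (q - q')"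
    and contact: "\<And>z h. z \<in> E \<Longrightarrow> snd z \<bullet> fst h = 0 \<Longrightarrow> X z \<bullet> (fst h + Du z h) = 0"
    and per: "\<And>q p k. k \<in> int_vecs \<Longrightarrow> u (q + k, p) = u (q, p)"
  obtains s g where "generating_function s g"
    "\<And>Q p. p \<noteq> 0 \<Longrightarrow> (Q + snd (g (Q, p))) + u (Q + snd (g (Q, p)), p) = Q"
    "\<And>Q p. p \<noteq> 0 \<Longrightarrow> sgn (p + fst (g (Q, p))) = X (Q + snd (g (Q, p)), p)"
proof -
  have open_E: "open E" unfolding E_def by (intro open_Collect_neq continuous_intros)
  \<comment> \<open>(Q, p) can serve as coordinates since q is recovered as the fixed point of the
    contraction that sends q to Q - u(q, p).\<close>
  have fix1: "\<exists>!q. q + u (q, p) = Q" if "p \<noteq> 0" for Q p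
  proof -
    have "\<exists>!q. Q - u (q, p) = q"
      using lip[OF that] by (intro banach_fix_type[of "1 / 10"]) (auto simp: dist_norm norm_minus_commute)
    moreover have "Q - u (q, p) = q \<longleftrightarrow> q + u (q, p) = Q" for q by (auto simp: algebra_simps)
    ultimately show ?thesis by simp
  qed
  define r where "r y = (THE q. q + u (q, snd y) = fst y)" for y
  have r: "r (Q, p) + u (r (Q, p), p) = Q" if "p \<noteq> 0" for Q p
    using theI'[OF fix1[OF that]] by (simp add: r_def)
  have r_eq: "r (Q, p) = q" if "p \<noteq> 0" "q + u (q, p) = Q" for Q p q
    using fix1[OF that(1)] r[OF that(1)] that(2) by blast
  define R where "R y = (r y, snd y)" for y
  have RE: "R y \<in> E" if "y \<in> E" for y using that by (simp add: R_def E_def)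
  have contu: "continuous_on E u"
    by (rule has_derivative_continuous_on, rule has_derivative_at_withinI[OF der])
  have contr: "isCont r y" if "y \<in> E" for y
  proof -
    obtain Q p where y: "y = (Q, p)" "p \<noteq> 0" using \<open>y \<in> E\<close> by (cases y) (auto simp: E_def)
    \<comment> \<open>10/9 = 1 / (1 - 1/10): the variation of \<open>u\<close> in its first argument
      is absorbed on the left.\<close>
    let ?b = "\<lambda>y'. (10 / 9) * (norm (fst y' - Q) + norm (u (r y, snd y') - u (r y, p)))"
    have ev: "\<forall>\<^sub>F y' in at y. norm (r y' - r y) \<le> ?b y'"
      unfolding eventually_at_topological
    proof (intro exI[of _ E] conjI ballI impI open_E \<open>y \<in> E\<close>)
      fix y' assume "y' \<in> E"
      obtain Q' p' where y': "y' = (Q', p')" "p' \<noteq> 0" using \<open>y' \<in> E\<close> by (cases y') (auto simp: E_def)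
      have "r y' - r y = (Q' - Q) - (u (r y', p') - u (r y, p')) - (u (r y, p') - u (r y, p))"
        using r[OF y(2), of Q] r[OF y'(2), of Q'] y(1) y'(1) by (simp add: algebra_simps)
      then have "norm (r y' - r y) \<le> norm (Q' - Q) + norm (u (r y', p') - u (r y, p')) + norm (u (r y, p') - u (r y, p))"
        using norm_triangle_ineq4[of "Q' - Q - (u (r y', p') - u (r y, p'))" "u (r y, p') - u (r y, p)"]
          norm_triangle_ineq4[of "Q' - Q" "u (r y', p') - u (r y, p')"] by simp
      then show "norm (r y' - r y) \<le> ?b y'"
        using lip[OF y'(2), of "r y'" "r y"] by (simp add: y')
    qed
    have "(?b \<longlongrightarrow> (10 / 9) * (norm (fst y - Q) + norm (u (r y, snd y) - u (r y, p)))) (at y)"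
    proof -
      have "isCont u (r y, snd y)"
        using contu open_E \<open>y \<in> E\<close> by (auto simp: continuous_on_eq_continuous_at E_def)
      then have "((\<lambda>y'. u (r y, snd y')) \<longlongrightarrow> u (r y, snd y)) (at y)"
        by (rule isCont_tendsto_compose) (intro tendsto_intros)
      then show ?thesis by (intro tendsto_intros)
    qed
    then have "(?b \<longlongrightarrow> 0) (at y)" by (simp add: y(1))
    with ev have "((\<lambda>y'. r y' - r y) \<longlongrightarrow> 0) (at y)" by (rule Lim_null_comparison)
    then show ?thesis unfolding isCont_def by (rule LIM_zero_cancel)
  qed
  have contR: "continuous_on E R"
    unfolding R_def using contr by (intro continuous_intros continuous_at_imp_continuous_on) auto
  \<comment> \<open>The derivative of the map from (q, p) to (Q, p), whose inverse is
    \<open>R\<close>. Since \<open>R\<close> is already known to exist and to be continuous,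
    injectivity of \<open>DH\<close> is all that its differentiability still requires in finite
    dimension.\<close>
  define DH where "DH z h = (fst h + Du z h, snd h)" for z h
  have DH: "((\<lambda>z. (fst z + u z, snd z)) has_derivative DH z) (at z)" if "z \<in> E" for z
    unfolding DH_def using der[OF that] by (auto intro!: derivative_eq_intros)
  have Du_le: "norm (Du z (v, 0)) \<le> 1 / 10 * norm v" if "z \<in> E" for z v
    using directional_derivative_le_lipschitz[OF der[OF that], of "(v, 0)" "1 / 10"] lip[of "snd z" "fst z + _ *\<^sub>R v" "fst z"] that
    by (cases z) (simp add: E_def)
  have injDH: "inj (DH z)" if "z \<in> E" for z
  proof (rule linear_injective_0[THEN iffD2, OF has_derivative_linear[OF DH[OF that]]], intro allI impI)
    fix h assume h: "DH z h = 0"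
    then have h2: "snd h = 0" and "fst h = - Du z h"
      by (auto simp: DH_def prod_eq_iff eq_neg_iff_add_eq_0)
    have h': "h = (fst h, 0)" using h2 by (simp add: prod_eq_iff)
    have "norm (fst h) = norm (Du z h)" by (subst \<open>fst h = - Du z h\<close>) simp
    also have "\<dots> \<le> 1 / 10 * norm (fst h)" by (subst h') (rule Du_le[OF that])
    finally have "norm (fst h) \<le> 1 / 10 * norm (fst h)" .
    then have "norm (fst h) \<le> 0" by linarith
    then show "h = 0" using h2 by (simp add: prod_eq_iff)
  qed
  \<comment> \<open>X \<bullet> dQ vanishes on the kernel of p \<bullet> dq, so it is a multiple of
    that form; evaluation on (p, 0) shows the factor to be F / |p|^2. This dictates \<lambda> =
    |p|^2 / F.\<close>
  define F where "F z = X z \<bullet> (snd z + Du z (snd z, 0))" for z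
  \<comment> \<open>X is within 1/10 of the direction of p, and the derivative of \<open>u\<close>
    contributes at most another 1/10.\<close>
  have F: "8 / 10 * norm (snd z) \<le> F z" "F z \<le> 11 / 10 * norm (snd z)" if "z \<in> E" for z
  proof -
    obtain q p where z: "z = (q, p)" "p \<noteq> 0" using \<open>z \<in> E\<close> by (cases z) (auto simp: E_def)
    have "X z \<bullet> p = norm p + (X z - sgn p) \<bullet> p"
      using z by (simp add: inner_diff_left sgn_div_norm dot_square_norm power2_eq_square)
    moreover have "\<bar>(X z - sgn p) \<bullet> p\<bar> \<le> 1 / 10 * norm p"
      using Cauchy_Schwarz_ineq2[of "X z - sgn p" p] mult_right_mono[OF Xp[OF z(2), of q] norm_ge_zero[of p]] z(1)
      by simp
    moreover have "\<bar>X z \<bullet> p\<bar> \<le> norm p"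
      using Cauchy_Schwarz_ineq2[of "X z" p] X1[OF that] by simp
    moreover have "\<bar>X z \<bullet> Du z (p, 0)\<bar> \<le> 1 / 10 * norm p"
      using Cauchy_Schwarz_ineq2[of "X z" "Du z (p, 0)"] X1[OF that] Du_le[OF that, of p] by simp
    ultimately show "8 / 10 * norm (snd z) \<le> F z" "F z \<le> 11 / 10 * norm (snd z)"
      unfolding F_def using z by (auto simp: inner_add_right)
  qed
  have Fpos: "F z > 0" if "z \<in> E" for z
  proof -
    have "0 < 8 / 10 * norm (snd z)" using that by (simp add: E_def)
    then show ?thesis using F(1)[OF that] by linarith
  qed
  define P where "P z = ((norm (snd z))\<^sup>2 / F z) *\<^sub>R X z" for z
  have contact': "snd z \<bullet> fst h = P z \<bullet> (fst h + Du z h)" if "z \<in> E" for z h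
  proof -
    let ?p = "snd z"
    have p: "?p \<noteq> 0" using that by (simp add: E_def)
    \<comment> \<open>Subtracting c times (p, 0) from h leaves a vector in the kernel of p \<bullet>
      dq, on which both sides vanish.\<close>
    define c where "c = (?p \<bullet> fst h) / (?p \<bullet> ?p)"
    have "?p \<bullet> fst (h - c *\<^sub>R (?p, 0)) = 0" using p by (simp add: c_def inner_diff_right)
    moreover have "Du z (c *\<^sub>R ?p, 0) = c *\<^sub>R Du z (?p, 0)"
      using blinfun.scaleR_right[of "Du z" c "(?p, 0)"] by simp
    ultimately have "X z \<bullet> (fst h + Du z h) = c * F z"
      using contact[OF that, of "h - c *\<^sub>R (?p, 0)"]
      by (simp add: F_def blinfun.diff_right inner_diff_right inner_add_right algebra_simps)
    then show ?thesis using Fpos[OF that] p by (simp add: P_def c_def dot_square_norm)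
  qed
  have contP: "continuous_on E P"
  proof -
    have "continuous_on E F" unfolding F_def by (intro continuous_intros contX contDu)
    moreover have "F z \<noteq> 0" if "z \<in> E" for z using Fpos[OF that] by simp
    ultimately show ?thesis unfolding P_def by (intro continuous_intros contX) auto
  qed
  define s where "s y = snd y \<bullet> (r y - fst y)" for y
  define g where "g y = (P (R y) - snd y, r y - fst y)" for y
  have sgn_P: "sgn (P z) = X z" if "z \<in> E" for z
    using Fpos[OF that] X1[OF that] that by (simp add: P_def sgn_scaleR E_def) (simp add: sgn_div_norm)
  show thesis
  proof (rule that[of s g])
    show "generating_function s g"
      unfolding generating_function_def
    proof (intro conjI allI impI)
      fix y :: "(real ^ 'n) \<times> (real ^ 'n)" assume "snd y \<noteq> 0"
      then have y: "y \<in> E" by (simp add: E_def)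
      let ?z = "R y"
      have lin: "linear (DH ?z)" by (rule has_derivative_linear[OF DH[OF RE[OF y]]])
      obtain K where K: "linear K" "K \<circ> DH ?z = id"
        using linear_injective_left_inverse[OF lin injDH[OF RE[OF y]]] by blast
      then have DHK: "DH ?z (K h) = h" for h
        using linear_inverse_left[OF lin K(1)] by (metis comp_apply id_apply)
      have "(R has_derivative K) (at y)"
      proof (rule has_derivative_inverse_basic[where g = R and y = y, OF DH[OF RE[OF y]] _ K(2) _ open_E y])
        show "bounded_linear K" using K(1) by (rule linear_conv_bounded_linear[THEN iffD1])
        show "isCont R y" using contR open_E y by (simp add: continuous_on_eq_continuous_at)
        show "(fst (R y) + u (R y), snd (R y)) = y" if "y \<in> E" for y
          using that r[of "snd y" "fst y"] by (simp add: R_def E_def)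
      qed
      then have "((\<lambda>y. fst (R y)) has_derivative (\<lambda>h. fst (K h))) (at y)"
        by (rule has_derivative_fst)
      then have "(r has_derivative (\<lambda>h. fst (K h))) (at y)" by (simp add: R_def)
      then have "(s has_derivative (\<lambda>h. snd y \<bullet> (fst (K h) - fst h) + snd h \<bullet> (r y - fst y))) (at y)"
        unfolding s_def by (auto intro!: derivative_eq_intros)
      \<comment> \<open>From p \<bullet> dq = P \<bullet> dQ one gets d(p \<bullet> (q - Q)) = (P -
        p) \<bullet> dQ + (q - Q) \<bullet> dp.\<close>
      moreover have "snd y \<bullet> (fst (K h) - fst h) + snd h \<bullet> (r y - fst y) = g y \<bullet> h" for h
      proof -
        have "fst (K h) + Du ?z (K h) = fst h" using DHK[of h] by (simp add: DH_def prod_eq_iff)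
        then have "snd y \<bullet> fst (K h) = P ?z \<bullet> fst h"
          using contact'[OF RE[OF y], of "K h"] by (simp add: R_def)
        then show ?thesis by (simp add: g_def inner_prod_def inner_diff_left inner_diff_right inner_commute)
      qed
      ultimately show "(s has_derivative (\<lambda>h. g y \<bullet> h)) (at y)" by simp
    next
      have "continuous_on E r" using contr by (simp add: continuous_at_imp_continuous_on)
      moreover have "continuous_on E (\<lambda>y. P (R y))"
        by (rule continuous_on_compose2[OF contP contR]) (use RE in auto)
      ultimately show "continuous_on {z. snd z \<noteq> 0} g"
        unfolding g_def E_def[symmetric] by (intro continuous_intros)
    next
      fix Q p k :: "real ^ 'n" assume k: "k \<in> int_vecs"
      show "s (Q + k, p) = s (Q, p)"
      proof (cases "p = 0")
        case False
        have "r (Q + k, p) = r (Q, p) + k"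
          by (rule r_eq[OF False]) (use r[OF False, of Q] per[OF k, of "r (Q, p)" p] in \<open>simp add: algebra_simps\<close>)
        then show ?thesis by (simp add: s_def)
      qed (simp add: s_def)
    next
      fix Q p :: "real ^ 'n" assume p: "p \<noteq> 0"
      let ?z = "R (Q, p)"
      have z: "?z \<in> E" by (rule RE) (simp add: E_def p)
      \<comment> \<open>The length |p|^2 / F of P is off by at most 3/10 |p| and the direction by at
        most 1/10, which together stay below |p| / 2.\<close>
      have "P ?z - p = ((norm p)\<^sup>2 / F ?z - norm p) *\<^sub>R X ?z + norm p *\<^sub>R (X ?z - sgn p)"
        using p by (simp add: P_def R_def algebra_simps sgn_div_norm)
      then have "norm (P ?z - p) \<le> \<bar>(norm p)\<^sup>2 / F ?z - norm p\<bar> * norm (X ?z) + norm p * norm (X ?z - sgn p)"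
        using norm_triangle_ineq[of "((norm p)\<^sup>2 / F ?z - norm p) *\<^sub>R X ?z" "norm p *\<^sub>R (X ?z - sgn p)"]
        by simp
      also have "\<dots> \<le> (3 / 10 * norm p) * 1 + norm p * (1 / 10)"
      proof (intro add_mono mult_mono)
        have F': "8 / 10 * norm p \<le> F ?z" "F ?z \<le> 11 / 10 * norm p" using F[OF z] by (auto simp: R_def)
        have "13 / 10 * norm p * (8 / 10 * norm p) \<le> 13 / 10 * norm p * F ?z"
          "7 / 10 * norm p * F ?z \<le> 7 / 10 * norm p * (11 / 10 * norm p)"
          using F' by (intro mult_left_mono; simp)+
        moreover have "13 / 10 * norm p * (8 / 10 * norm p) = 104 / 100 * (norm p)\<^sup>2"
          "7 / 10 * norm p * (11 / 10 * norm p) = 77 / 100 * (norm p)\<^sup>2"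
          by (simp_all add: power2_eq_square)
        ultimately have "(norm p)\<^sup>2 \<le> 13 / 10 * norm p * F ?z" "7 / 10 * norm p * F ?z \<le> (norm p)\<^sup>2"
          using zero_le_power2[of "norm p"] by linarith+
        then have "(norm p)\<^sup>2 / F ?z \<le> 13 / 10 * norm p" "7 / 10 * norm p \<le> (norm p)\<^sup>2 / F ?z"
          using Fpos[OF z] by (auto simp: field_simps)
        then show "\<bar>(norm p)\<^sup>2 / F ?z - norm p\<bar> \<le> 3 / 10 * norm p" by linarith
      qed (use X1[OF z] Xp[OF p] in \<open>auto simp: R_def\<close>)
      finally show "norm (fst (g (Q, p))) \<le> norm p / 2"
        unfolding g_def fst_conv snd_conv using norm_ge_zero[of p] by linarith
    qed
    show "(Q + snd (g (Q, p))) + u (Q + snd (g (Q, p)), p) = Q" if "p \<noteq> 0" for Q p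
      using r[OF that] by (simp add: g_def)
    show "sgn (p + fst (g (Q, p))) = X (Q + snd (g (Q, p)), p)" if "p \<noteq> 0" for Q p
      using sgn_P[of "R (Q, p)"] that by (simp add: g_def R_def E_def)
  qed
qed

section \<open>Maps of class C1 on subsets of Euclidean spaces\<close>

text \<open>The analogue of \<open>smooth_on\<close> with one derivative, which is recorded as a map
  into operators that is continuous in the operator norm, as mean value estimates require.\<close>

definition locally_C1 :: "'a::euclidean_space set \<Rightarrow> ('a \<Rightarrow> 'b::euclidean_space) \<Rightarrow> bool" where
  "locally_C1 M f \<longleftrightarrow> (\<forall>x\<in>M. \<exists>U g g'. open U \<and> x \<in> U \<and>
    (\<forall>y\<in>U. (g has_derivative blinfun_apply (g' y)) (at y)) \<and> continuous_on U g' \<and>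
    (\<forall>y\<in>M \<inter> U. g y = f y))"

lemma locally_C1E:
  assumes "locally_C1 M f" "x \<in> M"
  obtains U g g' where "open U" "x \<in> U" "\<And>y. y \<in> U \<Longrightarrow> (g has_derivative blinfun_apply (g' y)) (at y)"
    "continuous_on U g'" "\<And>y. y \<in> M \<Longrightarrow> y \<in> U \<Longrightarrow> g y = f y"
proof -
  from bspec[OF assms(1)[unfolded locally_C1_def] assms(2)]
  obtain U g g' where "open U \<and> x \<in> U \<and> (\<forall>y\<in>U. (g has_derivative blinfun_apply (g' y)) (at y)) \<and>
    continuous_on U g' \<and> (\<forall>y\<in>M \<inter> U. g y = f y)"
    by (elim exE)
  then show thesis by (intro that[of U g g']) simp_all
qed

text \<open>In finite dimension, continuity in each direction is continuity in the operator norm;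
  this is the passage from \<open>Ck_on\<close> to \<open>locally_C1\<close>.\<close>

lemma blinfun_derivative:
  fixes g :: "'a::euclidean_space \<Rightarrow> 'b::euclidean_space"
  assumes "\<And>y. y \<in> U \<Longrightarrow> (g has_derivative D y) (at y)"
    and "\<And>v. continuous_on U (\<lambda>y. D y v)"
  shows "\<exists>g'. (\<forall>y\<in>U. blinfun_apply (g' y) = D y) \<and> continuous_on U g'"
proof (intro exI conjI ballI)
  have D: "blinfun_apply (Blinfun (D y)) = D y" if "y \<in> U" for y
    using has_derivative_bounded_linear[OF assms(1)[OF that]] by (rule bounded_linear_Blinfun_apply)
  then show "blinfun_apply (Blinfun (D y)) = D y" if "y \<in> U" for y using that by blast
  show "continuous_on U (\<lambda>y. Blinfun (D y))"
  proof (rule continuous_on_blinfun_componentwise)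
    fix i :: 'a
    show "continuous_on U (\<lambda>y. blinfun_apply (Blinfun (D y)) i)"
      using assms(2)[of i] by (rule continuous_on_eq) (simp add: D)
  qed
qed

lemma locally_C1I:
  assumes "open M" "\<And>y. y \<in> M \<Longrightarrow> (f has_derivative D y) (at y)"
    and "\<And>v. continuous_on M (\<lambda>y. D y v)"
  shows "locally_C1 M f"
proof -
  obtain f' where "\<And>y. y \<in> M \<Longrightarrow> blinfun_apply (f' y) = D y" "continuous_on M f'"
    using blinfun_derivative[of M f D, OF assms(2,3)] by blast
  note f' = this
  show ?thesis
    unfolding locally_C1_def
  proof (intro ballI exI conjI)
    show "open M" by (rule assms(1))
    show "(f has_derivative blinfun_apply (f' y)) (at y)" if "y \<in> M" for y
      unfolding f'(1)[OF that] by (rule assms(2)[OF that])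
  qed (use f'(2) in simp_all)
qed

lemma smooth_on_imp_locally_C1:
  assumes "smooth_on M f"
  shows "locally_C1 M f"
  unfolding locally_C1_def
proof
  fix x assume "x \<in> M"
  from bspec[OF assms[unfolded smooth_on_def] this]
  obtain U g where "open U \<and> x \<in> U \<and> (\<forall>k. Ck_on k U g) \<and> (\<forall>y\<in>M \<inter> U. g y = f y)"
    by (elim exE)
  then have U: "open U" "x \<in> U" "\<And>k. Ck_on k U g" "\<And>y. y \<in> M \<inter> U \<Longrightarrow> g y = f y" by simp_all
  from U(3)[of "Suc 0"] have der: "(g has_derivative frechet_derivative g (at y)) (at y)" if "y \<in> U" for y
    using that by (simp add: frechet_derivative_works)
  moreover from U(3)[of "Suc 0"] have "continuous_on U (\<lambda>y. frechet_derivative g (at y) v)" for v by simp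
  ultimately obtain g' where g': "\<And>y. y \<in> U \<Longrightarrow> blinfun_apply (g' y) = frechet_derivative g (at y)" "continuous_on U g'"
    using blinfun_derivative[of U g "\<lambda>y. frechet_derivative g (at y)"] by blast
  show "\<exists>U g g'. open U \<and> x \<in> U \<and> (\<forall>y\<in>U. (g has_derivative blinfun_apply (g' y)) (at y)) \<and>
      continuous_on U g' \<and> (\<forall>y\<in>M \<inter> U. g y = f y)"
  proof (intro exI conjI ballI)
    show "(g has_derivative blinfun_apply (g' y)) (at y)" if "y \<in> U" for y
      unfolding g'(1)[OF that] by (rule der[OF that])
  qed (use U g'(2) in auto)
qed

lemma locally_C1_compose:
  assumes f: "locally_C1 M f" and h: "locally_C1 N h" and "f ` M \<subseteq> N"
  shows "locally_C1 M (\<lambda>x. h (f x))"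
  unfolding locally_C1_def
proof
  fix x assume "x \<in> M"
  obtain U g g' where U: "open U" "x \<in> U" "\<And>y. y \<in> U \<Longrightarrow> (g has_derivative blinfun_apply (g' y)) (at y)"
    "continuous_on U g'" "\<And>y. y \<in> M \<Longrightarrow> y \<in> U \<Longrightarrow> g y = f y"
    by (rule locally_C1E[OF f \<open>x \<in> M\<close>]) blast
  have "f x \<in> N" using \<open>x \<in> M\<close> assms(3) by blast
  obtain V k k' where V: "open V" "f x \<in> V" "\<And>y. y \<in> V \<Longrightarrow> (k has_derivative blinfun_apply (k' y)) (at y)"
    "continuous_on V k'" "\<And>y. y \<in> N \<Longrightarrow> y \<in> V \<Longrightarrow> k y = h y"
    by (rule locally_C1E[OF h \<open>f x \<in> N\<close>]) blast
  have contg: "continuous_on U g"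
    by (rule has_derivative_continuous_on, rule has_derivative_at_withinI[OF U(3)])
  let ?W = "U \<inter> g -` V"
  show "\<exists>U g g'. open U \<and> x \<in> U \<and> (\<forall>y\<in>U. (g has_derivative blinfun_apply (g' y)) (at y)) \<and>
      continuous_on U g' \<and> (\<forall>y\<in>M \<inter> U. g y = h (f y))"
  proof (intro exI[of _ ?W] exI[of _ "\<lambda>y. k (g y)"] exI[of _ "\<lambda>y. k' (g y) o\<^sub>L g' y"] conjI ballI)
    show "open ?W" by (rule continuous_open_preimage[OF contg U(1) V(1)])
    show "x \<in> ?W" using U(2) V(2) U(5)[of x] \<open>x \<in> M\<close> by simp
    show "((\<lambda>y. k (g y)) has_derivative blinfun_apply (k' (g y) o\<^sub>L g' y)) (at y)" if "y \<in> ?W" for y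
      using has_derivative_compose[OF U(3) V(3), of y] that by (simp add: blinfun_apply_blinfun_compose[abs_def])
    have "continuous_on ?W (\<lambda>y. k' (g y))"
      by (rule continuous_on_compose2[OF V(4) continuous_on_subset[OF contg]]) auto
    then show "continuous_on ?W (\<lambda>y. k' (g y) o\<^sub>L g' y)"
      by (intro continuous_intros continuous_on_subset[OF U(4)]) auto
    show "k (g y) = h (f y)" if "y \<in> M \<inter> ?W" for y
      using that U(5)[of y] V(5)[of "f y"] assms(3) by auto
  qed
qed

text \<open>On an open set each local extension is \<open>f\<close> itself near the point, so by
  uniqueness the local derivatives agree and glue.\<close>

lemma locally_C1_open:
  assumes "open M" "locally_C1 M f"
  obtains f' where "\<And>y. y \<in> M \<Longrightarrow> (f has_derivative blinfun_apply (f' y)) (at y)" "continuous_on M f'"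
proof -
  define f' where "f' y = Blinfun (frechet_derivative f (at y))" for y
  have loc: "\<exists>U g'. open U \<and> x \<in> U \<and> U \<subseteq> M \<and> continuous_on U g' \<and>
      (\<forall>y\<in>U. (f has_derivative blinfun_apply (f' y)) (at y) \<and> f' y = g' y)" if "x \<in> M" for x
  proof -
    obtain U g g' where U: "open U" "x \<in> U" "\<And>y. y \<in> U \<Longrightarrow> (g has_derivative blinfun_apply (g' y)) (at y)"
      "continuous_on U g'" "\<And>y. y \<in> M \<Longrightarrow> y \<in> U \<Longrightarrow> g y = f y"
      by (rule locally_C1E[OF assms(2) \<open>x \<in> M\<close>]) blast
    have "(f has_derivative blinfun_apply (g' y)) (at y)" if "y \<in> M \<inter> U" for y
      by (rule has_derivative_transform_within_open[OF U(3), of y "M \<inter> U"])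
        (use that assms(1) U in auto)
    moreover from this have "f' y = g' y" if "y \<in> M \<inter> U" for y
      using frechet_derivative_at[of f "blinfun_apply (g' y)" y, symmetric] that
      by (simp add: f'_def blinfun_apply_inverse)
    ultimately show ?thesis
      using assms(1) U that continuous_on_subset[OF U(4), of "M \<inter> U"]
      by (intro exI[of _ "M \<inter> U"] exI[of _ g']) auto
  qed
  show thesis
  proof (rule that[of f'])
    show "(f has_derivative blinfun_apply (f' y)) (at y)" if "y \<in> M" for y
      using loc[OF that] by blast
    show "continuous_on M f'"
    proof (rule continuous_at_imp_continuous_on, rule ballI)
      fix x assume "x \<in> M"
      then obtain U g' where U: "open U" "x \<in> U" "continuous_on U g'" "\<And>y. y \<in> U \<Longrightarrow> f' y = g' y"
        using loc[OF \<open>x \<in> M\<close>] by blast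
      have "continuous_on U f'" by (rule continuous_on_eq[OF U(3)]) (simp add: U(4))
      then show "isCont f' x" using continuous_on_eq_continuous_at[OF U(1)] U(2) by blast
    qed
  qed
qed

lemma locally_C1_has_derivative_within:
  assumes "locally_C1 M f" "x \<in> M"
  obtains D where "(f has_derivative D) (at x within M)"
proof -
  obtain U g g' where U: "open U" "x \<in> U" "\<And>y. y \<in> U \<Longrightarrow> (g has_derivative blinfun_apply (g' y)) (at y)"
    "\<And>y. y \<in> M \<Longrightarrow> y \<in> U \<Longrightarrow> g y = f y"
    by (rule locally_C1E[OF assms]) blast
  obtain d where d: "d > 0" "ball x d \<subseteq> U" using U(1,2) open_contains_ball by blast
  have "(f has_derivative blinfun_apply (g' x)) (at x within M)"
    by (rule has_derivative_transform_within[OF has_derivative_at_withinI[OF U(3)[OF U(2)]] d(1) assms(2)])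
      (use U(4) d(2) in \<open>auto simp: dist_commute subset_eq\<close>)
  then show thesis by (rule that)
qed

section \<open>Positions and momenta as coordinates on the contact manifold\<close>

lemma has_derivative_vec_lambda [derivative_intros]:
  fixes f :: "'i::finite \<Rightarrow> 'a::real_normed_vector \<Rightarrow> 'b::euclidean_space"
  assumes "\<And>i. (f i has_derivative f' i) (at x within S)"
  shows "((\<lambda>x. \<chi> i. f i x) has_derivative (\<lambda>h. \<chi> i. f' i h)) (at x within S)"
  unfolding has_derivative_componentwise_within[of "\<lambda>x. \<chi> i. f i x"]
  using assms by (auto simp: Basis_vec_def inner_axis intro!: has_derivative_inner_left)

lemma frechet_derivative_eq: "(f has_derivative f') (at x) \<Longrightarrow> frechet_derivative f (at x) = f'"
  using frechet_derivative_at by metis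

text \<open>Differentiation permutes these sums with new coefficients, so the induction runs over
  all \<open>A\<close> and \<open>B\<close>. They provide curves whose smoothness to every order can
  be checked.\<close>

lemma Ck_on_trigonometric:
  fixes A B :: "'j \<Rightarrow> 'b::euclidean_space" and c :: "'j \<Rightarrow> real"
  shows "Ck_on k U (\<lambda>t. \<Sum>j\<in>J. cos (c j * t) *\<^sub>R A j + sin (c j * t) *\<^sub>R B j)"
proof (induction k arbitrary: A B)
  case 0
  show ?case by (auto intro!: continuous_intros)
next
  case (Suc k)
  let ?f = "\<lambda>t. \<Sum>j\<in>J. cos (c j * t) *\<^sub>R A j + sin (c j * t) *\<^sub>R B j"
  have der: "(?f has_derivative (\<lambda>v. \<Sum>j\<in>J. cos (c j * t) *\<^sub>R ((v * c j) *\<^sub>R B j) + sin (c j * t) *\<^sub>R ((- v * c j) *\<^sub>R A j))) (at t)" for t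
    by (auto intro!: derivative_eq_intros sum.cong simp: algebra_simps)
  show ?case
    using Suc.IH[of "\<lambda>j. (_ * c j) *\<^sub>R B j" "\<lambda>j. (- _ * c j) *\<^sub>R A j"] der
    by (auto simp: frechet_derivative_eq[OF der] intro: differentiableI)
qed

text \<open>The universal covering in the first factor and the radial projection in the second.
  Composition with it produces functions that are periodic in q and homogeneous of degree 0 in
  p.\<close>

definition torus_param :: "(real ^ 'n) \<times> (real ^ 'n) \<Rightarrow> (complex ^ 'n) \<times> (real ^ 'n)" where
  "torus_param z = ((\<chi> i. cis (2 * pi * fst z $ i)), sgn (snd z))"

lemma torus_param_mem: "snd z \<noteq> 0 \<Longrightarrow> torus_param z \<in> torus_sphere"
  by (auto simp: torus_param_def torus_sphere_def torus_def norm_sgn)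

definition torus_param_deriv :: "(real ^ 'n) \<times> (real ^ 'n) \<Rightarrow> (real ^ 'n) \<times> (real ^ 'n) \<Rightarrow> (complex ^ 'n) \<times> (real ^ 'n)" where
  "torus_param_deriv z h = ((\<chi> i. (2 * pi * fst h $ i) *\<^sub>R (\<i> * cis (2 * pi * fst z $ i))),
    (snd h - (sgn (snd z) \<bullet> snd h) *\<^sub>R sgn (snd z)) /\<^sub>R norm (snd z))"

lemma has_derivative_cis: "(cis has_derivative (\<lambda>h. h *\<^sub>R (\<i> * cis x))) (at x within S)"
proof -
  have "((\<lambda>x. Complex (cos x) (sin x)) has_derivative (\<lambda>h. h *\<^sub>R (\<i> * cis x))) (at x within S)"
    unfolding Complex_eq
    by (auto intro!: derivative_eq_intros simp: complex_eq_iff)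
  then show ?thesis by (simp add: cis_conv_exp complex_eq_iff cis.ctr[abs_def])
qed

lemma torus_param_has_derivative:
  assumes "snd z \<noteq> 0"
  shows "(torus_param has_derivative torus_param_deriv z) (at z)"
proof -
  have 1: "((\<lambda>z. cis (2 * pi * fst z $ i)) has_derivative
      (\<lambda>h. (2 * pi * fst h $ i) *\<^sub>R (\<i> * cis (2 * pi * fst z $ i)))) (at z)" for i
    by (rule has_derivative_compose[OF _ has_derivative_cis, of "\<lambda>z. 2 * pi * fst z $ i"])
      (auto intro!: derivative_eq_intros bounded_linear.has_derivative[OF bounded_linear_vec_nth])
  have 2: "((\<lambda>z. sgn (snd z)) has_derivative (\<lambda>h. (snd h - (sgn (snd z) \<bullet> snd h) *\<^sub>R sgn (snd z)) /\<^sub>R norm (snd z))) (at z)"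
    unfolding sgn_div_norm using assms
    by (auto intro!: derivative_eq_intros has_derivative_compose[OF _ has_derivative_norm]
        simp: sgn_div_norm algebra_simps divide_inverse power2_eq_square inner_commute)
  show ?thesis
    unfolding torus_param_def[abs_def] torus_param_deriv_def
    by (intro has_derivative_Pair has_derivative_vec_lambda 1 2)
qed

text \<open>The curve moves the angles at constant speed and the sphere component along a great
  circle. Unlike the image of a straight line in p, it is a trigonometric sum.\<close>

lemma torus_param_deriv_tangent:
  assumes "snd z \<noteq> 0"
  shows "torus_param_deriv z h \<in> tangent_space torus_sphere (torus_param z)"
proof -
  define e where "e = sgn (snd z)"
  have e: "e \<bullet> e = 1" using assms by (simp add: e_def dot_square_norm norm_sgn)
  define \<nu> where "\<nu> = (snd h - (e \<bullet> snd h) *\<^sub>R e) /\<^sub>R norm (snd z)"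
  have \<nu>: "e \<bullet> \<nu> = 0" by (simp add: \<nu>_def inner_diff_right e)
  \<comment> \<open>\<open>Some i\<close> stands for the i-th circle and \<open>None\<close> for the
    sphere. If \<nu> = 0, then the frequency and \<open>sgn \<nu>\<close> are both 0 and the sphere
    component rests at \<open>e\<close>.\<close>
  define c where "c j = (case j of None \<Rightarrow> norm \<nu> | Some i \<Rightarrow> 2 * pi * fst h $ i)" for j
  define A where "A j = (case j of None \<Rightarrow> (0, e) | Some i \<Rightarrow> (axis i (cis (2 * pi * fst z $ i)), 0))" for j
  define B where "B j = (case j of None \<Rightarrow> (0, sgn \<nu>) | Some i \<Rightarrow> (axis i (\<i> * cis (2 * pi * fst z $ i)), 0))" for j
  define \<gamma> where "\<gamma> t = (\<Sum>j\<in>UNIV. cos (c j * t) *\<^sub>R A j + sin (c j * t) *\<^sub>R B j)" for t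
  have sum_axis: "(\<Sum>i\<in>UNIV. axis i (f i)) = (\<chi> i. f i)" for f :: "'a \<Rightarrow> complex"
    by (simp add: vec_eq_iff axis_def)
  have sum: "(\<Sum>j\<in>UNIV. f j) = f None + (\<Sum>i\<in>UNIV. f (Some i))" for f :: "'a option \<Rightarrow> (complex ^ 'a) \<times> (real ^ 'a)"
    by (simp add: UNIV_option_conv sum.reindex)
  have axis: "r *\<^sub>R axis i a = axis i (r *\<^sub>R a)" "axis i a + axis i b = axis i (a + b)" for r i and a b :: complex
    by (auto simp: axis_def vec_eq_iff)
  have \<gamma>: "\<gamma> t = ((\<chi> i. cis (2 * pi * (fst z $ i + t * fst h $ i))), cos (norm \<nu> * t) *\<^sub>R e + sin (norm \<nu> * t) *\<^sub>R sgn \<nu>)" for t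
  proof -
    have "cos (2 * pi * fst h $ i * t) *\<^sub>R cis (2 * pi * fst z $ i) + sin (2 * pi * fst h $ i * t) *\<^sub>R (\<i> * cis (2 * pi * fst z $ i)) =
      cis (2 * pi * (fst z $ i + t * fst h $ i))" for i
    proof -
      have "2 * pi * (fst z $ i + t * fst h $ i) = 2 * pi * fst h $ i * t + 2 * pi * fst z $ i"
        by (simp add: algebra_simps)
      then show ?thesis by (simp add: complex_eq_iff cos_add sin_add)
    qed
    then show ?thesis
      by (simp add: \<gamma>_def sum c_def A_def B_def axis fst_sum snd_sum prod_eq_iff sum_axis)
  qed
  have "((\<lambda>t. \<gamma> t) has_derivative (\<lambda>v. v *\<^sub>R (\<Sum>j\<in>UNIV. c j *\<^sub>R B j))) (at 0)"
    unfolding \<gamma>_def by (auto intro!: derivative_eq_intros simp: scaleR_sum_right intro!: sum.cong)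
  moreover have "(\<Sum>j\<in>UNIV. c j *\<^sub>R B j) = torus_param_deriv z h"
  proof -
    have "norm \<nu> *\<^sub>R sgn \<nu> = \<nu>" by (cases "\<nu> = 0") (simp_all add: sgn_div_norm)
    moreover have "torus_param_deriv z h = ((\<chi> i. (2 * pi * fst h $ i) *\<^sub>R (\<i> * cis (2 * pi * fst z $ i))), \<nu>)"
      by (simp add: torus_param_deriv_def \<nu>_def e_def)
    ultimately show ?thesis
      by (simp add: sum c_def B_def axis fst_sum snd_sum prod_eq_iff sum_axis)
  qed
  ultimately have "(\<gamma> has_vector_derivative torus_param_deriv z h) (at 0)"
    by (simp add: has_vector_derivative_def)
  moreover have "\<gamma> 0 = torus_param z" by (simp add: \<gamma> torus_param_def e_def)
  moreover have "\<gamma> t \<in> torus_sphere" for t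
  proof -
    have "norm (cos (norm \<nu> * t) *\<^sub>R e + sin (norm \<nu> * t) *\<^sub>R sgn \<nu>) = 1"
    proof (cases "\<nu> = 0")
      case True
      then show ?thesis using e by (simp add: norm_eq_1)
    next
      case False
      have "e \<bullet> sgn \<nu> = 0" "sgn \<nu> \<bullet> sgn \<nu> = 1" using \<nu> False by (auto simp: sgn_div_norm dot_square_norm power2_eq_square)
      then show ?thesis
        unfolding norm_eq_1 using e sin_cos_squared_add[of "norm \<nu> * t"]
        by (simp add: inner_add_left inner_add_right inner_commute power2_eq_square)
    qed
    moreover have "(\<chi> i. cis (2 * pi * (fst z $ i + t * fst h $ i))) \<in> torus"
      unfolding torus_def by (rule CollectI, rule exI[of _ "fst z + t *\<^sub>R fst h"]) simp
    ultimately show ?thesis by (simp add: \<gamma> torus_sphere_def)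
  qed
  moreover have "smooth_on {-1<..<1} \<gamma>"
    unfolding smooth_on_def
    by (intro ballI exI[of _ UNIV] exI[of _ \<gamma>]) (auto simp: \<gamma>_def[abs_def] intro: Ck_on_trigonometric)
  ultimately show ?thesis
    unfolding tangent_space_def by (intro CollectI exI[of _ \<gamma>] exI[of _ 1]) auto
qed

text \<open>The factors 2 pi cancel, and for p \<noteq> 0 the contact form pulls back to p \<bullet>
  dq / |p|. This ties the contact manifold to the homogeneous lift.\<close>

lemma contact_form_torus_param_deriv:
  "contact_form (torus_param z) (torus_param_deriv z h) = sgn (snd z) \<bullet> fst h"
  by (simp add: contact_form_def torus_param_def torus_param_deriv_def inner_vec_def scaleR_conv_of_real)

lemma torus_param_deriv_horizontal:
  assumes "snd z \<noteq> 0" "snd z \<bullet> fst h = 0"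
  shows "torus_param_deriv z h \<in> standard_contact_structure (torus_param z)"
  using assms torus_param_deriv_tangent[OF assms(1), of h]
  by (simp add: standard_contact_structure_def contact_form_torus_param_deriv sgn_div_norm)

section \<open>Lifting C1-small contact maps\<close>

text \<open>C1-smallness is expressed by a Lipschitz constant of \<psi> - id in the ambient space,
  which avoids norms of derivatives along the submanifold.\<close>

definition small_contact_map :: "real \<Rightarrow> ((complex ^ 'n) \<times> (real ^ 'n) \<Rightarrow> (complex ^ 'n) \<times> (real ^ 'n)) \<Rightarrow> bool" where
  "small_contact_map \<epsilon> \<psi> \<longleftrightarrow> \<psi> ` torus_sphere \<subseteq> torus_sphere \<and> locally_C1 torus_sphere \<psi> \<and>
    (\<forall>y\<in>torus_sphere. norm (\<psi> y - y) \<le> \<epsilon>) \<and>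
    (\<forall>y\<in>torus_sphere. \<forall>y'\<in>torus_sphere. norm ((\<psi> y - y) - (\<psi> y' - y')) \<le> \<epsilon> * norm (y - y')) \<and>
    (\<forall>y\<in>torus_sphere. \<exists>D. (\<psi> has_derivative D) (at y within torus_sphere) \<and>
      D ` standard_contact_structure y \<subseteq> standard_contact_structure (\<psi> y))"

lemma norm_fst_le_norm: "norm (fst x) \<le> norm x"
  using norm_fst_le[of "fst x" "snd x"] by (simp only: prod.collapse)

lemma norm_snd_le_norm: "norm (snd x) \<le> norm x"
  using norm_snd_le[of "snd x" "fst x"] by (simp only: prod.collapse)

lemma norm_cis_diff_le: "norm (cis a - cis b) \<le> \<bar>a - b\<bar>"
proof -
  have "norm (cis a - cis b) \<le> 1 * norm (a - b)"
  proof (rule differentiable_bound[of UNIV cis "\<lambda>x h. h *\<^sub>R (\<i> * cis x)"])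
    show "(cis has_derivative (\<lambda>h. h *\<^sub>R (\<i> * cis x))) (at x within UNIV)" for x
      by (rule has_derivative_cis)
    show "onorm (\<lambda>h::real. h *\<^sub>R (\<i> * cis x)) \<le> 1" for x
      by (rule onorm_bound) (auto simp: norm_mult)
  qed auto
  then show ?thesis by simp
qed

lemma torus_param_lipschitz:
  fixes q q' p :: "real ^ 'n"
  shows "norm (torus_param (q, p) - torus_param (q', p)) \<le> 2 * pi * CARD('n) * norm (q - q')"
proof -
  have "torus_param (q, p) - torus_param (q', p) = ((\<chi> i. cis (2 * pi * q $ i) - cis (2 * pi * q' $ i)), 0)"
    by (simp add: torus_param_def vec_eq_iff prod_eq_iff)
  then have "norm (torus_param (q, p) - torus_param (q', p)) =
      norm (\<chi> i. cis (2 * pi * q $ i) - cis (2 * pi * q' $ i))"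
    by (simp add: norm_Pair)
  also have "\<dots> \<le> (\<Sum>i\<in>UNIV. norm (cis (2 * pi * q $ i) - cis (2 * pi * q' $ i)))"
    using L2_set_le_sum[of UNIV "\<lambda>i. norm (cis (2 * pi * q $ i) - cis (2 * pi * q' $ i))"]
    by (simp add: norm_vec_def)
  also have "\<dots> \<le> (\<Sum>i\<in>(UNIV :: 'n set). 2 * pi * norm (q - q'))"
  proof (rule sum_mono)
    fix i :: 'n
    have "norm (cis (2 * pi * q $ i) - cis (2 * pi * q' $ i)) \<le> \<bar>2 * pi * q $ i - 2 * pi * q' $ i\<bar>"
      by (rule norm_cis_diff_le)
    also have "\<dots> = 2 * pi * \<bar>(q - q') $ i\<bar>" by (simp add: abs_mult flip: right_diff_distrib)
    also have "\<dots> \<le> 2 * pi * norm (q - q')" by (intro mult_left_mono component_le_norm_cart) auto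
    finally show "norm (cis (2 * pi * q $ i) - cis (2 * pi * q' $ i)) \<le> 2 * pi * norm (q - q')" .
  qed
  finally show ?thesis by (simp add: mult.commute mult.left_commute)
qed

text \<open>The disc avoids the branch cut and the derivative 1 / z is at most 2 in norm
  there.\<close>

lemma Ln_lipschitz_near_1:
  assumes "norm (w - 1) \<le> 1 / 2" "norm (w' - 1) \<le> 1 / 2"
  shows "norm (Ln w - Ln w') \<le> 2 * norm (w - w')"
proof (rule field_differentiable_bound[of "cball 1 (1 / 2)" Ln inverse])
  have Re: "Re z \<ge> 1 / 2" if "z \<in> cball 1 (1 / 2)" for z
    using that abs_Re_le_cmod[of "1 - z"] by (auto simp: dist_norm)
  show "(Ln has_field_derivative inverse z) (at z within cball 1 (1 / 2))" if "z \<in> cball 1 (1 / 2)" for z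
    using Re[OF that]
    by (intro has_field_derivative_at_within[OF has_field_derivative_Ln]) (auto simp: complex_nonpos_Reals_iff)
  show "norm (inverse z) \<le> 2" if "z \<in> cball 1 (1 / 2)" for z :: complex
  proof -
    have "1 / 2 \<le> norm z" using Re[OF that] complex_Re_le_cmod[of z] by linarith
    then have "inverse (norm z) \<le> inverse (1 / 2)" by (intro le_imp_inverse_le) auto
    then show ?thesis by (simp add: norm_inverse)
  qed
qed (use assms in \<open>auto simp: dist_norm norm_minus_commute\<close>)

lemma torus_iff: "z \<in> torus \<longleftrightarrow> (\<forall>i. norm (z $ i) = 1)"
proof
  assume "\<forall>i. norm (z $ i) = 1"
  then have "cis (Arg (z $ i)) = z $ i" for i using rcis_cmod_Arg[of "z $ i"] by (simp add: rcis_def)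
  then have "z = (\<chi> i. cis (2 * pi * (\<chi> i. Arg (z $ i) / (2 * pi)) $ i))" by (simp add: vec_eq_iff)
  then show "z \<in> torus" unfolding torus_def by blast
qed (auto simp: torus_def)

text \<open>Dividing each torus coordinate of the image by the original one gives a number
  \<open>w\<close> near 1, whose principal logarithm is a single-valued angular displacement. This
  replaces lifting of paths and makes the displacement \<open>u\<close> periodic at once.\<close>

lemma small_contact_map_generating_function:
  fixes \<psi> :: "(complex ^ 'n) \<times> (real ^ 'n) \<Rightarrow> (complex ^ 'n) \<times> (real ^ 'n)"
  assumes small: "small_contact_map (1 / (20 * (CARD('n) + 1)\<^sup>2)) \<psi>"
  obtains s g where "generating_function s g"
    "\<And>Q p. p \<noteq> 0 \<Longrightarrow> \<psi> (torus_param (Q + snd (g (Q, p)), p)) = torus_param (Q, p + fst (g (Q, p)))"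
proof -
  define N where "N = real CARD('n)"
  \<comment> \<open>Each component of \<open>u\<close> will be Lipschitz in q with constant 2
    \<epsilon> (N + 1), and the N components together with 2 \<epsilon> N (N + 1), which is at most
    1/10 for this \<epsilon>.\<close>
  define \<epsilon> where "\<epsilon> = 1 / (20 * (N + 1)\<^sup>2)"
  have "N \<ge> 1" by (simp add: N_def Suc_le_eq)
  have \<epsilon>: "\<epsilon> > 0" "\<epsilon> \<le> 1 / 20" "N * (2 * \<epsilon> * (N + 1)) \<le> 1 / 10"
  proof -
    have "1 \<le> (N + 1)\<^sup>2" using \<open>N \<ge> 1\<close> by (simp add: power2_eq_square algebra_simps)
    then show "\<epsilon> > 0" "\<epsilon> \<le> 1 / 20"
      using frac_le[of 1 1 20 "20 * (N + 1)\<^sup>2"] \<open>N \<ge> 1\<close> by (simp_all add: \<epsilon>_def)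
    have "2 * (1 / (20 * t\<^sup>2)) * t = 1 / (10 * t)" for t :: real by (simp add: power2_eq_square)
    then have "N * (2 * \<epsilon> * (N + 1)) = N / (10 * (N + 1))" by (simp add: \<epsilon>_def)
    also have "\<dots> \<le> 1 / 10" using \<open>N \<ge> 1\<close> by (simp add: field_simps)
    finally show "N * (2 * \<epsilon> * (N + 1)) \<le> 1 / 10" .
  qed
  have small': "small_contact_map \<epsilon> \<psi>" using small by (simp add: \<epsilon>_def N_def add.commute)
  have maps: "\<And>y. y \<in> torus_sphere \<Longrightarrow> \<psi> y \<in> torus_sphere"
    and C1: "locally_C1 torus_sphere \<psi>"
    and close: "\<And>y. y \<in> torus_sphere \<Longrightarrow> norm (\<psi> y - y) \<le> \<epsilon>"
    and lip: "\<And>y y'. y \<in> torus_sphere \<Longrightarrow> y' \<in> torus_sphere \<Longrightarrow>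
      norm ((\<psi> y - y) - (\<psi> y' - y')) \<le> \<epsilon> * norm (y - y')"
    and contact: "\<And>y. y \<in> torus_sphere \<Longrightarrow> \<exists>D. (\<psi> has_derivative D) (at y within torus_sphere) \<and>
      D ` standard_contact_structure y \<subseteq> standard_contact_structure (\<psi> y)"
    using small'[unfolded small_contact_map_def] by (simp_all add: image_subset_iff)
  define E where "E = {z :: (real ^ 'n) \<times> (real ^ 'n). snd z \<noteq> 0}"
  have open_E: "open E" unfolding E_def by (intro open_Collect_neq continuous_intros)
  have tp: "torus_param z \<in> torus_sphere" if "z \<in> E" for z using that by (simp add: E_def torus_param_mem)
  define \<Psi> where "\<Psi> z = \<psi> (torus_param z)" for z
  have \<Psi>: "norm (fst (\<Psi> z) $ i) = 1" "norm (snd (\<Psi> z)) = 1" if "z \<in> E" for z i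
    using maps[OF tp[OF that]] by (auto simp: \<Psi>_def torus_sphere_def torus_iff mem_Times_iff)
  have contsgn: "continuous_on E (\<lambda>z. sgn (snd z))"
    unfolding sgn_div_norm by (intro continuous_intros) (auto simp: E_def)
  have "locally_C1 E torus_param"
  proof (rule locally_C1I[OF open_E torus_param_has_derivative])
    show "continuous_on E (\<lambda>z. torus_param_deriv z h)" for h
      unfolding torus_param_deriv_def cis_conv_exp
      by (intro continuous_intros contsgn) (auto simp: E_def)
  qed (simp add: E_def)
  then have "locally_C1 E \<Psi>"
    unfolding \<Psi>_def by (rule locally_C1_compose[OF _ C1]) (use tp in auto)
  then obtain \<Psi>' where \<Psi>': "\<And>z. z \<in> E \<Longrightarrow> (\<Psi> has_derivative blinfun_apply (\<Psi>' z)) (at z)" "continuous_on E \<Psi>'"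
    by (rule locally_C1_open[OF open_E]) blast
  have cont\<Psi>: "continuous_on E \<Psi>"
    by (rule has_derivative_continuous_on, rule has_derivative_at_withinI[OF \<Psi>'(1)])
  define w where "w i z = fst (\<Psi> z) $ i * cis (- (2 * pi * fst z $ i))" for i z
  have diff_le: "norm (fst (\<Psi> z) $ i - cis (2 * pi * fst z $ i)) \<le> \<epsilon>" if "z \<in> E" for z i
  proof -
    have "norm (fst (\<Psi> z) $ i - cis (2 * pi * fst z $ i)) = norm (fst (\<Psi> z - torus_param z) $ i)"
      by (simp add: torus_param_def)
    also have "\<dots> \<le> norm (fst (\<Psi> z - torus_param z))" by (rule Finite_Cartesian_Product.norm_nth_le)
    also have "\<dots> \<le> norm (\<Psi> z - torus_param z)"
      by (rule norm_fst_le_norm)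
    also have "\<dots> \<le> \<epsilon>" unfolding \<Psi>_def by (rule close[OF tp[OF that]])
    finally show ?thesis .
  qed
  have w_1: "w i z - 1 = (fst (\<Psi> z) $ i - cis (2 * pi * fst z $ i)) * cis (- (2 * pi * fst z $ i))" for i z
    by (simp add: w_def left_diff_distrib cis_mult)
  have w_near: "norm (w i z - 1) \<le> \<epsilon>" if "z \<in> E" for z i
    unfolding w_1 norm_mult using diff_le[OF that] by simp
  have w_slit: "w i z \<notin> \<real>\<^sub>\<le>\<^sub>0" "w i z \<noteq> 0" if "z \<in> E" for z i
  proof -
    have "Re (w i z) \<ge> 1 / 2"
      using w_near[OF that, of i] abs_Re_le_cmod[of "w i z - 1"] \<epsilon>(2) by (auto simp: abs_le_iff)
    then show "w i z \<notin> \<real>\<^sub>\<le>\<^sub>0" "w i z \<noteq> 0" by (auto simp: complex_nonpos_Reals_iff)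
  qed
  define u :: "(real ^ 'n) \<times> (real ^ 'n) \<Rightarrow> real ^ 'n" where "u z = (\<chi> i. Im (Ln (w i z)) / (2 * pi))" for z
  \<comment> \<open>Adding \<open>fst h\<close> back leaves the angular velocity Im (dz_i / z_i) /
    (2 pi) of \<Psi>, the very expression inside \<open>contact_form\<close>.\<close>
  define D :: "(real ^ 'n) \<times> (real ^ 'n) \<Rightarrow> (real ^ 'n) \<times> (real ^ 'n) \<Rightarrow> real ^ 'n" where
    "D z h = (\<chi> i. Im (fst (\<Psi>' z h) $ i / fst (\<Psi> z) $ i) / (2 * pi) - fst h $ i)" for z h
  have Du: "(u has_derivative D z) (at z)" if z: "z \<in> E" for z
    unfolding u_def D_def
  proof (rule has_derivative_vec_lambda)
    fix i
    have "((\<lambda>z. cis (- (2 * pi * fst z $ i))) has_derivative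
      (\<lambda>h. (- (2 * pi * fst h $ i)) *\<^sub>R (\<i> * cis (- (2 * pi * fst z $ i))))) (at z)"
      by (rule has_derivative_compose[OF _ has_derivative_cis, of "\<lambda>z. - (2 * pi * fst z $ i)"])
        (auto intro!: derivative_eq_intros bounded_linear.has_derivative[OF bounded_linear_vec_nth])
    moreover have "((\<lambda>z. fst (\<Psi> z) $ i) has_derivative (\<lambda>h. fst (\<Psi>' z h) $ i)) (at z)"
      by (intro bounded_linear.has_derivative[OF bounded_linear_vec_nth] has_derivative_fst \<Psi>'(1)[OF z])
    ultimately have "(w i has_derivative (\<lambda>h. fst (\<Psi> z) $ i * ((- (2 * pi * fst h $ i)) *\<^sub>R (\<i> * cis (- (2 * pi * fst z $ i))))
       + fst (\<Psi>' z h) $ i * cis (- (2 * pi * fst z $ i)))) (at z)"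
      unfolding w_def by (rule has_derivative_mult[rotated])
    then have "((\<lambda>z. Ln (w i z)) has_derivative (\<lambda>h. inverse (w i z) * (fst (\<Psi> z) $ i * ((- (2 * pi * fst h $ i)) *\<^sub>R (\<i> * cis (- (2 * pi * fst z $ i))))
       + fst (\<Psi>' z h) $ i * cis (- (2 * pi * fst z $ i))))) (at z)"
      by (rule has_derivative_compose)
        (rule has_field_derivative_Ln[OF w_slit(1)[OF z], unfolded has_field_derivative_def])
    moreover have "inverse (w i z) * (fst (\<Psi> z) $ i * ((- (2 * pi * fst h $ i)) *\<^sub>R (\<i> * cis (- (2 * pi * fst z $ i))))
       + fst (\<Psi>' z h) $ i * cis (- (2 * pi * fst z $ i))) = fst (\<Psi>' z h) $ i / fst (\<Psi> z) $ i - \<i> * of_real (2 * pi * fst h $ i)" for h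
    proof -
      have "fst (\<Psi> z) $ i \<noteq> 0" using \<Psi>(1)[OF z, of i] by auto
      moreover have "cis (- (2 * pi * fst z $ i)) \<noteq> 0" by simp
      ultimately show ?thesis unfolding w_def scaleR_conv_of_real by (simp add: divide_simps) (simp add: algebra_simps)
    qed
    ultimately have "((\<lambda>z. Ln (w i z)) has_derivative (\<lambda>h. fst (\<Psi>' z h) $ i / fst (\<Psi> z) $ i - \<i> * of_real (2 * pi * fst h $ i))) (at z)"
      by simp
    from bounded_linear.has_derivative[OF bounded_linear_divide bounded_linear.has_derivative[OF bounded_linear_Im this], of "2 * pi"]
    have "((\<lambda>z. Im (Ln (w i z)) / (2 * pi)) has_derivative
        (\<lambda>h. Im (fst (\<Psi>' z h) $ i / fst (\<Psi> z) $ i - \<i> * of_real (2 * pi * fst h $ i)) / (2 * pi))) (at z)"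
      by simp
    then show "((\<lambda>z. Im (Ln (w i z)) / (2 * pi)) has_derivative
        (\<lambda>h. Im (fst (\<Psi>' z h) $ i / fst (\<Psi> z) $ i) / (2 * pi) - fst h $ i)) (at z)"
      by (simp add: diff_divide_distrib)
  qed
  have "continuous_on E (\<lambda>z. D z h)" for h
  proof -
    have "fst (\<Psi> z) $ i \<noteq> 0" if "z \<in> E" for z i using \<Psi>(1)[OF that, of i] by auto
    then show ?thesis unfolding D_def by (intro continuous_intros \<Psi>'(2) cont\<Psi>) auto
  qed
  then obtain Du' where Du': "\<And>z. z \<in> E \<Longrightarrow> blinfun_apply (Du' z) = D z" "continuous_on E Du'"
    using blinfun_derivative[of E u D, OF Du] by blast
  \<comment> \<open>\<open>w\<close> has norm 1, so its logarithm is purely imaginary and taking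
    \<open>Im\<close> loses nothing.\<close>
  have cis_u: "cis (2 * pi * (fst z + u z) $ i) = fst (\<Psi> z) $ i" if "z \<in> E" for z i
  proof -
    have "norm (w i z) = 1" using \<Psi>(1)[OF that] by (simp add: w_def norm_mult)
    then have "Re (Ln (w i z)) = 0" using w_slit(2)[OF that, of i] by simp
    then have "Ln (w i z) = \<i> * of_real (Im (Ln (w i z)))" by (simp add: complex_eq_iff)
    then have "cis (Im (Ln (w i z))) = w i z"
      using exp_Ln[OF w_slit(2)[OF that, of i]] by (simp add: cis_conv_exp)
    moreover have "2 * pi * (fst z + u z) $ i = 2 * pi * fst z $ i + Im (Ln (w i z))"
      by (simp add: u_def algebra_simps)
    ultimately have "cis (2 * pi * (fst z + u z) $ i) = cis (2 * pi * fst z $ i) * w i z"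
      by (simp flip: cis_mult)
    also have "\<dots> = fst (\<Psi> z) $ i * (cis (2 * pi * fst z $ i) * cis (- (2 * pi * fst z $ i)))"
      by (simp add: w_def)
    finally show ?thesis by (simp add: cis_mult)
  qed
  have u_lip: "norm (u (q, p) - u (q', p)) \<le> 1 / 10 * norm (q - q')" if "p \<noteq> 0" for q q' p
  proof -
    have z: "(q, p) \<in> E" "(q', p) \<in> E" using that by (auto simp: E_def)
    have comp: "\<bar>(u (q, p) - u (q', p)) $ i\<bar> \<le> 2 * \<epsilon> * (N + 1) * norm (q - q')" for i
    proof -
      \<comment> \<open>The splitting w - 1 = d e keeps a factor \<epsilon> in both terms of the
        product rule, since \<open>d\<close> is small and also varies little; a direct estimate of
        \<open>w\<close> would lose it.\<close>
      define d where "d q = fst (\<Psi> (q, p)) $ i - cis (2 * pi * q $ i)" for q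
      define e where "e q = cis (- (2 * pi * q $ i))" for q :: "real ^ 'n"
      have "d q - d q' = fst ((\<Psi> (q, p) - torus_param (q, p)) - (\<Psi> (q', p) - torus_param (q', p))) $ i"
        by (simp add: d_def torus_param_def)
      also have "norm \<dots> \<le> norm ((\<Psi> (q, p) - torus_param (q, p)) - (\<Psi> (q', p) - torus_param (q', p)))"
        by (rule order_trans[OF Finite_Cartesian_Product.norm_nth_le norm_fst_le_norm])
      also have "\<dots> \<le> \<epsilon> * norm (torus_param (q, p) - torus_param (q', p))"
        unfolding \<Psi>_def by (rule lip[OF tp[OF z(1)] tp[OF z(2)]])
      also have "\<dots> \<le> \<epsilon> * (2 * pi * N * norm (q - q'))"
        unfolding N_def using \<epsilon>(1) by (intro mult_left_mono torus_param_lipschitz) auto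
      finally have d: "norm (d q - d q') \<le> \<epsilon> * (2 * pi * N * norm (q - q'))" .
      have "norm (e q - e q') \<le> \<bar>- (2 * pi * q $ i) - - (2 * pi * q' $ i)\<bar>"
        unfolding e_def by (rule norm_cis_diff_le)
      also have "- (2 * pi * q $ i) - - (2 * pi * q' $ i) = - (2 * pi * (q - q') $ i)"
        by (simp add: algebra_simps)
      also have "\<bar>\<dots>\<bar> \<le> 2 * pi * norm (q - q')"
        using component_le_norm_cart[of "q - q'" i] by (simp add: abs_mult)
      finally have e: "norm (e q - e q') \<le> 2 * pi * norm (q - q')" .
      have "w i (q, p) - 1 = d q * e q" "w i (q', p) - 1 = d q' * e q'"
        by (simp_all add: w_1 d_def e_def)
      then have "w i (q, p) - w i (q', p) = (d q - d q') * e q + d q' * (e q - e q')"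
        by (simp add: algebra_simps)
      also have "norm \<dots> \<le> norm (d q - d q') * norm (e q) + norm (d q') * norm (e q - e q')"
        by (rule order_trans[OF norm_triangle_ineq]) (simp add: norm_mult)
      also have "\<dots> \<le> \<epsilon> * (2 * pi * N * norm (q - q')) * 1 + \<epsilon> * (2 * pi * norm (q - q'))"
        using d e diff_le[OF z(2), of i] \<epsilon>(1)
        by (intro add_mono mult_mono) (auto simp: e_def d_def \<open>N \<ge> 1\<close> order_trans[OF zero_le_one])
      finally have w: "norm (w i (q, p) - w i (q', p)) \<le> 2 * pi * \<epsilon> * (N + 1) * norm (q - q')"
        by (simp add: algebra_simps)
      have "\<bar>Im (Ln (w i (q, p))) - Im (Ln (w i (q', p)))\<bar> \<le> norm (Ln (w i (q, p)) - Ln (w i (q', p)))"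
        using abs_Im_le_cmod[of "Ln (w i (q, p)) - Ln (w i (q', p))"] by simp
      also have "\<dots> \<le> 2 * norm (w i (q, p) - w i (q', p))"
        using w_near[OF z(1), of i] w_near[OF z(2), of i] \<epsilon>(2) by (intro Ln_lipschitz_near_1) auto
      also have "\<dots> \<le> 2 * (2 * pi * \<epsilon> * (N + 1) * norm (q - q'))" using w by simp
      finally have "\<bar>Im (Ln (w i (q, p))) - Im (Ln (w i (q', p)))\<bar> / (2 * pi) \<le> 2 * (2 * pi * \<epsilon> * (N + 1) * norm (q - q')) / (2 * pi)"
        by (intro divide_right_mono) auto
      then show ?thesis by (simp add: u_def diff_divide_distrib[symmetric] abs_divide)
    qed
    have "norm (u (q, p) - u (q', p)) \<le> (\<Sum>i\<in>UNIV. \<bar>(u (q, p) - u (q', p)) $ i\<bar>)"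
      by (rule norm_le_l1_cart)
    also have "\<dots> \<le> (\<Sum>i\<in>(UNIV :: 'n set). 2 * \<epsilon> * (N + 1) * norm (q - q'))"
      by (intro sum_mono comp)
    also have "\<dots> = N * (2 * \<epsilon> * (N + 1)) * norm (q - q')" by (simp add: N_def)
    also have "\<dots> \<le> 1 / 10 * norm (q - q')" by (intro mult_right_mono \<epsilon>(3)) auto
    finally show ?thesis .
  qed
  \<comment> \<open>The derivative of \<psi> is given only within the manifold. Composed with that
    of \<open>torus_param\<close>, which maps into the manifold, it becomes a derivative on the open
    set \<open>E\<close>, where it must agree with \<open>\<Psi>'\<close>.\<close>
  have horizontal: "snd (\<Psi> z) \<bullet> (fst h + Du' z h) = 0" if z: "z \<in> E" and h: "snd z \<bullet> fst h = 0" for z h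
  proof -
    obtain D\<psi> where D\<psi>: "(\<psi> has_derivative D\<psi>) (at (torus_param z) within torus_sphere)"
      "D\<psi> ` standard_contact_structure (torus_param z) \<subseteq> standard_contact_structure (\<Psi> z)"
      using contact[OF tp[OF z]] unfolding \<Psi>_def by (elim exE conjE)
    have tp_der: "(torus_param has_derivative torus_param_deriv z) (at z within E)"
      by (rule has_derivative_at_withinI, rule torus_param_has_derivative) (use z in \<open>simp add: E_def\<close>)
    have "(\<psi> has_derivative D\<psi>) (at (torus_param z) within torus_param ` E)"
      by (rule has_derivative_subset[OF D\<psi>(1)]) (use tp in auto)
    from has_derivative_in_compose[OF tp_der this]
    have "(\<Psi> has_derivative (\<lambda>h. D\<psi> (torus_param_deriv z h))) (at z)"
      unfolding \<Psi>_def[symmetric] by (simp add: at_within_open[OF z open_E])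
    from has_derivative_unique[OF this \<Psi>'(1)[OF z]]
    have "\<Psi>' z h = D\<psi> (torus_param_deriv z h)" by (rule fun_cong[symmetric])
    moreover have "torus_param_deriv z h \<in> standard_contact_structure (torus_param z)"
      by (rule torus_param_deriv_horizontal) (use z h in \<open>simp_all add: E_def\<close>)
    ultimately have "\<Psi>' z h \<in> standard_contact_structure (\<Psi> z)" using D\<psi>(2) by auto
    then have "contact_form (\<Psi> z) (\<Psi>' z h) = 0" by (simp add: standard_contact_structure_def)
    then have "(\<Sum>i\<in>UNIV. snd (\<Psi> z) $ i * (Im (fst (\<Psi>' z h) $ i / fst (\<Psi> z) $ i) / (2 * pi))) = 0"
      by (simp add: contact_form_def case_prod_unfold)
    then show ?thesis by (simp add: Du'(1)[OF z] D_def inner_vec_def)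
  qed
  have per: "u (q + k, p) = u (q, p)" if "k \<in> int_vecs" for q p k
  proof -
    have "cis (2 * pi * (q + k) $ i) = cis (2 * pi * q $ i)" for i
    proof -
      have "k $ i \<in> \<int>" using that by (simp add: int_vecs_def)
      then have "cis (2 * pi * k $ i) = 1" by (auto simp: cis_multiple_2pi elim!: Ints_cases)
      then show ?thesis by (simp add: distrib_left flip: cis_mult)
    qed
    then have "torus_param (q + k, p) = torus_param (q, p)"
      and "cis (- (2 * pi * (q + k) $ i)) = cis (- (2 * pi * q $ i))" for i
      by (simp_all add: torus_param_def flip: cis_cnj)
    then show ?thesis unfolding u_def w_def \<Psi>_def fst_conv by simp
  qed
  have cont_snd: "continuous_on E (\<lambda>z. snd (\<Psi> z))" by (intro continuous_intros cont\<Psi>)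
  have snd_close: "norm (snd (\<Psi> (q, p)) - sgn p) \<le> 1 / 10" if "p \<noteq> 0" for q p
  proof -
    have "snd (\<Psi> (q, p)) - sgn p = snd (\<Psi> (q, p) - torus_param (q, p))" by (simp add: torus_param_def)
    also have "norm \<dots> \<le> norm (\<Psi> (q, p) - torus_param (q, p))" by (rule norm_snd_le_norm)
    also have "\<dots> \<le> \<epsilon>" unfolding \<Psi>_def using that by (intro close tp) (simp add: E_def)
    finally show ?thesis using \<epsilon>(2) by simp
  qed
  show thesis
  proof (rule generating_function_of_lift[of u Du' "\<lambda>z. snd (\<Psi> z)"])
    fix s g
    assume gen: "generating_function s g"
      and Q: "\<And>Q p. p \<noteq> 0 \<Longrightarrow> Q + snd (g (Q, p)) + u (Q + snd (g (Q, p)), p) = Q"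
      and P: "\<And>Q p. p \<noteq> 0 \<Longrightarrow> sgn (p + fst (g (Q, p))) = snd (\<Psi> (Q + snd (g (Q, p)), p))"
    show thesis
    proof (rule that[OF gen])
      fix Q p :: "real ^ 'n" assume p: "p \<noteq> 0"
      let ?z = "(Q + snd (g (Q, p)), p)"
      have "fst (\<Psi> ?z) = (\<chi> i. cis (2 * pi * Q $ i))"
        using cis_u[of ?z] Q[OF p, of Q] p by (simp add: vec_eq_iff E_def)
      then show "\<psi> (torus_param ?z) = torus_param (Q, p + fst (g (Q, p)))"
        using P[OF p, of Q] by (simp add: torus_param_def[of "(Q, _)"] prod_eq_iff \<Psi>_def)
    qed
  qed (use Du Du' cont_snd \<Psi> u_lip horizontal per snd_close in \<open>auto simp: E_def\<close>)
qed

subsection \<open>Fragmentation of contact isotopies\<close>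

text \<open>M is not convex, so mean value estimates are only local. Pairs closer than a Lebesgue
  number e lie in one ball of a finite cover; for the others uniform smallness suffices, with
  \<epsilon> e / 2 for each point. A general filter covers both later uses, at infinity and at a
  time of the isotopy.\<close>

lemma eventually_lipschitz:
  fixes f :: "'t \<Rightarrow> 'a::euclidean_space \<Rightarrow> 'b::real_normed_vector"
  assumes M: "compact M" and "\<epsilon> > 0"
    and local: "\<And>y. y \<in> M \<Longrightarrow> \<exists>r>0. \<forall>\<^sub>F t in F. \<forall>y\<^sub>1\<in>M \<inter> ball y r. \<forall>y\<^sub>2\<in>M \<inter> ball y r.
      norm (f t y\<^sub>1 - f t y\<^sub>2) \<le> \<epsilon> * norm (y\<^sub>1 - y\<^sub>2)"
    and small: "\<And>e. e > 0 \<Longrightarrow> \<forall>\<^sub>F t in F. \<forall>y\<in>M. norm (f t y) \<le> e"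
  shows "\<forall>\<^sub>F t in F. \<forall>y\<^sub>1\<in>M. \<forall>y\<^sub>2\<in>M. norm (f t y\<^sub>1 - f t y\<^sub>2) \<le> \<epsilon> * norm (y\<^sub>1 - y\<^sub>2)"
proof -
  obtain r where r: "\<And>y. y \<in> M \<Longrightarrow> r y > 0" "\<And>y. y \<in> M \<Longrightarrow> \<forall>\<^sub>F t in F. \<forall>y\<^sub>1\<in>M \<inter> ball y (r y). \<forall>y\<^sub>2\<in>M \<inter> ball y (r y).
      norm (f t y\<^sub>1 - f t y\<^sub>2) \<le> \<epsilon> * norm (y\<^sub>1 - y\<^sub>2)"
  proof -
    have "\<forall>y\<in>M. \<exists>r. r > 0 \<and> (\<forall>\<^sub>F t in F. \<forall>y\<^sub>1\<in>M \<inter> ball y r. \<forall>y\<^sub>2\<in>M \<inter> ball y r.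
        norm (f t y\<^sub>1 - f t y\<^sub>2) \<le> \<epsilon> * norm (y\<^sub>1 - y\<^sub>2))"
      by (intro ballI local)
    from bchoice[OF this] obtain r where "\<forall>y\<in>M. r y > 0 \<and> (\<forall>\<^sub>F t in F. \<forall>y\<^sub>1\<in>M \<inter> ball y (r y). \<forall>y\<^sub>2\<in>M \<inter> ball y (r y).
        norm (f t y\<^sub>1 - f t y\<^sub>2) \<le> \<epsilon> * norm (y\<^sub>1 - y\<^sub>2))" ..
    then show thesis by (intro that[of r]) simp_all
  qed
  have cover: "M \<subseteq> (\<Union>c\<in>M. ball c (r c))" using r(1) by force
  obtain C where C: "C \<subseteq> M" "finite C" "M \<subseteq> (\<Union>c\<in>C. ball c (r c))"
    by (rule compactE_image[OF M open_ball cover])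
  obtain e where e: "e > 0" "\<And>y. y \<in> M \<Longrightarrow> \<exists>c\<in>C. ball y e \<subseteq> ball c (r c)"
    using Heine_Borel_lemma[OF M C(3)] by auto
  have "\<forall>\<^sub>F t in F. \<forall>c\<in>C. \<forall>y\<^sub>1\<in>M \<inter> ball c (r c). \<forall>y\<^sub>2\<in>M \<inter> ball c (r c).
      norm (f t y\<^sub>1 - f t y\<^sub>2) \<le> \<epsilon> * norm (y\<^sub>1 - y\<^sub>2)"
    using C r(2) by (intro eventually_ball_finite) auto
  moreover have "\<forall>\<^sub>F t in F. \<forall>y\<in>M. norm (f t y) \<le> \<epsilon> * e / 2"
    using \<open>\<epsilon> > 0\<close> e(1) by (intro small) simp
  ultimately show ?thesis
  proof eventually_elim
    case (elim t)
    show ?case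
    proof (intro ballI)
      fix y\<^sub>1 y\<^sub>2 assume y: "y\<^sub>1 \<in> M" "y\<^sub>2 \<in> M"
      show "norm (f t y\<^sub>1 - f t y\<^sub>2) \<le> \<epsilon> * norm (y\<^sub>1 - y\<^sub>2)"
      proof (cases "norm (y\<^sub>1 - y\<^sub>2) < e")
        case True
        obtain c where c: "c \<in> C" "ball y\<^sub>1 e \<subseteq> ball c (r c)" using e(2)[OF y(1)] by blast
        have "y\<^sub>1 \<in> ball c (r c)" "y\<^sub>2 \<in> ball c (r c)"
          using True e(1) c(2) by (auto simp: dist_norm subset_eq)
        then show ?thesis using elim(1) c(1) y by blast
      next
        case False
        have "norm (f t y\<^sub>1 - f t y\<^sub>2) \<le> \<epsilon> * e / 2 + \<epsilon> * e / 2"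
          using elim(2) y by (intro norm_triangle_le_diff add_mono) auto
        also have "\<dots> \<le> \<epsilon> * norm (y\<^sub>1 - y\<^sub>2)" using False \<open>\<epsilon> > 0\<close> by simp
        finally show ?thesis .
      qed
    qed
  qed
qed

lemma locally_C1_continuous_on:
  assumes "locally_C1 M f"
  shows "continuous_on M f"
  unfolding continuous_on_eq_continuous_within
proof
  fix x assume "x \<in> M"
  then obtain D where "(f has_derivative D) (at x within M)"
    by (rule locally_C1_has_derivative_within[OF assms])
  then show "continuous (at x within M) f" by (rule has_derivative_continuous)
qed

lemma blinfun_derivative_lipschitz:
  fixes g :: "'a::euclidean_space \<Rightarrow> 'b::euclidean_space"
  assumes "convex S" "\<And>x. x \<in> S \<Longrightarrow> (g has_derivative blinfun_apply (g' x)) (at x)"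
    and "\<And>x. x \<in> S \<Longrightarrow> norm (g' x) \<le> B" and "x \<in> S" "y \<in> S"
  shows "norm (g x - g y) \<le> B * norm (x - y)"
proof (rule differentiable_bound[OF assms(1) _ _ assms(4,5)])
  show "(g has_derivative blinfun_apply (g' x)) (at x within S)" if "x \<in> S" for x
    using assms(2)[OF that] by (rule has_derivative_at_withinI)
  show "onorm (blinfun_apply (g' x)) \<le> B" if "x \<in> S" for x
    using assms(3)[OF that] by (simp add: norm_blinfun.rep_eq)
qed

text \<open>As t tends to infinity, f / t becomes uniformly small, and locally 1-Lipschitz once t
  exceeds the local derivative bound. So it is eventually 1-Lipschitz on all of M, and a large t is
  a Lipschitz constant of f.\<close>

lemma locally_C1_compact_lipschitz:
  fixes f :: "'a::euclidean_space \<Rightarrow> 'b::euclidean_space"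
  assumes M: "compact M" and f: "locally_C1 M f"
  obtains L where "L \<ge> 1" "\<And>y y'. y \<in> M \<Longrightarrow> y' \<in> M \<Longrightarrow> norm (f y - f y') \<le> L * norm (y - y')"
proof -
  have "\<forall>\<^sub>F t in at_top. \<forall>y\<^sub>1\<in>M. \<forall>y\<^sub>2\<in>M. norm (f y\<^sub>1 /\<^sub>R t - f y\<^sub>2 /\<^sub>R t) \<le> 1 * norm (y\<^sub>1 - y\<^sub>2)"
  proof (rule eventually_lipschitz[OF M])
    fix y assume "y \<in> M"
    obtain U g g' where U: "open U" "y \<in> U" "\<And>y. y \<in> U \<Longrightarrow> (g has_derivative blinfun_apply (g' y)) (at y)"
      "continuous_on U g'" "\<And>y. y \<in> M \<Longrightarrow> y \<in> U \<Longrightarrow> g y = f y"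
      by (rule locally_C1E[OF f \<open>y \<in> M\<close>]) blast
    have "isCont g' y" using continuous_on_eq_continuous_at[OF U(1)] U(2,4) by blast
    then obtain r\<^sub>1 where r\<^sub>1: "r\<^sub>1 > 0" "\<And>x. dist x y < r\<^sub>1 \<Longrightarrow> dist (g' x) (g' y) < 1"
      unfolding continuous_at_eps_delta using zero_less_one by blast
    obtain r\<^sub>2 where r\<^sub>2: "r\<^sub>2 > 0" "ball y r\<^sub>2 \<subseteq> U" using U(1,2) open_contains_ball by blast
    define r where "r = min r\<^sub>1 r\<^sub>2"
    have lip: "norm (f y\<^sub>1 - f y\<^sub>2) \<le> (norm (g' y) + 1) * norm (y\<^sub>1 - y\<^sub>2)"
      if y: "y\<^sub>1 \<in> M" "y\<^sub>1 \<in> ball y r" "y\<^sub>2 \<in> M" "y\<^sub>2 \<in> ball y r" for y\<^sub>1 y\<^sub>2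
    proof -
      have sub: "x \<in> U" if "x \<in> ball y r" for x using that r\<^sub>2(2) by (auto simp: r_def)
      have "norm (g y\<^sub>1 - g y\<^sub>2) \<le> (norm (g' y) + 1) * norm (y\<^sub>1 - y\<^sub>2)"
      proof (rule blinfun_derivative_lipschitz[of "ball y r" g g'])
        show "norm (g' x) \<le> norm (g' y) + 1" if "x \<in> ball y r" for x
          using r\<^sub>1(2)[of x] that norm_triangle_sub[of "g' x" "g' y"] by (simp add: r_def dist_norm dist_commute norm_minus_commute)
      qed (use U(3) sub y in auto)
      then show ?thesis using U(5) sub y by simp
    qed
    show "\<exists>r>0. \<forall>\<^sub>F t in at_top. \<forall>y\<^sub>1\<in>M \<inter> ball y r. \<forall>y\<^sub>2\<in>M \<inter> ball y r.
      norm (f y\<^sub>1 /\<^sub>R t - f y\<^sub>2 /\<^sub>R t) \<le> 1 * norm (y\<^sub>1 - y\<^sub>2)"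
    proof (intro exI[of _ r] conjI)
      show "r > 0" using r\<^sub>1(1) r\<^sub>2(1) by (simp add: r_def)
      show "\<forall>\<^sub>F t in at_top. \<forall>y\<^sub>1\<in>M \<inter> ball y r. \<forall>y\<^sub>2\<in>M \<inter> ball y r.
          norm (f y\<^sub>1 /\<^sub>R t - f y\<^sub>2 /\<^sub>R t) \<le> 1 * norm (y\<^sub>1 - y\<^sub>2)"
        using eventually_ge_at_top[of "norm (g' y) + 1"]
      proof eventually_elim
        case (elim t)
        then have "t > 0" using norm_ge_zero[of "g' y"] by linarith
        show ?case
        proof (intro ballI)
          fix y\<^sub>1 y\<^sub>2 assume "y\<^sub>1 \<in> M \<inter> ball y r" "y\<^sub>2 \<in> M \<inter> ball y r"
          then have "norm (f y\<^sub>1 - f y\<^sub>2) \<le> t * norm (y\<^sub>1 - y\<^sub>2)"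
            using lip[of y\<^sub>1 y\<^sub>2] mult_right_mono[OF elim norm_ge_zero[of "y\<^sub>1 - y\<^sub>2"]] by auto
          then have "norm (f y\<^sub>1 - f y\<^sub>2) / t \<le> norm (y\<^sub>1 - y\<^sub>2)"
            using \<open>t > 0\<close> by (simp add: pos_divide_le_eq mult.commute)
          then have "norm ((f y\<^sub>1 - f y\<^sub>2) /\<^sub>R t) \<le> norm (y\<^sub>1 - y\<^sub>2)"
            using \<open>t > 0\<close> by (simp add: divide_inverse mult.commute)
          then show "norm (f y\<^sub>1 /\<^sub>R t - f y\<^sub>2 /\<^sub>R t) \<le> 1 * norm (y\<^sub>1 - y\<^sub>2)"
            by (simp add: scaleR_diff_right)
        qed
      qed
    qed
  next
    fix e :: real assume "e > 0"
    obtain B where B: "\<And>y. y \<in> M \<Longrightarrow> norm (f y) \<le> B"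
      using compact_imp_bounded[OF compact_continuous_image[OF locally_C1_continuous_on[OF f] M]]
      by (auto simp: bounded_iff)
    show "\<forall>\<^sub>F t in at_top. \<forall>y\<in>M. norm (f y /\<^sub>R t) \<le> e"
      using eventually_ge_at_top[of "max 1 (B / e)"]
    proof eventually_elim
      case (elim t)
      then have "t > 0" "B \<le> t * e" using \<open>e > 0\<close> by (auto simp: field_simps)
      then show ?case using B by (fastforce simp: field_simps intro: order_trans)
    qed
  qed simp
  then obtain T where T: "\<And>t. t \<ge> T \<Longrightarrow> \<forall>y\<^sub>1\<in>M. \<forall>y\<^sub>2\<in>M. norm (f y\<^sub>1 /\<^sub>R t - f y\<^sub>2 /\<^sub>R t) \<le> 1 * norm (y\<^sub>1 - y\<^sub>2)"
    unfolding eventually_at_top_linorder by blast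
  show thesis
  proof (rule that[of "max 1 T"])
    fix y y' assume "y \<in> M" "y' \<in> M"
    then have "norm (f y /\<^sub>R max 1 T - f y' /\<^sub>R max 1 T) \<le> norm (y - y')"
      using T[of "max 1 T"] by simp
    then have "norm ((f y - f y') /\<^sub>R max 1 T) \<le> norm (y - y')"
      by (simp only: scaleR_diff_right)
    then have "norm (f y - f y') / max 1 T \<le> norm (y - y')"
      by (simp add: divide_inverse mult.commute)
    then show "norm (f y - f y') \<le> max 1 T * norm (y - y')"
      by (simp add: pos_divide_le_eq mult.commute)
  qed simp
qed

text \<open>The local extensions have derivatives continuous in time and space together, so the
  difference of two nearby slices has small space derivative; \<open>eventually_lipschitz\<close>
  makes this global.\<close>

lemma locally_C1_family_lipschitz_continuous:
  fixes \<phi> :: "real \<Rightarrow> 'a::euclidean_space \<Rightarrow> 'b::euclidean_space"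
  assumes M: "compact M" and f: "locally_C1 ({0..1} \<times> M) (\<lambda>(t, q). \<phi> t q)"
    and t\<^sub>0: "t\<^sub>0 \<in> {0..1}" and "\<epsilon> > 0"
  obtains \<delta> where "\<delta> > 0" "\<And>t y. t \<in> {0..1} \<Longrightarrow> \<bar>t - t\<^sub>0\<bar> < \<delta> \<Longrightarrow> y \<in> M \<Longrightarrow> norm (\<phi> t y - \<phi> t\<^sub>0 y) \<le> \<epsilon>"
    "\<And>t y y'. t \<in> {0..1} \<Longrightarrow> \<bar>t - t\<^sub>0\<bar> < \<delta> \<Longrightarrow> y \<in> M \<Longrightarrow> y' \<in> M \<Longrightarrow>
      norm ((\<phi> t y - \<phi> t\<^sub>0 y) - (\<phi> t y' - \<phi> t\<^sub>0 y')) \<le> \<epsilon> * norm (y - y')"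
proof -
  let ?F = "at t\<^sub>0 within {0..1}"
  have uc: "uniformly_continuous_on ({0..1} \<times> M) (\<lambda>(t, q). \<phi> t q)"
    by (intro compact_uniformly_continuous locally_C1_continuous_on[OF f] compact_Times M) simp
  have small: "\<forall>\<^sub>F t in ?F. \<forall>y\<in>M. norm (\<phi> t y - \<phi> t\<^sub>0 y) \<le> e" if "e > 0" for e
  proof -
    obtain d where d: "d > 0" "\<And>z z'. z \<in> {0..1} \<times> M \<Longrightarrow> z' \<in> {0..1} \<times> M \<Longrightarrow> dist z' z < d \<Longrightarrow>
        dist (case z' of (t, q) \<Rightarrow> \<phi> t q) (case z of (t, q) \<Rightarrow> \<phi> t q) < e"
      using uc \<open>e > 0\<close> unfolding uniformly_continuous_on_def by blast
    show ?thesis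
      unfolding eventually_at
    proof (intro exI[of _ d] conjI d(1) ballI impI)
      fix t y assume "t \<in> {0..1}" "t \<noteq> t\<^sub>0 \<and> dist t t\<^sub>0 < d" "y \<in> M"
      then show "norm (\<phi> t y - \<phi> t\<^sub>0 y) \<le> e"
        using d(2)[of "(t\<^sub>0, y)" "(t, y)"] t\<^sub>0 by (simp add: dist_Pair_Pair dist_norm)
    qed
  qed
  have "\<forall>\<^sub>F t in ?F. \<forall>y\<^sub>1\<in>M. \<forall>y\<^sub>2\<in>M. norm ((\<phi> t y\<^sub>1 - \<phi> t\<^sub>0 y\<^sub>1) - (\<phi> t y\<^sub>2 - \<phi> t\<^sub>0 y\<^sub>2)) \<le> \<epsilon> * norm (y\<^sub>1 - y\<^sub>2)"
  proof (rule eventually_lipschitz[OF M \<open>\<epsilon> > 0\<close> _ small])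
    fix y assume "y \<in> M"
    then have "(t\<^sub>0, y) \<in> {0..1} \<times> M" using t\<^sub>0 by simp
    from locally_C1E[OF f this]
    obtain U g g' where U: "open U" "(t\<^sub>0, y) \<in> U" "\<And>z. z \<in> U \<Longrightarrow> (g has_derivative blinfun_apply (g' z)) (at z)"
      "continuous_on U g'" "\<And>z. z \<in> {0..1} \<times> M \<Longrightarrow> z \<in> U \<Longrightarrow> g z = (case z of (t, q) \<Rightarrow> \<phi> t q)"
      by blast
    have "isCont g' (t\<^sub>0, y)" using continuous_on_eq_continuous_at[OF U(1)] U(2,4) by blast
    then obtain r\<^sub>1 where r\<^sub>1: "r\<^sub>1 > 0" "\<And>z. dist z (t\<^sub>0, y) < r\<^sub>1 \<Longrightarrow> dist (g' z) (g' (t\<^sub>0, y)) < \<epsilon> / 2"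
      unfolding continuous_at_eps_delta using \<open>\<epsilon> > 0\<close> half_gt_zero by blast
    obtain r\<^sub>2 where r\<^sub>2: "r\<^sub>2 > 0" "ball (t\<^sub>0, y) r\<^sub>2 \<subseteq> U" using U(1,2) open_contains_ball by blast
    define r where "r = min r\<^sub>1 r\<^sub>2 / 2"
    have r: "r > 0" using r\<^sub>1(1) r\<^sub>2(1) by (simp add: r_def)
    have near: "(t, x) \<in> U \<and> norm (g' (t, x) - g' (t\<^sub>0, y)) \<le> \<epsilon> / 2" if "\<bar>t - t\<^sub>0\<bar> < r" "x \<in> ball y r" for t x
    proof -
      have "dist (t, x) (t\<^sub>0, y) \<le> \<bar>t - t\<^sub>0\<bar> + dist x y"
        using norm_Pair_le[of "t - t\<^sub>0" "x - y"] by (simp add: dist_norm)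
      also have "\<dots> < min r\<^sub>1 r\<^sub>2" using that by (simp add: r_def dist_commute)
      finally have "dist (t, x) (t\<^sub>0, y) < r\<^sub>1" "(t, x) \<in> ball (t\<^sub>0, y) r\<^sub>2" by (auto simp: dist_commute)
      then show ?thesis using r\<^sub>1(2)[of "(t, x)"] r\<^sub>2(2) by (auto simp: dist_norm)
    qed
    show "\<exists>r>0. \<forall>\<^sub>F t in ?F. \<forall>y\<^sub>1\<in>M \<inter> ball y r. \<forall>y\<^sub>2\<in>M \<inter> ball y r.
      norm ((\<phi> t y\<^sub>1 - \<phi> t\<^sub>0 y\<^sub>1) - (\<phi> t y\<^sub>2 - \<phi> t\<^sub>0 y\<^sub>2)) \<le> \<epsilon> * norm (y\<^sub>1 - y\<^sub>2)"
      unfolding eventually_at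
    proof (intro exI[of _ r] conjI r ballI impI)
      fix t y\<^sub>1 y\<^sub>2 assume t: "t \<in> {0..1}" "t \<noteq> t\<^sub>0 \<and> dist t t\<^sub>0 < r"
        and y: "y\<^sub>1 \<in> M \<inter> ball y r" "y\<^sub>2 \<in> M \<inter> ball y r"
      \<comment> \<open>Inclusion of the space directions: the mean value estimate runs in space
        alone, with both times fixed.\<close>
      define J :: "'a \<Rightarrow>\<^sub>L (real \<times> 'a)" where "J = Blinfun (\<lambda>v. (0, v))"
      have J: "blinfun_apply J = (\<lambda>v. (0, v))"
        unfolding J_def by (intro bounded_linear_Blinfun_apply bounded_linear_Pair) (auto intro: bounded_linear_intros)
      have normJ: "norm J \<le> 1" by (rule norm_blinfun_bound) (auto simp: J norm_Pair)
      have lift: "((\<lambda>x. (s, x)) has_derivative blinfun_apply J) (at x)" for s and x :: 'a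
        unfolding J by (auto intro!: derivative_eq_intros)
      have t': "\<bar>t - t\<^sub>0\<bar> < r" "\<bar>t\<^sub>0 - t\<^sub>0\<bar> < r" using t r by (auto simp: dist_norm)
      have "norm ((g (t, y\<^sub>1) - g (t\<^sub>0, y\<^sub>1)) - (g (t, y\<^sub>2) - g (t\<^sub>0, y\<^sub>2))) \<le> \<epsilon> * norm (y\<^sub>1 - y\<^sub>2)"
      proof (rule blinfun_derivative_lipschitz[of "ball y r" "\<lambda>x. g (t, x) - g (t\<^sub>0, x)" "\<lambda>x. (g' (t, x) - g' (t\<^sub>0, x)) o\<^sub>L J"])
        show "((\<lambda>x. g (t, x) - g (t\<^sub>0, x)) has_derivative blinfun_apply ((g' (t, x) - g' (t\<^sub>0, x)) o\<^sub>L J)) (at x)"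
          if "x \<in> ball y r" for x
        proof -
          have "((\<lambda>x. g (s, x)) has_derivative (\<lambda>v. g' (s, x) (J v))) (at x)" if "\<bar>s - t\<^sub>0\<bar> < r" for s
            using near[OF that \<open>x \<in> ball y r\<close>] by (intro has_derivative_compose[OF lift U(3)]) auto
          from has_derivative_diff[OF this[OF t'(1)] this[OF t'(2)]]
          show ?thesis by (simp add: blinfun.diff_left blinfun_apply_blinfun_compose[abs_def])
        qed
        show "norm ((g' (t, x) - g' (t\<^sub>0, x)) o\<^sub>L J) \<le> \<epsilon>" if "x \<in> ball y r" for x
        proof -
          have "norm (g' (t, x) - g' (t\<^sub>0, x)) \<le> \<epsilon> / 2 + \<epsilon> / 2"
            using near[OF t'(1) that] near[OF t'(2) that]
              norm_triangle_ineq4[of "g' (t, x) - g' (t\<^sub>0, y)" "g' (t\<^sub>0, x) - g' (t\<^sub>0, y)"] by simp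
          then have "norm (g' (t, x) - g' (t\<^sub>0, x)) * norm J \<le> \<epsilon> * 1"
            using normJ \<open>\<epsilon> > 0\<close> by (intro mult_mono) auto
          then show ?thesis
            using norm_blinfun_compose[of "g' (t, x) - g' (t\<^sub>0, x)" J] by linarith
        qed
      qed (use y in auto)
      moreover have "g (s, x) = \<phi> s x" if "s \<in> {0..1}" "\<bar>s - t\<^sub>0\<bar> < r" "x \<in> M \<inter> ball y r" for s x
        using U(5)[of "(s, x)"] near[of s x] that by auto
      ultimately show "norm ((\<phi> t y\<^sub>1 - \<phi> t\<^sub>0 y\<^sub>1) - (\<phi> t y\<^sub>2 - \<phi> t\<^sub>0 y\<^sub>2)) \<le> \<epsilon> * norm (y\<^sub>1 - y\<^sub>2)"
        using t(1) t\<^sub>0 t' y by simp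
    qed
  qed
  then obtain d\<^sub>1 where d\<^sub>1: "d\<^sub>1 > 0" "\<And>t. t \<in> {0..1} \<Longrightarrow> t \<noteq> t\<^sub>0 \<and> dist t t\<^sub>0 < d\<^sub>1 \<Longrightarrow>
      \<forall>y\<^sub>1\<in>M. \<forall>y\<^sub>2\<in>M. norm ((\<phi> t y\<^sub>1 - \<phi> t\<^sub>0 y\<^sub>1) - (\<phi> t y\<^sub>2 - \<phi> t\<^sub>0 y\<^sub>2)) \<le> \<epsilon> * norm (y\<^sub>1 - y\<^sub>2)"
    unfolding eventually_at by blast
  obtain d\<^sub>2 where d\<^sub>2: "d\<^sub>2 > 0" "\<And>t. t \<in> {0..1} \<Longrightarrow> t \<noteq> t\<^sub>0 \<and> dist t t\<^sub>0 < d\<^sub>2 \<Longrightarrow>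
      \<forall>y\<in>M. norm (\<phi> t y - \<phi> t\<^sub>0 y) \<le> \<epsilon>"
    using small[OF \<open>\<epsilon> > 0\<close>] unfolding eventually_at by blast
  show thesis
  proof (rule that[of "min d\<^sub>1 d\<^sub>2"])
    fix t y y' assume *: "t \<in> {0..1}" "\<bar>t - t\<^sub>0\<bar> < min d\<^sub>1 d\<^sub>2" "y \<in> M"
    show "norm (\<phi> t y - \<phi> t\<^sub>0 y) \<le> \<epsilon>"
      using d\<^sub>2(2)[of t] * \<open>\<epsilon> > 0\<close> by (cases "t = t\<^sub>0") (auto simp: dist_norm)
    assume "y' \<in> M"
    then show "norm ((\<phi> t y - \<phi> t\<^sub>0 y) - (\<phi> t y' - \<phi> t\<^sub>0 y')) \<le> \<epsilon> * norm (y - y')"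
      using d\<^sub>1(2)[of t] * \<open>\<epsilon> > 0\<close> by (cases "t = t\<^sub>0") (auto simp: dist_norm)
  qed (use d\<^sub>1 d\<^sub>2 in simp)
qed

lemma compact_torus_sphere: "compact (torus_sphere :: ((complex ^ 'n) \<times> (real ^ 'n)) set)"
proof -
  have eq: "(torus :: (complex ^ 'n) set) = (\<Inter>i. {z. norm (z $ i) = 1})" by (auto simp: torus_iff)
  have "closed (torus :: (complex ^ 'n) set)"
    unfolding eq by (intro closed_INT ballI closed_Collect_eq continuous_intros)
  moreover have "bounded (torus :: (complex ^ 'n) set)"
  proof (rule boundedI)
    fix z :: "complex ^ 'n" assume "z \<in> torus"
    then show "norm z \<le> CARD('n)"
      using L2_set_le_sum[of UNIV "\<lambda>i. norm (z $ i)"] by (simp add: norm_vec_def torus_iff)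
  qed
  ultimately have "compact (torus :: (complex ^ 'n) set)" by (simp add: compact_eq_bounded_closed)
  then show ?thesis unfolding torus_sphere_def by (intro compact_Times) auto
qed

text \<open>A derivative within M is determined only on tangent vectors, so the chain rule along a
  curve takes the place of uniqueness of derivatives.\<close>

lemma has_derivative_id_on_tangent_space:
  assumes v: "v \<in> tangent_space M q" and h: "(h has_derivative D) (at q within M)"
    and id: "\<And>x. x \<in> M \<Longrightarrow> h x = x"
  shows "D v = v"
proof -
  obtain \<gamma> e where \<gamma>: "e > 0" "\<gamma> ` {-e<..<e} \<subseteq> M" "\<gamma> 0 = q" "(\<gamma> has_vector_derivative v) (at 0)"
    using v unfolding tangent_space_def by blast
  have at0: "at (0::real) within {-e<..<e} = at 0" using \<gamma>(1) by (intro at_within_open) auto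
  have der\<gamma>: "(\<gamma> has_derivative (\<lambda>t. t *\<^sub>R v)) (at 0 within {-e<..<e})"
    using \<gamma>(4) unfolding at0 has_vector_derivative_def .
  have "(h has_derivative D) (at (\<gamma> 0) within \<gamma> ` {-e<..<e})"
    unfolding \<gamma>(3) by (rule has_derivative_subset[OF h \<gamma>(2)])
  from has_derivative_in_compose[OF der\<gamma> this]
  have "((\<lambda>t. h (\<gamma> t)) has_derivative (\<lambda>t. D (t *\<^sub>R v))) (at 0)" unfolding at0 .
  then have "(\<gamma> has_derivative (\<lambda>t. D (t *\<^sub>R v))) (at 0)"
    by (rule has_derivative_transform_within_open[of _ _ _ _ "{-e<..<e}"])
      (use \<gamma>(1,2) id in \<open>auto simp: image_subset_iff\<close>)
  from has_derivative_unique[OF this \<gamma>(4)[unfolded has_vector_derivative_def]]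
  have "D (1 *\<^sub>R v) = 1 *\<^sub>R v" by (rule fun_cong)
  then show ?thesis by simp
qed

text \<open>The inverse of A is known to be smooth but not to preserve \<xi>. It does, since
  \<open>D\<^sub>B\<close> undoes \<open>D\<^sub>A\<close> on tangent vectors, hence on \<xi>, and
  \<open>D\<^sub>A\<close> maps \<xi> onto \<xi>.\<close>

lemma preserves_distribution_comp_inverse:
  assumes A: "diffeomorphism_of M A" "preserves_distribution M \<xi> A"
    and C: "preserves_distribution M \<xi> C"
    and \<xi>: "\<And>q. q \<in> M \<Longrightarrow> \<xi> q \<subseteq> tangent_space M q" and q: "q \<in> M"
  shows "\<exists>D. ((\<lambda>y. C (inv_into M A y)) has_derivative D) (at (A q) within M) \<and> D ` \<xi> (A q) \<subseteq> \<xi> (C q)"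
proof -
  let ?B = "inv_into M A"
  have bij: "bij_betw A M M" and smooth: "smooth_on M ?B"
    using A(1) by (auto simp: diffeomorphism_of_def)
  have Aq: "A q \<in> M" using bij q by (auto simp: bij_betw_def)
  have BA: "?B (A x) = x" if "x \<in> M" for x using bij_betw_inv_into_left[OF bij that] .
  have imA: "A ` M = M" and imB: "?B ` M = M"
    using bij bij_betw_inv_into[OF bij] by (auto simp: bij_betw_def)
  obtain D\<^sub>A where D\<^sub>A: "(A has_derivative D\<^sub>A) (at q within M)" "D\<^sub>A ` \<xi> q = \<xi> (A q)"
    using A(2) q unfolding preserves_distribution_def by metis
  obtain D\<^sub>C where D\<^sub>C: "(C has_derivative D\<^sub>C) (at q within M)" "D\<^sub>C ` \<xi> q = \<xi> (C q)"
    using C q unfolding preserves_distribution_def by metis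
  obtain D\<^sub>B where D\<^sub>B: "(?B has_derivative D\<^sub>B) (at (A q) within M)"
    by (rule locally_C1_has_derivative_within[OF smooth_on_imp_locally_C1[OF smooth] Aq])
  have "((\<lambda>x. ?B (A x)) has_derivative (\<lambda>v. D\<^sub>B (D\<^sub>A v))) (at q within M)"
    by (rule has_derivative_in_compose[OF D\<^sub>A(1)]) (simp add: imA D\<^sub>B)
  note BA_der = this
  have BA': "D\<^sub>B (D\<^sub>A v) = v" if "v \<in> \<xi> q" for v
    by (rule has_derivative_id_on_tangent_space[OF _ BA_der BA]) (use \<xi>[OF q] that in auto)
  have "((\<lambda>y. C (?B y)) has_derivative (\<lambda>v. D\<^sub>C (D\<^sub>B v))) (at (A q) within M)"
    by (rule has_derivative_in_compose[OF D\<^sub>B]) (simp add: imB BA[OF q] D\<^sub>C(1))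
  moreover have "(\<lambda>v. D\<^sub>C (D\<^sub>B v)) ` \<xi> (A q) \<subseteq> \<xi> (C q)"
    unfolding D\<^sub>A(2)[symmetric] using D\<^sub>C(2) BA' by auto
  ultimately show ?thesis by blast
qed

text \<open>Nothing is assumed about how the inverses depend on time, so only the inverse at
  \<open>t\<^sub>0\<close> gets a Lipschitz constant L. For a near \<open>t\<^sub>0\<close> the map
  \<open>\<phi> a\<close> is a small Lipschitz perturbation of \<open>\<phi> t\<^sub>0\<close>, so
  its inverse has constant 2 L, uniformly in a.\<close>

lemma contact_isotopy_small_steps:
  fixes \<phi> :: "real \<Rightarrow> (complex ^ 'n) \<times> (real ^ 'n) \<Rightarrow> (complex ^ 'n) \<times> (real ^ 'n)"
  assumes iso: "contact_isotopy torus_sphere standard_contact_structure \<phi>"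
    and t\<^sub>0: "t\<^sub>0 \<in> {0..1}" and "\<epsilon> > 0"
  obtains d where "d > 0" "\<And>a b. a \<in> {0..1} \<Longrightarrow> b \<in> {0..1} \<Longrightarrow> \<bar>a - t\<^sub>0\<bar> < d \<Longrightarrow> \<bar>b - t\<^sub>0\<bar> < d \<Longrightarrow>
    small_contact_map \<epsilon> (\<lambda>y. \<phi> b (inv_into torus_sphere (\<phi> a) y))"
proof -
  let ?M = "torus_sphere :: ((complex ^ 'n) \<times> (real ^ 'n)) set"
  have C1: "locally_C1 ({0..1} \<times> ?M) (\<lambda>(t, q). \<phi> t q)"
    using iso unfolding contact_isotopy_def by (intro smooth_on_imp_locally_C1) simp
  have diffeo: "diffeomorphism_of ?M (\<phi> t)" and pres: "preserves_distribution ?M standard_contact_structure (\<phi> t)"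
    if "t \<in> {0..1}" for t
    using iso that unfolding contact_isotopy_def by auto
  have bij: "bij_betw (\<phi> t) ?M ?M" and smooth: "locally_C1 ?M (\<phi> t)" "locally_C1 ?M (inv_into ?M (\<phi> t))"
    if "t \<in> {0..1}" for t
    using diffeo[OF that] by (auto simp: diffeomorphism_of_def intro: smooth_on_imp_locally_C1)
  obtain L where L: "L \<ge> 1" "\<And>y y'. y \<in> ?M \<Longrightarrow> y' \<in> ?M \<Longrightarrow>
      norm (inv_into ?M (\<phi> t\<^sub>0) y - inv_into ?M (\<phi> t\<^sub>0) y') \<le> L * norm (y - y')"
    using locally_C1_compact_lipschitz[OF compact_torus_sphere smooth(2)[OF t\<^sub>0]] by blast
  \<comment> \<open>2 L \<eta> \<le> 1 yields the constant 2 L for the inverse of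
    \<open>\<phi> a\<close>; then \<phi> b - \<phi> a, with constant 2 \<eta>, composed with that
    inverse has constant 4 L \<eta> \<le> \<epsilon>.\<close>
  define \<eta> where "\<eta> = min (\<epsilon> / (4 * L)) (1 / (2 * L))"
  have \<eta>: "\<eta> > 0" "4 * L * \<eta> \<le> \<epsilon>" "2 * L * \<eta> \<le> 1"
    using L(1) \<open>\<epsilon> > 0\<close> by (auto simp: \<eta>_def min_def field_simps)
  have "2 * \<eta> \<le> \<epsilon>"
  proof -
    have "2 * \<eta> \<le> 4 * L * \<eta>" using L(1) \<eta>(1) by simp
    then show ?thesis using \<eta>(2) by linarith
  qed
  obtain d where d: "d > 0"
    "\<And>t y. t \<in> {0..1} \<Longrightarrow> \<bar>t - t\<^sub>0\<bar> < d \<Longrightarrow> y \<in> ?M \<Longrightarrow> norm (\<phi> t y - \<phi> t\<^sub>0 y) \<le> \<eta>"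
    "\<And>t y y'. t \<in> {0..1} \<Longrightarrow> \<bar>t - t\<^sub>0\<bar> < d \<Longrightarrow> y \<in> ?M \<Longrightarrow> y' \<in> ?M \<Longrightarrow>
      norm ((\<phi> t y - \<phi> t\<^sub>0 y) - (\<phi> t y' - \<phi> t\<^sub>0 y')) \<le> \<eta> * norm (y - y')"
    by (rule locally_C1_family_lipschitz_continuous[OF compact_torus_sphere C1 t\<^sub>0 \<eta>(1)]) blast
  show thesis
  proof (rule that[OF d(1)])
    fix a b assume a: "a \<in> {0..1}" "\<bar>a - t\<^sub>0\<bar> < d" and b: "b \<in> {0..1}" "\<bar>b - t\<^sub>0\<bar> < d"
    let ?B = "inv_into ?M (\<phi> a)"
    have B: "?B y \<in> ?M" "\<phi> a (?B y) = y" if "y \<in> ?M" for y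
      using bij[OF a(1)] that by (auto simp: bij_betw_def inv_into_into f_inv_into_f)
    have maps: "\<phi> t y \<in> ?M" if "t \<in> {0..1}" "y \<in> ?M" for t y
      using bij[OF that(1)] that(2) by (auto simp: bij_betw_def)
    have inv\<^sub>0: "inv_into ?M (\<phi> t\<^sub>0) (\<phi> t\<^sub>0 y) = y" if "y \<in> ?M" for y
      using bij_betw_inv_into_left[OF bij[OF t\<^sub>0] that] .
    have step: "norm (\<phi> b y - \<phi> a y) \<le> 2 * \<eta>" if "y \<in> ?M" for y
      using d(2)[OF b that] d(2)[OF a that] norm_triangle_ineq4[of "\<phi> b y - \<phi> t\<^sub>0 y" "\<phi> a y - \<phi> t\<^sub>0 y"] by simp
    have step_lip: "norm ((\<phi> b y - \<phi> a y) - (\<phi> b y' - \<phi> a y')) \<le> 2 * \<eta> * norm (y - y')" if "y \<in> ?M" "y' \<in> ?M" for y y'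
    proof -
      have "(\<phi> b y - \<phi> a y) - (\<phi> b y' - \<phi> a y') =
          ((\<phi> b y - \<phi> t\<^sub>0 y) - (\<phi> b y' - \<phi> t\<^sub>0 y')) - ((\<phi> a y - \<phi> t\<^sub>0 y) - (\<phi> a y' - \<phi> t\<^sub>0 y'))"
        by (simp add: algebra_simps)
      also have "norm \<dots> \<le> \<eta> * norm (y - y') + \<eta> * norm (y - y')"
        by (intro norm_triangle_le_diff add_mono d(3) a b that)
      finally show ?thesis by simp
    qed
    have inv_lip: "norm (q - q') \<le> 2 * L * norm (\<phi> a q - \<phi> a q')" if "q \<in> ?M" "q' \<in> ?M" for q q'
    proof -
      have "norm (q - q') \<le> L * norm (\<phi> t\<^sub>0 q - \<phi> t\<^sub>0 q')"
        using L(2)[OF maps[OF t\<^sub>0 that(1)] maps[OF t\<^sub>0 that(2)]] by (simp add: inv\<^sub>0 that)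
      also have "\<dots> \<le> L * (norm (\<phi> a q - \<phi> a q') + \<eta> * norm (q - q'))"
      proof (rule mult_left_mono)
        have "\<phi> t\<^sub>0 q - \<phi> t\<^sub>0 q' = (\<phi> a q - \<phi> a q') - ((\<phi> a q - \<phi> t\<^sub>0 q) - (\<phi> a q' - \<phi> t\<^sub>0 q'))"
          by (simp add: algebra_simps)
        also have "norm \<dots> \<le> norm (\<phi> a q - \<phi> a q') + \<eta> * norm (q - q')"
          by (intro norm_triangle_le_diff add_mono d(3) a that order_refl)
        finally show "norm (\<phi> t\<^sub>0 q - \<phi> t\<^sub>0 q') \<le> norm (\<phi> a q - \<phi> a q') + \<eta> * norm (q - q')" .
      qed (use L(1) in simp)
      finally have *: "norm (q - q') \<le> L * norm (\<phi> a q - \<phi> a q') + L * \<eta> * norm (q - q')"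
        by (simp add: algebra_simps)
      have "L * \<eta> * norm (q - q') \<le> 1 / 2 * norm (q - q')"
        using \<eta>(3) by (intro mult_right_mono) auto
      with * have "norm (q - q') \<le> 2 * (L * norm (\<phi> a q - \<phi> a q'))" by linarith
      then show ?thesis by simp
    qed
    show "small_contact_map \<epsilon> (\<lambda>y. \<phi> b (?B y))"
      unfolding small_contact_map_def
    proof (intro conjI ballI)
      show "(\<lambda>y. \<phi> b (?B y)) ` ?M \<subseteq> ?M" using B maps b(1) by blast
      show "locally_C1 ?M (\<lambda>y. \<phi> b (?B y))"
        by (rule locally_C1_compose[OF smooth(2)[OF a(1)] smooth(1)[OF b(1)]]) (use B in blast)
    next
      fix y assume y: "y \<in> ?M"
      show "norm (\<phi> b (?B y) - y) \<le> \<epsilon>"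
        using step[OF B(1)[OF y]] \<open>2 * \<eta> \<le> \<epsilon>\<close> by (simp add: B(2)[OF y])
      have "\<exists>D. ((\<lambda>y. \<phi> b (?B y)) has_derivative D) (at (\<phi> a (?B y)) within ?M) \<and>
          D ` standard_contact_structure (\<phi> a (?B y)) \<subseteq> standard_contact_structure (\<phi> b (?B y))"
        by (rule preserves_distribution_comp_inverse[OF diffeo[OF a(1)] pres[OF a(1)] pres[OF b(1)] _ B(1)[OF y]])
          (auto simp: standard_contact_structure_def)
      then show "\<exists>D. ((\<lambda>y. \<phi> b (?B y)) has_derivative D) (at y within ?M) \<and>
          D ` standard_contact_structure y \<subseteq> standard_contact_structure (\<phi> b (?B y))"
        by (simp only: B(2)[OF y])
    next
      fix y y' assume y: "y \<in> ?M" "y' \<in> ?M"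
      have "norm ((\<phi> b (?B y) - y) - (\<phi> b (?B y') - y')) \<le> 2 * \<eta> * norm (?B y - ?B y')"
        using step_lip[OF B(1)[OF y(1)] B(1)[OF y(2)]] by (simp add: B(2) y)
      also have "\<dots> \<le> 2 * \<eta> * (2 * L * norm (y - y'))"
        using inv_lip[OF B(1)[OF y(1)] B(1)[OF y(2)]] \<eta>(1) by (intro mult_left_mono) (simp_all add: B(2) y)
      also have "\<dots> = 4 * L * \<eta> * norm (y - y')" by simp
      also have "\<dots> \<le> \<epsilon> * norm (y - y')" using \<eta>(2) by (rule mult_right_mono) simp
      finally show "norm ((\<phi> b (?B y) - y) - (\<phi> b (?B y') - y')) \<le> \<epsilon> * norm (y - y')" .
    qed
  qed
qed

text \<open>Reaching time b from time a by finitely many small maps is transitive and possible near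
  every time, so bisection gives it on [0, 1]. The fold applies the head of the list first.\<close>

lemma contact_isotopy_fragmentation:
  fixes \<phi> :: "real \<Rightarrow> (complex ^ 'n) \<times> (real ^ 'n) \<Rightarrow> (complex ^ 'n) \<times> (real ^ 'n)"
  assumes iso: "contact_isotopy torus_sphere standard_contact_structure \<phi>" and "\<epsilon> > 0"
  obtains fs where "\<And>f. f \<in> set fs \<Longrightarrow> small_contact_map \<epsilon> f"
    "\<And>y. y \<in> torus_sphere \<Longrightarrow> fold (\<lambda>f. f) fs (\<phi> 0 y) = \<phi> 1 y"
proof -
  \<comment> \<open>The guards make \<open>P\<close> trivially true for intervals that leave [0, 1],
    which the local condition of the bisection principle also ranges over.\<close>
  define P where "P a b \<longleftrightarrow> (0 \<le> a \<longrightarrow> b \<le> 1 \<longrightarrow> (\<exists>fs. (\<forall>f\<in>set fs. small_contact_map \<epsilon> f) \<and>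
    (\<forall>y\<in>torus_sphere. fold (\<lambda>f. f) fs (\<phi> a y) = \<phi> b y)))" for a b :: real
  have "P 0 1"
  proof (rule Bolzano[where P = P])
    fix a b c assume trans: "P a b" "P b c" "a \<le> b" "b \<le> c"
    show "P a c" unfolding P_def
    proof (intro impI)
      assume "0 \<le> a" "c \<le> 1"
      then have "0 \<le> b" "b \<le> 1" using trans(3,4) by auto
      from trans(1)[unfolded P_def, THEN mp, THEN mp, OF \<open>0 \<le> a\<close> \<open>b \<le> 1\<close>]
      obtain fs where fs: "(\<forall>f\<in>set fs. small_contact_map \<epsilon> f) \<and> (\<forall>y\<in>torus_sphere. fold (\<lambda>f. f) fs (\<phi> a y) = \<phi> b y)" ..
      from trans(2)[unfolded P_def, THEN mp, THEN mp, OF \<open>0 \<le> b\<close> \<open>c \<le> 1\<close>]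
      obtain gs where gs: "(\<forall>f\<in>set gs. small_contact_map \<epsilon> f) \<and> (\<forall>y\<in>torus_sphere. fold (\<lambda>f. f) gs (\<phi> b y) = \<phi> c y)" ..
      show "\<exists>fs. (\<forall>f\<in>set fs. small_contact_map \<epsilon> f) \<and> (\<forall>y\<in>torus_sphere. fold (\<lambda>f. f) fs (\<phi> a y) = \<phi> c y)"
      proof (intro exI conjI)
        show "\<forall>f\<in>set (fs @ gs). small_contact_map \<epsilon> f"
          using conjunct1[OF fs] conjunct1[OF gs] unfolding set_append by blast
        show "\<forall>y\<in>torus_sphere. fold (\<lambda>f. f) (fs @ gs) (\<phi> a y) = \<phi> c y"
          using conjunct2[OF fs] conjunct2[OF gs] by simp
      qed
    qed
  next
    fix x :: real assume local: "0 \<le> x" "x \<le> 1"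
    then have "x \<in> {0..1}" by simp
    from contact_isotopy_small_steps[OF iso this \<open>\<epsilon> > 0\<close>]
    obtain d where d: "d > 0" "\<And>a b. a \<in> {0..1} \<Longrightarrow> b \<in> {0..1} \<Longrightarrow> \<bar>a - x\<bar> < d \<Longrightarrow> \<bar>b - x\<bar> < d \<Longrightarrow>
      small_contact_map \<epsilon> (\<lambda>y. \<phi> b (inv_into torus_sphere (\<phi> a) y))" by blast
    show "\<exists>d>0. \<forall>a b. a \<le> x \<and> x \<le> b \<and> b - a < d \<longrightarrow> P a b"
    proof (intro exI[of _ d] conjI d(1) allI impI)
      fix a b assume ab: "a \<le> x \<and> x \<le> b \<and> b - a < d"
      show "P a b" unfolding P_def
      proof (intro impI)
        assume "0 \<le> a" "b \<le> 1"
        then have a: "a \<in> {0..1}" "b \<in> {0..1}" "\<bar>a - x\<bar> < d" "\<bar>b - x\<bar> < d" using ab local by auto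
        have "bij_betw (\<phi> a) torus_sphere torus_sphere"
          using iso a(1) unfolding contact_isotopy_def diffeomorphism_of_def by blast
        then have "inv_into torus_sphere (\<phi> a) (\<phi> a y) = y" if "y \<in> torus_sphere" for y
          using that by (rule bij_betw_inv_into_left)
        then show "\<exists>fs. (\<forall>f\<in>set fs. small_contact_map \<epsilon> f) \<and> (\<forall>y\<in>torus_sphere. fold (\<lambda>f. f) fs (\<phi> a y) = \<phi> b y)"
          using d(2)[OF a] by (intro exI[of _ "[\<lambda>y. \<phi> b (inv_into torus_sphere (\<phi> a) y)]"]) auto
      qed
    qed
  qed simp
  then show thesis using that unfolding P_def by auto
qed

theorem proposition1p4:
  fixes p :: "real ^ 'n"
  assumes "CARD('n) \<ge> 2"
    and "p \<in> sphere 0 1"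
  shows "non_displaceable torus_sphere standard_contact_structure (torus \<times> {p})"
  unfolding non_displaceable_def
proof (intro allI impI)
  fix \<phi> :: "real \<Rightarrow> (complex ^ 'n) \<times> (real ^ 'n) \<Rightarrow> (complex ^ 'n) \<times> (real ^ 'n)"
  assume \<phi>: "contact_isotopy torus_sphere standard_contact_structure \<phi> \<and> (\<forall>q\<in>torus_sphere. \<phi> 0 q = q)"
  have p: "norm p = 1" "p \<noteq> 0" using assms(2) by auto
  let ?\<epsilon> = "1 / (20 * (CARD('n) + 1)\<^sup>2)"
  have param: "torus_param (q, p) \<in> torus \<times> {p}" for q
    using p by (simp add: torus_param_def torus_iff sgn_div_norm)
  have sub: "torus \<times> {p} \<subseteq> torus_sphere" using p by (auto simp: torus_sphere_def)
  have "?\<epsilon> > 0" by simp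
  from contact_isotopy_fragmentation[OF conjunct1[OF \<phi>] this]
  obtain fs where fs: "\<And>f. f \<in> set fs \<Longrightarrow> small_contact_map ?\<epsilon> f"
    "\<And>y. y \<in> torus_sphere \<Longrightarrow> fold (\<lambda>f. f) fs (\<phi> 0 y) = \<phi> 1 y" by blast
  have \<phi>1: "\<phi> 1 y = fold (\<lambda>f. f) fs y" if "y \<in> torus \<times> {p}" for y
    using fs(2)[of y] \<phi> that sub by auto
  have "\<exists>q q'. fold (\<lambda>f. f) fs (torus_param (q, p)) = torus_param (q', p)"
  \<comment> \<open>The action is indexed by 0 to m, that is by m + 1 maps; the empty composition is
    the identity.\<close>
  proof (cases "length fs")
    case (Suc m)
    define R where "R k s g \<longleftrightarrow> (k \<le> m \<longrightarrow> generating_function s g \<and>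
        (\<forall>Q p. p \<noteq> 0 \<longrightarrow> (fs ! k) (torus_param (Q + snd (g (Q, p)), p)) = torus_param (Q, p + fst (g (Q, p)))))"
      for k s g
    have "\<exists>s g. R k s g" for k
    proof (cases "k \<le> m")
      case True
      then have "fs ! k \<in> set fs" using Suc by simp
      show ?thesis
      proof (rule small_contact_map_generating_function[OF fs(1)[OF \<open>fs ! k \<in> set fs\<close>]])
        fix s g
        assume "generating_function s g" "\<And>Q p. p \<noteq> 0 \<Longrightarrow>
          (fs ! k) (torus_param (Q + snd (g (Q, p)), p)) = torus_param (Q, p + fst (g (Q, p)))"
        then have "R k s g" by (simp add: R_def)
        then show ?thesis by (intro exI)
      qed
    qed (simp add: R_def)
    then have "\<forall>k. \<exists>s g. R k s g" by blast
    from choice[OF this] obtain s where "\<forall>k. \<exists>g. R k (s k) g" ..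
    from choice[OF this] obtain g where "\<forall>k. R k (s k) (g k)" ..
    then have gen: "\<And>k. k \<le> m \<Longrightarrow> generating_function (s k) (g k)"
      and fsk: "\<And>k Q p. k \<le> m \<Longrightarrow> p \<noteq> 0 \<Longrightarrow>
        (fs ! k) (torus_param (Q + snd (g k (Q, p)), p)) = torus_param (Q, p + fst (g k (Q, p)))"
      unfolding R_def by simp_all
    show ?thesis
    proof (rule generating_functions_trajectory[of m s g p])
      show "generating_function (s k) (g k)" if "k \<le> m" for k by (rule gen[OF that])
      show "p \<noteq> 0" by (rule p(2))
    next
      fix Q P
      assume P0: "P 0 = p" and P: "\<And>k. k \<le> m \<Longrightarrow> P k \<noteq> 0"
        and PSuc: "\<And>k. k < m \<Longrightarrow> P (Suc k) = P k + fst (g k (Q k, P k))"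
        and QSuc: "\<And>k. k < m \<Longrightarrow> Q k = Q (Suc k) + snd (g (Suc k) (Q (Suc k), P (Suc k)))"
        and Pm: "p = P m + fst (g m (Q m, P m))"
      \<comment> \<open>The point at which map k is applied: its position is Q_k +
        \<partial>s_k/\<partial>p. The recursion for Q says that map k ends at the position where
        map k + 1 starts.\<close>
      define y where "y k = torus_param (Q k + snd (g k (Q k, P k)), P k)" for k
      have step: "(fs ! k) (y k) = y (Suc k)" if "k < m" for k
      proof -
        have "(fs ! k) (y k) = torus_param (Q k, P (Suc k))"
          unfolding y_def PSuc[OF that] using that by (intro fsk P) auto
        then show ?thesis unfolding y_def QSuc[OF that, symmetric] .
      qed
      have "fold (\<lambda>f. f) (take k fs) (y 0) = y k" if "k \<le> m" for k
        using that
      proof (induction k)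
        case (Suc k)
        then show ?case using \<open>length fs = Suc m\<close> step[of k] by (simp add: take_Suc_conv_app_nth)
      qed simp
      then have take_m: "fold (\<lambda>f. f) (take m fs) (y 0) = y m" by simp
      have "fs = take m fs @ [fs ! m]" using take_Suc_conv_app_nth[of m fs] Suc by simp
      then have "fold (\<lambda>f. f) fs (y 0) = fold (\<lambda>f. f) (take m fs @ [fs ! m]) (y 0)"
        by (rule arg_cong[where f = "\<lambda>l. fold (\<lambda>f. f) l (y 0)"])
      also have "\<dots> = (fs ! m) (y m)" by (simp add: take_m)
      \<comment> \<open>Here the closing condition enters: the trajectory ends with momentum
        \<open>p\<close>, hence over the fiber where it began.\<close>
      also have "\<dots> = torus_param (Q m, p)"
        using fsk[OF order_refl P[OF order_refl], of "Q m"] unfolding y_def Pm[symmetric] .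
      finally have "fold (\<lambda>f. f) fs (y 0) = torus_param (Q m, p)" .
      then show ?thesis unfolding y_def P0 by blast
    qed
  qed auto
  then obtain q q' where "fold (\<lambda>f. f) fs (torus_param (q, p)) = torus_param (q', p)" by blast
  then have "\<phi> 1 (torus_param (q, p)) = torus_param (q', p)" using \<phi>1[OF param] by simp
  then show "\<phi> 1 ` (torus \<times> {p}) \<inter> (torus \<times> {p}) \<noteq> {}"
    using param by (metis IntI empty_iff imageI)
qed

end
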